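(* Let $\alpha$ be irrational with bounded partial quotients, with denominators of best rational approximations $(q_s)$. Let $f\in C^2(\mathbb{T}\setminus\{a_1,\dots,a_k\})$, $f>0$, $f\in L^1(\mathbb{T})$, have singularities of type $h$ at $\{a_1,\dots,a_k\}$ with constants $A_i,B_i\ge0$. Suppose the set of singularities is divided into $F=\{a_1,\dots,a_v\}$ and $E=\{a_{v+1},\dots,a_k\}$, with $E$ nonempty, such that: (i) $A_i^2+B_i^2>0$ for every $i\in\{v+1,\dots,k\}$; (ii) for every $i\in\{1,\dots,v\}$, $a_i$ is a singularity of $f$ of type $g_i$, where $g_i$ is a positive function in $C^2(\mathbb{T}\setminus\{0\})$, decreasing on $(0,1)$, with $g_i'$ increasing on $(0,1)$, such that $\lim_{x\to a_i^+}\left|\frac{f'(x)}{g_i'(x-a_i)}\right|$ and $\lim_{x\to a_i^-}\left|\frac{f'(x)}{g_i'(a_i-x)}\right|$ exist and are finite; $\lim_{x\to0^+}\frac{g_i(x)}{h(x)}=0$; and for every $s\in\mathbb{N}$ there exists $x_{i,s}\in(0,1)$ with $x_{i,s}>\frac{1}{q_sh(\frac1{2q_s})}$ such that $\lim_{s\to+\infty}\frac{g_i'(x_{i,s})}{h'(\frac1{2q_s})}=0$ and $\sum_{s}q_sx_{i,s}<+\infty$. Assume that $\{a_{v+1},\dots,a_k\}$ is badly approximable by $\alpha$ with some constant $C>1$, and that there exist constants $D_1,D_2>0$ such that for every $s\in\mathbb{N}$ $$D_2>\frac{-h'(\frac{1}{C^4q_s})}{q_sh(\frac1{2q_s})}>D_1\quad\text{and}\quad\frac{h(\frac1{2q_s})}{h(\frac1{2q_{s+1}})}>D_1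 .$$ Then the special flow $(T^f_t)_{t\in\mathbb{R}}$ above the rotation $R_\alpha$ and under $f$ has the SWR-property.
   Context: $\mathbb{T}=\mathbb{R}/\mathbb{Z}$, with Lebesgue (Haar) measure $\lambda$ and metric $\|x-y\|$ (distance to the nearest integer); functions on $\mathbb{T}\setminus\{0\}$ are identified with functions on $(0,1)$; $R_\alpha x=x+\alpha$. Denominators: $(q_s)_{s\ge0}$ is the unique increasing sequence of integers with $q_0=1$ and $\|q_s\alpha\|<\|k\alpha\|$ for every $1\le k<q_{s+1}$, $k\ne q_s$. Bounded partial quotients means: there is a constant $r_\alpha$ with $q_{n+1}<r_\alpha q_n$ for all $n$. Singularities of type $h$: $h$ is a positive function in $C^2(\mathbb{T}\setminus\{0\})$, decreasing on $(0,1)$, with $\lim_{x\to0^+}h(x)=+\infty$ and $h'$ increasing on $(0,1)$. A function $f\in C^2(\mathbb{T}\setminus\{a_1,\dots,a_k\})$ has singularities of type $h$ at $\{a_1,\dots,a_k\}$ if for each $i$, $\lim_{x\to a_i^+}\frac{f'(x)}{h'(x-a_i)}=A_i$ and $\lim_{x\to a_i^-}\frac{f'(x)}{h'(a_i-x)}=-B_i$ for some numbers $A_i,B_i\ge0$ (possibly zero). The same terminology is used at a single singularity and with other functions in place of $h$. Badly approximable: a finite set $\{b_1,\dots,b_m\}\subset\mathbb{T}$ is badly approximable by $\alpha$ (with constant $C>1$) if for every $x\in\mathbb{T}$ and every $s\in\mathbb{N}$ there is at most one $i_0\in\{0,\dots,q_s-1\}$ with $x+i_0\alpha\in\bigcup_{i=1}^m\left[b_i-\frac1{2Cq_s},b_i+\frac1{2Cq_s}\right]$.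 Special flow: let $T$ be an automorphism of $(X,\mathscr{B},\mu)$, and let $f>0$, $f\in L^1(X,\mu)$. The special flow $(T^f_t)$ above $T$ and under $f$ acts on $X^f=\{(x,s): x\in X,\ 0\le s<f(x)\}$ (equivalently on $X\times\mathbb{R}$ modulo $(x,s+f(x))\sim(Tx,s)$) by $T^f_t(x,s)=(T^nx,\,t+s-f^{(n)}(x))$, where $n\in\mathbb{Z}$ is the unique integer with $f^{(n)}(x)\le t+s<f^{(n+1)}(x)$. Here $f^{(n)}(x)=f(x)+\dots+f(T^{n-1}x)$ for $n>0$, $f^{(0)}=0$, and $f^{(n)}(x)=-(f(T^nx)+\dots+f(T^{-1}x))$ for $n<0$. It preserves the normalized restriction of $\mu\otimes$Lebesgue to $X^f$. If $(X,d)$ is a metric space, $X^f$ carries the metric $d^f((x,s),(x',s'))=d(x,x')+|s-s'|$. SWR-property: let $(T_t)_{t\in\mathbb{R}}$ be an ergodic flow on a standard Borel probability space $(X,\mathscr{B},\mu)$, with $X$ a metric space with metric $d$. Let $t_0>0$ and $P\subset\mathbb{R}\setminus\{0\}$ compact. The flow has the switchable $R(t_0,P)$-property if for every $\epsilon>0$ and $N\in\mathbb{N}$ there exist $\kappa=\kappa(\epsilon)>0$, $\delta=\delta(\epsilon,N)>0$ and $Z=Z(\epsilon,N)\in\mathscr{B}$ with $\mu(Z)>1-\epsilon$ such that for any $x,y\in Z$ with $d(x,y)<\delta$ and $x$ not in the orbit of $y$, there exist $M,L\in\mathbb{N}$ with $M,L>N$ and $L/M\ge\kappa$, and $p\in P$,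 such that $\frac1L|\{n\in[M,M+L]\cap\mathbb{Z}: d(T_{nt_0}(x),T_{nt_0+p}(y))<\epsilon\}|>1-\epsilon$ or $\frac1L|\{n\in[M,M+L]\cap\mathbb{Z}: d(T_{-nt_0}(x),T_{-nt_0+p}(y))<\epsilon\}|>1-\epsilon$. The flow has the SWR-property if for some compact $P\subset\mathbb{R}\setminus\{0\}$ the set of $t_0>0$ for which it has the switchable $R(t_0,P)$-property is uncountable. *)

theory Defs
  imports "HOL-Probability.Probability"
begin

section \<open>The circle and its rotations\<close>

text \<open>
  The circle R/Z is represented by its fundamental domain [0,1). Real functions on the circle
  are functions on the reals of period 1, so that no special care is needed at the point 0.
\<close>

definition circle_norm :: "real \<Rightarrow> real" where
  "circle_norm x = \<bar>x - of_int (round x)\<bar>"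

definition circle_dist :: "real \<Rightarrow> real \<Rightarrow> real" where
  "circle_dist x y = circle_norm (x - y)"

definition circle_measure :: "real measure" where
  "circle_measure = restrict_space lborel {0..<1}"

definition rotation :: "real \<Rightarrow> real \<Rightarrow> real" where
  "rotation \<alpha> x = frac (x + \<alpha>)"

definition denominators :: "real \<Rightarrow> (nat \<Rightarrow> nat) \<Rightarrow> bool" where
  "denominators \<alpha> q \<longleftrightarrow> strict_mono q \<and> q 0 = 1 \<and>
     (\<forall>s k. 1 \<le> k \<and> k < q (Suc s) \<and> k \<noteq> q s
        \<longrightarrow> circle_norm (real (q s) * \<alpha>) < circle_norm (real k * \<alpha>))"

definition bounded_partial_quotients :: "(nat \<Rightarrow> nat) \<Rightarrow> bool" where
  "bounded_partial_quotients q \<longleftrightarrow> (\<exists>r::real. \<forall>n. real (q (Suc n)) < r * real (q n))"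

text \<open>
  For \<open>C > 1\<close> the interval of radius \<open>1 / (2 * C * q s)\<close> about \<open>b\<close> is shorter than the circle,
  hence it is the closed ball for the circle distance.
\<close>

definition badly_approximable :: "real \<Rightarrow> (nat \<Rightarrow> nat) \<Rightarrow> real set \<Rightarrow> real \<Rightarrow> bool" where
  "badly_approximable \<alpha> q B C \<longleftrightarrow> finite B \<and> C > 1 \<and>
     (\<forall>x s. \<forall>i < q s. \<forall>j < q s.
        (\<exists>b\<in>B. circle_dist (x + real i * \<alpha>) b \<le> 1 / (2 * C * real (q s))) \<and>
        (\<exists>b\<in>B. circle_dist (x + real j * \<alpha>) b \<le> 1 / (2 * C * real (q s)))
        \<longrightarrow> i = j)"

section \<open>Functions with singularities\<close>

text \<open>Intended for open \<open>S\<close> only.\<close>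

definition C2_on :: "real set \<Rightarrow> (real \<Rightarrow> real) \<Rightarrow> bool" where
  "C2_on S f \<longleftrightarrow> f differentiable_on S \<and> deriv f C1_differentiable_on S"

text \<open>
  Functions on the circle without 0 are functions on (0,1); their values elsewhere are irrelevant.
\<close>

definition singular_profile :: "(real \<Rightarrow> real) \<Rightarrow> bool" where
  "singular_profile g \<longleftrightarrow> (\<forall>x\<in>{0<..<1}. 0 < g x) \<and> C2_on {0<..<1} g \<and>
     antimono_on {0<..<1} g \<and> mono_on {0<..<1} (deriv g)"

text \<open>
  The limits of quotients presuppose that \<open>deriv g\<close> has no zeros near 0. This has to be said
  explicitly because of \<open>x / 0 = 0\<close>; it is automatic if \<open>g\<close> is a profile that is strictly
  decreasing or unbounded at 0.
\<close>

definition has_singularity_of_type ::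
  "(real \<Rightarrow> real) \<Rightarrow> (real \<Rightarrow> real) \<Rightarrow> real \<Rightarrow> real \<Rightarrow> real \<Rightarrow> bool" where
  "has_singularity_of_type f g a A B \<longleftrightarrow> 0 \<le> A \<and> 0 \<le> B \<and>
     (\<forall>\<^sub>F x in at_right 0. deriv g x \<noteq> 0) \<and>
     ((\<lambda>x. deriv f x / deriv g (x - a)) \<longlongrightarrow> A) (at_right a) \<and>
     ((\<lambda>x. deriv f x / deriv g (a - x)) \<longlongrightarrow> - B) (at_left a)"

section \<open>Special flows\<close>

text \<open>Integer iterates of a bijection \<open>T\<close> of \<open>X\<close>.\<close>

definition int_iterate :: "'a set \<Rightarrow> ('a \<Rightarrow> 'a) \<Rightarrow> int \<Rightarrow> 'a \<Rightarrow> 'a" where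
  "int_iterate X T n = (if 0 \<le> n then T ^^ nat n else the_inv_into X T ^^ nat (- n))"

definition birkhoff_sum :: "'a set \<Rightarrow> ('a \<Rightarrow> 'a) \<Rightarrow> ('a \<Rightarrow> real) \<Rightarrow> int \<Rightarrow> 'a \<Rightarrow> real" where
  "birkhoff_sum X T f n x =
     (if 0 \<le> n then \<Sum>j\<in>{0..<n}. f (int_iterate X T j x)
      else - (\<Sum>j\<in>{n..<0}. f (int_iterate X T j x)))"

definition special_flow ::
  "'a set \<Rightarrow> ('a \<Rightarrow> 'a) \<Rightarrow> ('a \<Rightarrow> real) \<Rightarrow> real \<Rightarrow> 'a \<times> real \<Rightarrow> 'a \<times> real" where
  "special_flow X T f t = (\<lambda>(x, s).
     let n = (THE n. birkhoff_sum X T f n x \<le> t + s \<and> t + s < birkhoff_sum X T f (n + 1) x)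
     in (int_iterate X T n x, t + s - birkhoff_sum X T f n x))"

definition special_flow_space :: "'a set \<Rightarrow> ('a \<Rightarrow> real) \<Rightarrow> ('a \<times> real) set" where
  "special_flow_space X f = {(x, s). x \<in> X \<and> 0 \<le> s \<and> s < f x}"

definition special_flow_measure :: "'a measure \<Rightarrow> ('a \<Rightarrow> real) \<Rightarrow> ('a \<times> real) measure" where
  "special_flow_measure M f =
     (let X = special_flow_space (space M) f; N = M \<Otimes>\<^sub>M lborel
      in scale_measure (1 / emeasure N X) (restrict_space N X))"

definition special_flow_dist ::
  "('a \<Rightarrow> 'a \<Rightarrow> real) \<Rightarrow> 'a \<times> real \<Rightarrow> 'a \<times> real \<Rightarrow> real" where
  "special_flow_dist d = (\<lambda>(x, s) (x', s'). d x x' + \<bar>s - s'\<bar>)"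

section \<open>Ergodic flows and the SWR-property\<close>

definition standard_borel :: "'a measure \<Rightarrow> bool" where
  "standard_borel M \<longleftrightarrow> (\<exists>\<tau>. topspace \<tau> = space M \<and>
     completely_metrizable_space \<tau> \<and> second_countable \<tau> \<and>
     sets M = sigma_sets (space M) {U. openin \<tau> U})"

definition measure_preserving_flow :: "'a measure \<Rightarrow> (real \<Rightarrow> 'a \<Rightarrow> 'a) \<Rightarrow> bool" where
  "measure_preserving_flow M T \<longleftrightarrow>
     (\<lambda>(t, x). T t x) \<in> measurable (borel \<Otimes>\<^sub>M M) M \<and>
     (\<forall>x\<in>space M. T 0 x = x) \<and>
     (\<forall>s t. \<forall>x\<in>space M. T (s + t) x = T s (T t x)) \<and>
     (\<forall>t. distr M M (T t) = M)"

definition ergodic_flow :: "'a measure \<Rightarrow> (real \<Rightarrow> 'a \<Rightarrow> 'a) \<Rightarrow> bool" where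
  "ergodic_flow M T \<longleftrightarrow> measure_preserving_flow M T \<and>
     (\<forall>A\<in>sets M. (\<forall>t. T t -` A \<inter> space M = A) \<longrightarrow> measure M A = 0 \<or> measure M A = 1)"

definition switchable_R ::
  "'a measure \<Rightarrow> ('a \<Rightarrow> 'a \<Rightarrow> real) \<Rightarrow> (real \<Rightarrow> 'a \<Rightarrow> 'a) \<Rightarrow> real \<Rightarrow> real set \<Rightarrow> bool" where
  "switchable_R M d T t0 P \<longleftrightarrow>
     (\<forall>\<epsilon>>0. \<exists>\<kappa>>0. \<forall>N::nat. \<exists>\<delta>>0. \<exists>Z\<in>sets M. measure M Z > 1 - \<epsilon> \<and>
       (\<forall>x\<in>Z. \<forall>y\<in>Z. d x y < \<delta> \<and> x \<notin> range (\<lambda>t. T t y) \<longrightarrow>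
         (\<exists>m l :: nat. \<exists>p\<in>P. m > N \<and> l > N \<and> real l / real m \<ge> \<kappa> \<and>
           (real (card {n \<in> {m..m + l}.
               d (T (real n * t0) x) (T (real n * t0 + p) y) < \<epsilon>}) / real l > 1 - \<epsilon> \<or>
            real (card {n \<in> {m..m + l}.
               d (T (- (real n * t0)) x) (T (- (real n * t0) + p) y) < \<epsilon>}) / real l > 1 - \<epsilon>))))"

text \<open>
  The SWR-property is a property of ergodic flows on standard Borel probability spaces equipped
  with a metric, so these requirements are part of the predicate.
\<close>

definition SWR_property ::
  "'a measure \<Rightarrow> ('a \<Rightarrow> 'a \<Rightarrow> real) \<Rightarrow> (real \<Rightarrow> 'a \<Rightarrow> 'a) \<Rightarrow> bool" where
  "SWR_property M d T \<longleftrightarrow>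
     prob_space M \<and> standard_borel M \<and> Metric_space (space M) d \<and> ergodic_flow M T \<and>
     (\<exists>P. compact P \<and> 0 \<notin> P \<and> uncountable {t0. t0 > 0 \<and> switchable_R M d T t0 P})"

end

theory Submission
  imports Defs
begin

text \<open>
  Let \<open>x\<close> and \<open>y\<close> be points of the circle at a small distance \<open>d\<close>, and let \<open>D n\<close> be the difference of their
  \<open>n\<close>-th Birkhoff sums, for integers \<open>n\<close> of either sign. If \<open>D\<close> stays close to a constant \<open>p \<noteq> 0\<close> during a window
  of times \<open>n\<close> whose length is a fixed fraction of its distance from 0, then the orbits of points above
  \<open>x\<close> and \<open>y\<close> run parallel, shifted in time by \<open>p\<close>, for a corresponding stretch of flow time. So the task is to find
  such windows, with \<open>\<bar>p\<bar>\<close> bounded and bounded away from 0.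

  Put \<open>H s = q s * h (1 / (2 * q s))\<close>. The two conditions on \<open>h\<close> and the bounded type of \<open>\<alpha>\<close> make \<open>- h' (c / q s)\<close>
  comparable to \<open>H s\<close>, for each constant \<open>c\<close>, and \<open>H (s + 1)\<close> comparable to \<open>H s\<close>. Choose \<open>s\<close> such
  that \<open>d\<close> is comparable to \<open>1 / H s\<close>. Along an orbit of length \<open>q s\<close> that stays at distance of order \<open>1 / q s\<close> from the
  strong singularities, the derivatives of \<open>f\<close> add up to at most a multiple of \<open>H s\<close>, so that \<open>D\<close>
  remains bounded (\<open>window_variation\<close>). A single visit to a strong singularity at a distance of this order changes
  \<open>D\<close> by at least a constant (\<open>strong_visit_jump\<close>). Within \<open>q s\<close> steps there is at most one closer visit,
  because the strong singularities are badly approximable. Hence at least one direction of time has no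
  closer visit; this is why the property is switchable. Bounded type provides a visit of the right order in this direction.

  Directly before or directly after this visit, \<open>\<bar>D\<bar>\<close> is bounded from below, whatever happened earlier. Let now
  \<open>q t\<close> be about \<open>\<kappa> * q s\<close> for a small \<open>\<kappa>\<close>. By bad approximability at the scale \<open>t\<close>, no other visit within \<open>q t\<close> steps comes closer than about \<open>1 / q t\<close>, so that on either
  side of the visit \<open>D\<close> varies by at most a multiple of \<open>H t / H s\<close> in a window of length \<open>q t\<close> (\<open>drift\<close>).
  The weak singularities contribute little, once a small set of points with close visits to them is
  discarded by a Borel--Cantelli argument (\<open>weak_visits_rare\<close>).

  Returning to the flow, one has to discard the times at which it is near the floor or the roof of the space. The maximal
  inequality bounds their density in initial segments of orbits (\<open>maximal_inequality\<close>), which costs a factor \<open>1 / \<kappa>\<close> when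
  passing to windows of relative length \<open>\<kappa>\<close>. Therefore \<open>D\<close> has to be constant up to a small multiple of \<open>\<kappa>\<close>
  (\<open>switchable_R_of_drift\<close>). This is the case: the conditions on \<open>h\<close> force it to grow like a power
  (\<open>profile_power_growth\<close>), so that \<open>H t / H s\<close> is of smaller order than \<open>q t / q s\<close>.
\<close>

section \<open>The circle distance\<close>

lemma circle_norm_le: "circle_norm x \<le> \<bar>x - of_int n\<bar>"
  unfolding circle_norm_def by (metis abs_minus_commute round_diff_minimal)

lemma circle_norm_attained: "\<exists>n::int. circle_norm x = \<bar>x - of_int n\<bar>"
  unfolding circle_norm_def by blast

lemma circle_norm_nonneg [simp]: "0 \<le> circle_norm x"
  unfolding circle_norm_def by simp

lemma circle_norm_le_half: "circle_norm x \<le> 1 / 2"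
  unfolding circle_norm_def using of_int_round_abs_le[of x] by (simp add: abs_minus_commute)

lemma circle_norm_le_abs: "circle_norm x \<le> \<bar>x\<bar>"
  using circle_norm_le[of x 0] by simp

lemma circle_norm_add_of_int [simp]: "circle_norm (x + of_int n) = circle_norm x"
proof (rule antisym)
  obtain m where "circle_norm x = \<bar>x - of_int m\<bar>" using circle_norm_attained by blast
  then show "circle_norm (x + of_int n) \<le> circle_norm x"
    using circle_norm_le[of "x + of_int n" "m + n"] by simp
next
  obtain m where "circle_norm (x + of_int n) = \<bar>x + of_int n - of_int m\<bar>"
    using circle_norm_attained by blast
  then show "circle_norm x \<le> circle_norm (x + of_int n)"
    using circle_norm_le[of x "m - n"] by (simp add: algebra_simps)
qed

lemma circle_norm_diff_of_int [simp]: "circle_norm (x - of_int n) = circle_norm x"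
  using circle_norm_add_of_int[of x "- n"] by simp

lemma circle_norm_minus [simp]: "circle_norm (- x) = circle_norm x"
proof -
  have "circle_norm (- y) \<le> circle_norm y" for y
  proof -
    obtain m where "circle_norm y = \<bar>y - of_int m\<bar>" using circle_norm_attained by blast
    then show ?thesis using circle_norm_le[of "- y" "- m"] by simp
  qed
  from this[of x] this[of "- x"] show ?thesis by simp
qed

lemma circle_norm_commute: "circle_norm (x - y) = circle_norm (y - x)"
  using circle_norm_minus[of "x - y"] by simp

lemma circle_norm_triangle: "circle_norm (x + y) \<le> circle_norm x + circle_norm y"
proof -
  obtain m n where "circle_norm x = \<bar>x - of_int m\<bar>" "circle_norm y = \<bar>y - of_int n\<bar>"
    using circle_norm_attained by metis
  then show ?thesis using circle_norm_le[of "x + y" "m + n"] by simp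
qed

lemma circle_norm_diff_le: "circle_norm x \<le> circle_norm y + \<bar>x - y\<bar>"
  using circle_norm_triangle[of y "x - y"] circle_norm_le_abs[of "x - y"] by simp

lemma circle_norm_eq_0_iff: "circle_norm x = 0 \<longleftrightarrow> x \<in> \<int>"
proof
  assume "circle_norm x = 0"
  then show "x \<in> \<int>" using circle_norm_attained[of x] by (auto simp: Ints_def)
next
  assume "x \<in> \<int>"
  then obtain n where "x = of_int n" by (auto elim: Ints_cases)
  then show "circle_norm x = 0" unfolding circle_norm_def by simp
qed

lemma circle_norm_eq_abs: "\<bar>x\<bar> \<le> 1 / 2 \<Longrightarrow> circle_norm x = \<bar>x\<bar>"
proof (rule antisym[OF circle_norm_le_abs])
  assume *: "\<bar>x\<bar> \<le> 1 / 2"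
  obtain m where m: "circle_norm x = \<bar>x - of_int m\<bar>" using circle_norm_attained by blast
  show "\<bar>x\<bar> \<le> circle_norm x"
  proof (cases "m = 0")
    case False
    then have "1 \<le> \<bar>of_int m :: real\<bar>" by linarith
    then show ?thesis using * m by linarith
  qed (use m in simp)
qed

lemma frac_add_of_int [simp]: "frac (x + of_int n) = frac x"
  by (simp add: frac_def)

lemma frac_frac_add [simp]: "frac (frac x + y) = frac (x + y)"
proof -
  have "frac x + y = (x + y) + of_int (- \<lfloor>x\<rfloor>)" by (simp add: frac_def)
  then show ?thesis by (metis frac_add_of_int)
qed

lemma frac_add_frac [simp]: "frac (x + frac y) = frac (x + y)"
  using frac_frac_add[of y x] by (simp only: add.commute)

lemma periodic_add_of_int:
  fixes f :: "real \<Rightarrow> 'a"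
  assumes periodic: "\<And>y. f (y + 1) = f y"
  shows "f (y + of_int n) = f y"
proof -
  have nat: "f (y + real k) = f y" for y k
  proof (induction k)
    case (Suc k)
    then show ?case using periodic[of "y + real k"] by (simp add: ac_simps)
  qed simp
  show ?thesis
  proof (cases "0 \<le> n")
    case True
    then show ?thesis using nat[of y "nat n"] by simp
  next
    case False
    then show ?thesis using nat[of "y + of_int n" "nat (- n)"] by simp
  qed
qed

lemma circle_norm_frac: "circle_norm (frac x + y) = circle_norm (x + y)"
proof -
  have "frac x + y = (x + y) - of_int \<lfloor>x\<rfloor>" by (simp add: frac_def)
  then show ?thesis by (metis circle_norm_diff_of_int)
qed

lemma circle_dist_frac: "circle_dist (frac x) (frac y) = circle_dist x y"
proof -
  have "frac x - frac y = (x - y) + of_int (\<lfloor>y\<rfloor> - \<lfloor>x\<rfloor>)" by (simp add: frac_def)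
  then show ?thesis unfolding circle_dist_def by (metis circle_norm_add_of_int)
qed

lemma Metric_space_circle: "Metric_space {0..<1} circle_dist"
proof
  fix x y z :: real
  show "0 \<le> circle_dist x y" by (simp add: circle_dist_def)
  show "circle_dist x y = circle_dist y x" by (simp add: circle_dist_def circle_norm_commute)
  show "circle_dist x z \<le> circle_dist x y + circle_dist y z"
    using circle_norm_triangle[of "x - y" "y - z"] by (simp add: circle_dist_def)
  assume "x \<in> {0..<1}" "y \<in> {0..<1}"
  then have "\<bar>x - y\<bar> < 1" by auto
  then have "x - y \<in> \<int> \<Longrightarrow> x = y"
    by (metis Ints_nonzero_abs_less1 eq_iff_diff_eq_0)
  then have "x - y \<in> \<int> \<longleftrightarrow> x = y" by (metis Ints_0 cancel_comm_monoid_add_class.diff_cancel)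
  then show "circle_dist x y = 0 \<longleftrightarrow> x = y"
    by (simp add: circle_dist_def circle_norm_eq_0_iff)
qed

section \<open>Rotations preserve Lebesgue measure and are ergodic\<close>

lemma space_circle_measure [simp]: "space circle_measure = {0..<1}"
  by (simp add: circle_measure_def space_restrict_space)

lemma sets_circle_measure: "sets circle_measure = sets (restrict_space borel {0..<1})"
  unfolding circle_measure_def by (rule sets_restrict_space_cong) simp

lemma emeasure_circle_measure:
  "A \<in> sets borel \<Longrightarrow> A \<subseteq> {0..<1} \<Longrightarrow> emeasure circle_measure A = emeasure lborel A"
  unfolding circle_measure_def by (subst emeasure_restrict_space) auto

lemma prob_space_circle_measure: "prob_space circle_measure"
  by standard (simp add: emeasure_circle_measure)

lemma emeasure_lborel_translate:
  assumes "A \<in> sets borel"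
  shows "emeasure lborel {x. x + c \<in> A} = emeasure lborel (A :: real set)"
proof -
  have "emeasure lborel A = emeasure (distr lborel borel ((+) c)) A"
    by (simp add: lborel_distr_plus)
  also have "\<dots> = emeasure lborel {x. x + c \<in> A}"
    using assms by (subst emeasure_distr) (auto simp: vimage_def add.commute)
  finally show ?thesis by simp
qed

lemma frac_rotation_measurable [measurable]:
  "(\<lambda>x. frac (x + c)) \<in> measurable circle_measure circle_measure"
proof -
  have "(\<lambda>x. frac (x + c)) \<in> borel_measurable borel" unfolding frac_def by measurable
  then show ?thesis unfolding circle_measure_def
    by (intro measurable_restrict_space2 measurable_restrict_space1) (simp_all add: frac_lt_1)
qed

lemma distr_frac_rotation: "distr circle_measure circle_measure (\<lambda>x. frac (x + c)) = circle_measure"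
proof (rule measure_eqI)
  fix A assume "A \<in> sets (distr circle_measure circle_measure (\<lambda>x. frac (x + c)))"
  then have A': "A \<in> sets circle_measure" by simp
  then have A: "A \<in> sets borel" "A \<subseteq> {0..<1}"
    using sets.sets_into_space[OF A'] by (auto simp: sets_circle_measure sets_restrict_space)
  define e where "e = frac c"
  have e: "0 \<le> e" "e < 1" by (auto simp: e_def frac_lt_1)
  \<comment> \<open>The rotation is a translation on each of two complementary arcs.\<close>
  have fr: "frac (x + c) = (if x + e < 1 then x + e else x + e - 1)" if "x \<in> {0..<1}" for x
  proof -
    have "frac (x + c) = frac (x + e)" unfolding e_def by simp
    moreover have "frac (x + e) = (if x + e < 1 then x + e else x + e - 1)"
      using that e by (auto simp: frac_unique_iff frac_eq)
    ultimately show ?thesis by simp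
  qed
  let ?P = "{x. x + e \<in> A \<inter> {e..<1}}" and ?Q = "{x. x + (e - 1) \<in> A \<inter> {0..<e}}"
  have eq: "(\<lambda>x. frac (x + c)) -` A \<inter> space circle_measure = ?P \<union> ?Q"
    using A e by (auto simp: fr add_diff_eq split: if_splits)
  have m: "?P \<in> sets borel" "?Q \<in> sets borel"
    using A(1) by measurable
  have "emeasure (distr circle_measure circle_measure (\<lambda>x. frac (x + c))) A
      = emeasure circle_measure (?P \<union> ?Q)"
    using A' eq by (subst emeasure_distr) auto
  also have "\<dots> = emeasure lborel (?P \<union> ?Q)"
    using m A e by (intro emeasure_circle_measure) auto
  also have "\<dots> = emeasure lborel ?P + emeasure lborel ?Q"
    using m by (intro plus_emeasure[symmetric]) auto
  also have "\<dots> = emeasure lborel (A \<inter> {e..<1}) + emeasure lborel (A \<inter> {0..<e})"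
    using A(1) by (simp add: emeasure_lborel_translate del: Int_iff)
  also have "\<dots> = emeasure lborel ((A \<inter> {e..<1}) \<union> (A \<inter> {0..<e}))"
    using A(1) by (intro plus_emeasure) auto
  also have "(A \<inter> {e..<1}) \<union> (A \<inter> {0..<e}) = A" using A(2) e by auto
  finally show "emeasure (distr circle_measure circle_measure (\<lambda>x. frac (x + c))) A = emeasure circle_measure A"
    using A by (simp add: emeasure_circle_measure)
qed simp

lemma irrational_orbit_dense:
  assumes "\<alpha> \<notin> \<rat>" "0 < (e::real)"
  shows "\<exists>(n::nat) (m::int). \<bar>real n * \<alpha> + of_int m - c\<bar> < e"
proof -
  have "frac c \<in> closure (range (\<lambda>n. frac (real n * \<alpha>)))"
    using Kronecker_approx_1[OF assms(1)] frac_ge_0[of c] frac_lt_1[of c] by simp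
  then obtain n where "\<bar>frac (real n * \<alpha>) - frac c\<bar> < e"
    using assms(2) by (auto simp: closure_approachable dist_real_def)
  then show ?thesis
    by (intro exI[of _ n] exI[of _ "\<lfloor>c\<rfloor> - \<lfloor>real n * \<alpha>\<rfloor>"]) (simp add: frac_def algebra_simps)
qed

text \<open>
  The measure of the part of an invariant set in an interval \<open>[c, c + t)\<close> depends continuously
  on \<open>c\<close> and is the same along each orbit, and orbits are dense, so it depends only on \<open>t\<close>. Being additive and
  monotone in \<open>t\<close>, it is proportional to \<open>t\<close>.
\<close>

lemma invariant_set_equidistributed:
  fixes B :: "real set"
  assumes irr: "\<alpha> \<notin> \<rat>" and B: "B \<in> sets borel"
    and inv1: "\<And>x. x + 1 \<in> B \<longleftrightarrow> x \<in> B" and inva: "\<And>x. x + \<alpha> \<in> B \<longleftrightarrow> x \<in> B"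
    and t: "0 \<le> t"
  shows "measure lborel (B \<inter> {c..<c + t}) = measure lborel (B \<inter> {0..<1}) * t"
proof -
  define G where "G c t = measure lborel (B \<inter> {c..<c + t})" for c t
  have fin: "B \<inter> {c..<d} \<in> fmeasurable lborel" for c d
  proof (cases "c \<le> d")
    case True
    have "{c..<d} \<in> fmeasurable lborel" using True by (intro fmeasurableI) auto
    then show ?thesis using B by (subst Int_commute) (rule fmeasurable_Int_fmeasurable, auto)
  qed simp
  have mono: "measure lborel (B \<inter> {c..<d}) \<le> measure lborel (B \<inter> {c'..<d'})" if "c' \<le> c" "d \<le> d'" for c d c' d'
    using that fin[of c' d'] B by (intro measure_mono_fmeasurable) auto
  have le: "measure lborel (B \<inter> {c..<d}) \<le> d - c" if "c \<le> d" for c d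
  proof -
    have "measure lborel (B \<inter> {c..<d}) \<le> measure lborel {c..<d}"
    proof (rule measure_mono_fmeasurable)
      show "{c..<d} \<in> fmeasurable lborel" by (rule fmeasurableI) (simp_all add: that)
    qed (use B in auto)
    then show ?thesis using that by simp
  qed
  have add: "G c (s + t) = G c s + G (c + s) t" if "0 \<le> s" "0 \<le> t" for c s t
  proof -
    have "B \<inter> {c..<c + (s + t)} = (B \<inter> {c..<c + s}) \<union> (B \<inter> {c + s..<c + s + t})"
      using that by auto
    also have "measure lborel \<dots> = measure lborel (B \<inter> {c..<c + s}) + measure lborel (B \<inter> {c + s..<c + s + t})"
    proof (rule measure_Union)
      show "emeasure lborel (B \<inter> {c..<c + s}) \<noteq> \<infinity>" "emeasure lborel (B \<inter> {c + s..<c + s + t}) \<noteq> \<infinity>"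
        using fmeasurableD2[OF fin] by simp_all
    qed (use B in auto)
    finally show ?thesis unfolding G_def .
  qed
  have shift1: "G (c + e) t = G c t" if "\<And>x. x + e \<in> B \<longleftrightarrow> x \<in> B" for c t e
  proof -
    have "{x. x + e \<in> B \<inter> {c + e..<c + e + t}} = B \<inter> {c..<c + t}" using that by auto
    moreover have "B \<inter> {c + e..<c + e + t} \<in> sets borel" using B by simp
    ultimately show ?thesis unfolding G_def measure_def
      using emeasure_lborel_translate[of "B \<inter> {c + e..<c + e + t}" e] by simp
  qed
  have invn: "x + real n * \<alpha> \<in> B \<longleftrightarrow> x \<in> B" for x n
  proof (induction n)
    case (Suc n)
    then show ?case using inva[of "x + real n * \<alpha>"] by (simp add: algebra_simps)
  qed simp
  have invk: "x + real n \<in> B \<longleftrightarrow> x \<in> B" for x n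
  proof (induction n)
    case (Suc n)
    then show ?case using inv1[of "x + real n"] by (simp add: algebra_simps)
  qed simp
  have invm: "x + of_int m \<in> B \<longleftrightarrow> x \<in> B" for x and m :: int
  proof (cases "0 \<le> m")
    case True
    then show ?thesis using invk[of x "nat m"] by simp
  next
    case False
    then show ?thesis using invk[of "x + of_int m" "nat (- m)"] by simp
  qed
  have inv: "x + (real n * \<alpha> + of_int m) \<in> B \<longleftrightarrow> x \<in> B" for x n and m :: int
    using invn invm by (metis add.assoc)
  have near: "\<bar>G c t - G c' t\<bar> \<le> 2 * \<bar>c - c'\<bar>" if t: "0 \<le> t" for c c' t
  proof -
    have *: "G c t \<le> G c' t + 2 * \<bar>c - c'\<bar>" for c c'
    proof -
      define w where "w = \<bar>c - c'\<bar>"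
      have "G c t \<le> G (c' - w) (w + (t + w))" unfolding G_def by (intro mono) (auto simp: w_def)
      also have "\<dots> = G (c' - w) w + (G c' t + G (c' + t) w)"
        using add[of w "t + w" "c' - w"] add[of t w c'] t by (simp add: w_def)
      also have "\<dots> \<le> w + (G c' t + w)"
        unfolding G_def using le[of "c' - w" "c' - w + w"] le[of "c' + t" "c' + t + w"] by (simp add: w_def)
      finally have "G c t \<le> G c' t + 2 * w" by simp
      then show ?thesis by (simp add: w_def)
    qed
    show ?thesis using *[of c c'] *[of c' c] by (simp add: abs_minus_commute)
  qed
  have const: "G c t = G 0 t" if t: "0 \<le> t" for c t
  proof (rule ccontr)
    assume "G c t \<noteq> G 0 t"
    then have pos: "0 < \<bar>G c t - G 0 t\<bar> / 2" by simp
    obtain n :: nat and m :: int where nm: "\<bar>real n * \<alpha> + of_int m - c\<bar> < \<bar>G c t - G 0 t\<bar> / 2"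
      using irrational_orbit_dense[OF irr pos] by blast
    have "G (0 + (real n * \<alpha> + of_int m)) t = G 0 t" by (rule shift1) (rule inv)
    then have "\<bar>G c t - G 0 t\<bar> \<le> 2 * \<bar>c - (real n * \<alpha> + of_int m)\<bar>"
      using near[OF t, of c "real n * \<alpha> + of_int m"] by simp
    then show False using nm by (simp add: abs_minus_commute)
  qed
  define F where "F t = G 0 t" for t
  have Fadd: "F (s + t) = F s + F t" if "0 \<le> s" "0 \<le> t" for s t
    using add[OF that, of 0] const[OF that(2)] by (simp add: F_def)
  have Fmult: "F (real n * t) = real n * F t" if "0 \<le> t" for n t
  proof (induction n)
    case 0
    show ?case using Fadd[of 0 0] by simp
  next
    case (Suc n)
    then show ?case using that by (simp add: algebra_simps Fadd)
  qed
  have Fmono: "F s \<le> F t" if "s \<le> t" for s t unfolding F_def G_def using that by (intro mono) auto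
  have Frat: "F (real k / real n) = real k / real n * F 1" if "0 < n" for k n
  proof -
    have "real n * F (1 / real n) = F 1" using Fmult[of "1 / real n" n] that by simp
    then have "F (1 / real n) = F 1 / real n" using that by (simp add: field_simps)
    then show ?thesis using Fmult[of "1 / real n" k] by simp
  qed
  have F1: "0 \<le> F 1" unfolding F_def G_def by simp
  have lin: "\<bar>F t - t * F 1\<bar> \<le> F 1 / real n" if "0 \<le> t" "0 < n" for n t
  proof -
    define k where "k = nat \<lfloor>t * real n\<rfloor>"
    have k: "real k \<le> t * real n" "t * real n \<le> real (Suc k)" using that unfolding k_def by auto linarith
    then have k': "real k / real n \<le> t" "t \<le> real (Suc k) / real n" using that by (auto simp: field_simps)
    have u: "F t \<le> real (Suc k) / real n * F 1" using Fmono[OF k'(2)] Frat[OF that(2)] by metis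
    have l: "real k / real n * F 1 \<le> F t" using Fmono[OF k'(1)] Frat[OF that(2)] by metis
    have "real k / real n * F 1 \<le> t * F 1" "t * F 1 \<le> real (Suc k) / real n * F 1"
      by (intro mult_right_mono k' F1)+
    moreover have "real (Suc k) / real n * F 1 = real k / real n * F 1 + F 1 / real n"
      by (simp add: add_divide_distrib algebra_simps)
    ultimately show ?thesis using u l by linarith
  qed
  have "F t = t * F 1" if t: "0 \<le> t" for t
  proof (rule ccontr)
    assume ne: "F t \<noteq> t * F 1"
    then obtain n :: nat where n: "F 1 / \<bar>F t - t * F 1\<bar> < real n" using reals_Archimedean2 by blast
    have "0 \<le> F 1 / \<bar>F t - t * F 1\<bar>" using F1 by simp
    then have n0: "0 < n" using n by (metis of_nat_0_less_iff le_less_trans)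
    have "F 1 < real n * \<bar>F t - t * F 1\<bar>" using n ne by (simp add: field_simps)
    moreover have "real n * \<bar>F t - t * F 1\<bar> \<le> F 1" using lin[OF t n0] n0 by (simp add: field_simps)
    ultimately show False by simp
  qed
  from this[OF t] const[OF t, of c] have "G c t = t * G 0 1" by (simp only: F_def)
  then show ?thesis by (simp add: G_def mult.commute)
qed

text \<open>
  If an invariant set is not null, then by equidistribution the normalised restriction of Lebesgue measure to
  (the periodic extension of) the set is Lebesgue measure again, so its complement is null.
\<close>

lemma irrational_rotation_ergodic:
  assumes irr: "\<alpha> \<notin> \<rat>" and A: "A \<in> sets circle_measure"
    and inv: "\<And>x. x \<in> {0..<1} \<Longrightarrow> frac (x + \<alpha>) \<in> A \<longleftrightarrow> x \<in> A"
  shows "emeasure circle_measure A = 0 \<or> emeasure circle_measure ({0..<1} - A) = 0"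
proof -
  have A': "A \<in> sets borel" "A \<subseteq> {0..<1}"
    using sets.sets_into_space[OF A] A by (auto simp: sets_circle_measure sets_restrict_space)
  define B where "B = {x. frac x \<in> A}"
  have [measurable]: "A \<in> sets borel" by fact
  have B: "B \<in> sets borel" unfolding B_def frac_def by measurable
  have B1: "x + 1 \<in> B \<longleftrightarrow> x \<in> B" for x unfolding B_def by (simp add: frac_1_eq)
  have Ba: "x + \<alpha> \<in> B \<longleftrightarrow> x \<in> B" for x
  proof -
    have "frac (x + \<alpha>) = frac (frac x + \<alpha>)" by simp
    then show ?thesis unfolding B_def using inv[of "frac x"] by (simp add: frac_lt_1)
  qed
  have BA: "B \<inter> {0..<1} = A" using A' by (auto simp: B_def frac_eq_id frac_eq)
  define b where "b = measure lborel A"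
  have eq: "measure lborel (B \<inter> {l..<u}) = b * (u - l)" if "l \<le> u" for l u
    using invariant_set_equidistributed[OF irr B B1 Ba, of "u - l" l] that by (simp add: BA b_def)
  have finite: "emeasure lborel (B \<inter> {l..<u}) < \<infinity>" for l u
  proof -
    have "emeasure lborel (B \<inter> {l..<u}) \<le> emeasure lborel {l..<u}" by (intro emeasure_mono) auto
    also have "\<dots> < \<infinity>" by (cases "l \<le> u") auto
    finally show ?thesis .
  qed
  have eme: "emeasure lborel (B \<inter> {l..<u}) = ennreal (b * (u - l))" if "l \<le> u" for l u
    using eq[OF that] finite[of l u] by (simp add: emeasure_eq_ennreal_measure)
  show ?thesis
  proof (cases "b = 0")
    case True
    have "emeasure circle_measure A = 0"
      using eme[of 0 1] True A' BA by (simp add: emeasure_circle_measure)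
    then show ?thesis ..
  next
    case False
    then have b: "0 < b" unfolding b_def by (simp add: zero_less_measure_iff)
    let ?M = "density lborel (\<lambda>x. ennreal (1 / b) * indicator B x)"
    have dens: "emeasure ?M X = ennreal (1 / b) * emeasure lborel (B \<inter> X)" if "X \<in> sets borel" for X
    proof -
      have "emeasure ?M X = (\<integral>\<^sup>+x. ennreal (1 / b) * indicator (B \<inter> X) x \<partial>lborel)"
        using B that by (subst emeasure_density) (auto intro!: nn_integral_cong split: split_indicator)
      then show ?thesis using B that by (simp add: nn_integral_cmult_indicator)
    qed
    have "lborel = ?M"
    proof (rule lborel_eqI)
      fix l u :: real assume "\<And>b. b \<in> Basis \<Longrightarrow> l \<bullet> b \<le> u \<bullet> b"
      then have lu: "l \<le> u" by simp
      have "emeasure lborel (B \<inter> {l<..<u}) = emeasure lborel (B \<inter> {l..<u})"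
      proof (rule emeasure_eq_AE)
        show "AE x in lborel. x \<in> B \<inter> {l<..<u} \<longleftrightarrow> x \<in> B \<inter> {l..<u}"
          using AE_lborel_singleton[of l] by eventually_elim auto
      qed (use B in auto)
      then have "emeasure ?M (box l u) = ennreal (1 / b) * ennreal (b * (u - l))"
        using eme[OF lu] by (simp add: dens)
      also have "\<dots> = ennreal (u - l)" using b lu by (subst ennreal_mult'[symmetric]) auto
      finally show "emeasure ?M (box l u) = ennreal (\<Prod>b\<in>Basis. (u - l) \<bullet> b)" by simp
    qed simp
    then have "emeasure lborel ({0..<1} - A) = emeasure ?M ({0..<1} - A)"
      by (rule arg_cong[where f = "\<lambda>M. emeasure M ({0..<1} - A)"])
    also have "\<dots> = ennreal (1 / b) * emeasure lborel (B \<inter> ({0..<1} - A))"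
      by (rule dens) (use A' in simp)
    also have "B \<inter> ({0..<1} - A) = {}" using BA by auto
    finally have "emeasure circle_measure ({0..<1} - A) = 0"
      using A' by (subst emeasure_circle_measure) auto
    then show ?thesis ..
  qed
qed

section \<open>The maximal inequality\<close>

text \<open>
  A greedy covering: at an index where some block of average above \<open>r\<close> starts, jump over such a block; at any other
  index, step by one. The blocks that are jumped over cover all indices of the first kind.
\<close>

lemma maximal_count_le_sum:
  fixes c :: "nat \<Rightarrow> real" and r :: real
  assumes "\<And>k. 0 \<le> c k" "0 \<le> r"
  shows "r * card {k. k < K \<and> (\<exists>n\<in>{1..N}. (\<Sum>j<n. c (k + j)) > r * n)} \<le> (\<Sum>k<K + N. c k)"
  using assms
proof (induction K arbitrary: c rule: less_induct)
  case (less K)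
  define E where "E c K = {k. k < K \<and> (\<exists>n\<in>{1..N}. (\<Sum>j<n. c (k + j)) > r * real n)}"
    for c :: "nat \<Rightarrow> real" and K
  have finE: "finite (E c K)" for c K unfolding E_def by simp
  have IH: "r * card (E (\<lambda>k. c (n + k)) (K - n)) \<le> (\<Sum>k<K - n + N. c (n + k))" if "1 \<le> n" "n \<le> K" for n
    unfolding E_def using that less.IH[of "K - n" "\<lambda>k. c (n + k)"] less.prems by (simp add: add.assoc)
  have split: "card (E c K) \<le> card (E c K \<inter> {..<n}) + card (E (\<lambda>k. c (n + k)) (K - n))" if "n \<le> K" for n
  proof -
    have "E c K \<subseteq> (E c K \<inter> {..<n}) \<union> (\<lambda>k. n + k) ` E (\<lambda>k. c (n + k)) (K - n)"
    proof
      fix k assume k: "k \<in> E c K"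
      show "k \<in> (E c K \<inter> {..<n}) \<union> (\<lambda>k. n + k) ` E (\<lambda>k. c (n + k)) (K - n)"
      proof (cases "k < n")
        case False
        then have "k = n + (k - n)" "k - n \<in> E (\<lambda>k. c (n + k)) (K - n)"
          using k unfolding E_def by auto
        then show ?thesis by blast
      qed (use k in simp)
    qed
    then have "card (E c K) \<le> card ((E c K \<inter> {..<n}) \<union> (\<lambda>k. n + k) ` E (\<lambda>k. c (n + k)) (K - n))"
      by (intro card_mono) (use finE in auto)
    also have "\<dots> \<le> card (E c K \<inter> {..<n}) + card ((\<lambda>k. n + k) ` E (\<lambda>k. c (n + k)) (K - n))"
      by (rule card_Un_le)
    also have "card ((\<lambda>k. n + k) ` E (\<lambda>k. c (n + k)) (K - n)) = card (E (\<lambda>k. c (n + k)) (K - n))"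
      by (intro card_image) simp
    finally show ?thesis .
  qed
  have sums: "(\<Sum>k<K + N. c k) = (\<Sum>k<n. c k) + (\<Sum>k<K - n + N. c (n + k))" if "n \<le> K" for n
  proof -
    have "(\<Sum>k<n + m. c k) = (\<Sum>k<n. c k) + (\<Sum>k<m. c (n + k))" for m
      by (induction m) (auto simp: algebra_simps)
    from this[of "K - n + N"] show ?thesis using that by simp
  qed
  have "r * card (E c K) \<le> (\<Sum>k<K + N. c k)"
  proof (cases "K = 0")
    case True
    then show ?thesis using less.prems by (simp add: E_def sum_nonneg)
  next
    case K: False
    show ?thesis
    proof (cases "0 \<in> E c K")
      case False
      then have "card (E c K) \<le> card (E (\<lambda>k. c (1 + k)) (K - 1))"
        using split[of 1] K by (simp add: lessThan_Suc)
      then have "r * card (E c K) \<le> r * card (E (\<lambda>k. c (1 + k)) (K - 1))"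
        using less.prems by (intro mult_left_mono) auto
      also have "\<dots> \<le> (\<Sum>k<K - 1 + N. c (1 + k))" using IH[of 1] K by simp
      also have "\<dots> \<le> (\<Sum>k<K + N. c k)" using sums[of 1] K less.prems(1)[of 0] by simp
      finally show ?thesis .
    next
      case True
      then obtain n where n: "1 \<le> n" "n \<le> N" "(\<Sum>j<n. c j) > r * real n" unfolding E_def by auto
      show ?thesis
      proof (cases "n \<le> K")
        case nK: True
        have "card (E c K \<inter> {..<n}) \<le> n" using card_mono[of "{..<n}" "E c K \<inter> {..<n}"] by simp
        then have "real (card (E c K)) \<le> real n + real (card (E (\<lambda>k. c (n + k)) (K - n)))"
          using split[OF nK] by linarith
        then have "r * card (E c K) \<le> r * (real n + card (E (\<lambda>k. c (n + k)) (K - n)))"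
          using less.prems by (intro mult_left_mono) auto
        also have "\<dots> \<le> (\<Sum>j<n. c j) + (\<Sum>k<K - n + N. c (n + k))"
          using n IH[OF n(1) nK] by (simp add: algebra_simps)
        finally show ?thesis using sums[OF nK] by simp
      next
        case False
        have "card (E c K) \<le> K" using card_mono[of "{..<K}" "E c K"] unfolding E_def by auto
        then have "r * card (E c K) \<le> r * real n" using False less.prems by (intro mult_left_mono) auto
        also have "\<dots> \<le> (\<Sum>j<n. c j)" using n by simp
        also have "\<dots> \<le> (\<Sum>k<K + N. c k)" using n less.prems by (intro sum_mono2) auto
        finally show ?thesis .
      qed
    qed
  qed
  then show ?case unfolding E_def .
qed

lemma distr_funpow:
  assumes "T \<in> measurable M M" "distr M M T = M"
  shows "(T ^^ k) \<in> measurable M M \<and> distr M M (T ^^ k) = M"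
proof (induction k)
  case 0
  show ?case by (simp add: distr_id2 id_def)
next
  case (Suc k)
  have "distr M M (T ^^ Suc k) = distr (distr M M (T ^^ k)) M T"
    using assms Suc by (subst distr_distr) (auto simp: comp_def)
  also have "\<dots> = M" using assms Suc by simp
  finally have "distr M M (T ^^ Suc k) = M" .
  moreover have "T ^^ Suc k \<in> measurable M M"
    using assms Suc unfolding funpow.simps by (intro measurable_comp) auto
  ultimately show ?case by blast
qed

text \<open>
  Integrating the covering inequality along orbits of length \<open>K\<close>, and letting \<open>K\<close> grow, bounds the measure
  of the points at which some average exceeds \<open>r\<close>.
\<close>

lemma maximal_inequality:
  fixes g :: "'a \<Rightarrow> real"
  assumes M: "finite_measure M" and T: "T \<in> measurable M M" "distr M M T = M"
    and g: "integrable M g" "\<And>x. x \<in> space M \<Longrightarrow> 0 \<le> g x" and r: "0 < r"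
  shows "{x \<in> space M. \<exists>n\<ge>1. r * real n < (\<Sum>j<n. g ((T ^^ j) x))} \<in> sets M" (is "?E \<in> _")
    and "measure M {x \<in> space M. \<exists>n\<ge>1. r * real n < (\<Sum>j<n. g ((T ^^ j) x))} \<le> (\<integral>x. g x \<partial>M) / r"
proof -
  interpret finite_measure M by fact
  have [measurable]: "g \<in> borel_measurable M" using g by auto
  have Tk[measurable]: "(T ^^ k) \<in> measurable M M" and dk: "distr M M (T ^^ k) = M" for k
    using distr_funpow[OF T] by auto
  have Tsp: "(T ^^ k) x \<in> space M" if "x \<in> space M" for x k
    using measurable_space[OF Tk that] .
  have intk: "(\<integral>x. u ((T ^^ k) x) \<partial>M) = (\<integral>x. u x \<partial>M)" if "u \<in> borel_measurable M" for k and u :: "'a \<Rightarrow> real"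
    using integral_distr[OF Tk that, of k] dk by simp
  have intbk: "integrable M (\<lambda>x. u ((T ^^ k) x))" if "integrable M u" for k and u :: "'a \<Rightarrow> real"
    using integrable_distr[OF Tk, of k u] that dk by simp
  have sub_int: "integrable M (\<lambda>x. indicator A ((T ^^ k) x) :: real)" if "A \<in> sets M" for A k
    using that by (intro intbk[of "indicator A"]) (auto simp: integrable_indicator_iff emeasure_eq_measure)
  define E where "E N = {x \<in> space M. \<exists>n\<in>{1..N}. r * real n < (\<Sum>j<n. g ((T ^^ j) x))}" for N
  have [measurable]: "E N \<in> sets M" for N unfolding E_def by measurable
  have bound: "measure M (E N) \<le> (\<integral>x. g x \<partial>M) / r" for N
  proof (rule ccontr)
    let ?I = "\<integral>x. g x \<partial>M"
    assume "\<not> measure M (E N) \<le> ?I / r"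
    then have gap: "0 < r * measure M (E N) - ?I" using r by (simp add: field_simps)
    have main: "real K * (r * measure M (E N)) \<le> real (K + N) * ?I" for K
    proof -
      have "r * (\<Sum>k<K. indicator (E N) ((T ^^ k) x)) \<le> (\<Sum>k<K + N. g ((T ^^ k) x))" if x: "x \<in> space M" for x
      proof -
        have comm: "(T ^^ j) ((T ^^ k) x) = (T ^^ (k + j)) x" for j k
          by (metis add.commute comp_apply funpow_add)
        have "(\<Sum>k<K. indicator (E N) ((T ^^ k) x) :: real) = real (card {k. k < K \<and> (T ^^ k) x \<in> E N})"
          by (simp add: indicator_def sum_of_bool_eq lessThan_def Collect_conj_eq)
        also have "{k. k < K \<and> (T ^^ k) x \<in> E N}
            = {k. k < K \<and> (\<exists>n\<in>{1..N}. (\<Sum>j<n. g ((T ^^ (k + j)) x)) > r * real n)}"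
          using x Tsp by (auto simp: E_def comm)
        finally show ?thesis
          using maximal_count_le_sum[of "\<lambda>k. g ((T ^^ k) x)" r K N] g(2)[OF Tsp[OF x]] r by simp
      qed
      then have "(\<integral>x. r * (\<Sum>k<K. indicator (E N) ((T ^^ k) x)) \<partial>M) \<le> (\<integral>x. (\<Sum>k<K + N. g ((T ^^ k) x)) \<partial>M)"
        by (intro integral_mono integrable_mult_right Bochner_Integration.integrable_sum sub_int intbk g) auto
      moreover have "(\<integral>x. (\<Sum>k<K + N. g ((T ^^ k) x)) \<partial>M) = real (K + N) * ?I"
        by (subst Bochner_Integration.integral_sum) (auto intro!: intbk g simp: intk)
      moreover have "(\<integral>x. r * (\<Sum>k<K. indicator (E N) ((T ^^ k) x)) \<partial>M) = real K * (r * measure M (E N))"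
      proof -
        have "(\<integral>x. (\<Sum>k<K. indicator (E N) ((T ^^ k) x)) \<partial>M) = (\<Sum>k<K. \<integral>x. indicat_real (E N) ((T ^^ k) x) \<partial>M)"
          by (intro Bochner_Integration.integral_sum sub_int) auto
        also have "\<dots> = (\<Sum>k<K. measure M (E N))"
          using sets.sets_into_space[of "E N" M] by (intro sum.cong refl) (subst intk, auto simp: Int_absorb1)
        finally show ?thesis by simp
      qed
      ultimately show ?thesis by (simp only:)
    qed
    obtain K :: nat where K: "real N * ?I / (r * measure M (E N) - ?I) < real K"
      using reals_Archimedean2 by blast
    then have "real N * ?I < real K * (r * measure M (E N) - ?I)" using gap by (simp add: field_simps)
    then show False using main[of K] by (simp add: algebra_simps)
  qed
  have un: "(\<Union>N. E N) = ?E" unfolding E_def by fastforce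
  have "(\<Union>N. E N) \<in> sets M" by measurable
  then show "?E \<in> sets M" by (simp only: un)
  have "incseq E" by (force simp: incseq_def E_def)
  then have "(\<lambda>N. measure M (E N)) \<longlonglongrightarrow> measure M (\<Union>N. E N)"
    by (intro finite_Lim_measure_incseq) auto
  then have "measure M (\<Union>N. E N) \<le> (\<integral>x. g x \<partial>M) / r"
    using bound by (intro LIMSEQ_le_const2) auto
  then show "measure M ?E \<le> (\<integral>x. g x \<partial>M) / r" by (simp add: un)
qed

section \<open>Special flows over rotations\<close>

locale rotation_flow =
  fixes \<alpha> :: real and f :: "real \<Rightarrow> real"
  assumes irrational: "\<alpha> \<notin> \<rat>"
    and periodic: "\<And>y. f (y + 1) = f y"
    and positive: "\<And>y. 0 < f y"
    and L1: "integrable circle_measure f"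
    and growth: "\<exists>c>0. \<exists>n0. \<forall>n\<ge>n0. \<forall>x. c * real n \<le> (\<Sum>i<n. f (x + real i * \<alpha>))"
begin

lemma f_add_of_int [simp]: "f (y + of_int n) = f y"
  using periodic by (rule periodic_add_of_int)

lemma f_frac_add [simp]: "f (frac x + y) = f (x + y)"
proof -
  have "frac x + y = (x + y) + of_int (- \<lfloor>x\<rfloor>)" by (simp add: frac_def)
  then show ?thesis by (metis f_add_of_int)
qed

lemma f_frac [simp]: "f (frac x) = f x"
  using f_frac_add[of x 0] by simp

lemma frac_measurable_circle [measurable]: "frac \<in> measurable borel circle_measure"
proof -
  have "(frac :: real \<Rightarrow> real) \<in> borel_measurable borel" unfolding frac_def[abs_def] by measurable
  then show ?thesis unfolding circle_measure_def
    by (intro measurable_restrict_space2) (simp_all add: frac_lt_1)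
qed

lemma f_measurable [measurable]: "f \<in> borel_measurable borel"
proof -
  have "(\<lambda>x. f (frac x)) \<in> borel_measurable borel"
    by (rule measurable_compose[OF frac_measurable_circle]) (use L1 in auto)
  then show ?thesis by simp
qed

text \<open>
  The Birkhoff sums, as functions on the real line of period 1; this makes the cocycle identity hold for lifts of points.
\<close>

definition birk :: "int \<Rightarrow> real \<Rightarrow> real" where
  "birk n x = (if 0 \<le> n then \<Sum>j\<in>{0..<n}. f (x + of_int j * \<alpha>) else - (\<Sum>j\<in>{n..<0}. f (x + of_int j * \<alpha>)))"

lemma birk_0 [simp]: "birk 0 x = 0"
  by (simp add: birk_def)

lemma birk_Suc: "birk (n + 1) x = birk n x + f (x + of_int n * \<alpha>)"
proof (cases "0 \<le> n")
  case True
  then have "{0..<n + 1} = insert n {0..<n}" by auto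
  then show ?thesis using True by (simp add: birk_def)
next
  case False
  then have "{n..<0} = insert n {n + 1..<0}" by auto
  then show ?thesis using False by (cases "n = -1") (auto simp: birk_def)
qed

lemma birk_add: "birk (m + n) x = birk m x + birk n (x + of_int m * \<alpha>)"
proof (induction n rule: int_induct[where k = 0])
  case (step1 i)
  then show ?case using birk_Suc[of "m + i" x] birk_Suc[of i "x + of_int m * \<alpha>"]
    by (simp add: algebra_simps)
next
  case (step2 i)
  then show ?case using birk_Suc[of "m + (i - 1)" x] birk_Suc[of "i - 1" "x + of_int m * \<alpha>"]
    by (simp add: algebra_simps)
qed simp

lemma birk_frac [simp]: "birk n (frac x) = birk n x"
  by (simp add: birk_def)

lemma birk_minus: "birk (- n) x = - birk n (x - of_int n * \<alpha>)"
  using birk_add[of "- n" n x] by simp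

lemma birk_of_nat: "birk (int n) x = (\<Sum>i<n. f (x + real i * \<alpha>))"
proof (induction n)
  case (Suc n)
  then show ?case using birk_Suc[of "int n" x] by (simp add: add.commute)
qed simp

lemma birk_less: "m < n \<Longrightarrow> birk m x < birk n x"
proof (induction n rule: int_gr_induct)
  case base
  then show ?case using birk_Suc[of m x] positive[of "x + of_int m * \<alpha>"] by simp
next
  case (step i)
  then show ?case using birk_Suc[of i x] positive[of "x + of_int i * \<alpha>"] by simp
qed

lemma birk_mono: "m \<le> n \<Longrightarrow> birk m x \<le> birk n x"
  using birk_less[of m n x] by (cases "m = n") auto

lemma birk_measurable [measurable]: "birk n \<in> borel_measurable borel"
  unfolding birk_def by (cases "0 \<le> n") simp_all

lemma birk_growth:
  obtains c n0 where "0 < c" "\<And>n x. n0 \<le> n \<Longrightarrow> c * real n \<le> birk (int n) x"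
  using growth unfolding birk_of_nat by blast

text \<open>
  The sums are unbounded in both directions, because they grow linearly, uniformly in the starting point.
\<close>

lemma lap_exists: "\<exists>n. birk n x \<le> t \<and> t < birk (n + 1) x"
proof (rule ccontr)
  assume "\<nexists>n. birk n x \<le> t \<and> t < birk (n + 1) x"
  then have step: "birk n x \<le> t \<Longrightarrow> birk (n + 1) x \<le> t" for n by force
  obtain c n0 where c: "0 < c" and gr: "\<And>n x. n0 \<le> n \<Longrightarrow> c * real n \<le> birk (int n) x"
    by (rule birk_growth) blast
  obtain k :: nat where k: "\<bar>t\<bar> / c < real k" using reals_Archimedean2 by blast
  define n where "n = max k n0"
  have n: "\<bar>t\<bar> < c * real n"
    using k c by (simp add: n_def field_simps max_def split: if_splits)
      (smt (verit) mult_less_cancel_left_pos mult_mono of_nat_mono)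
  have low: "birk (- int n) x \<le> t"
    using gr[of n "x - of_int (int n) * \<alpha>"] n by (simp add: birk_minus n_def)
  have "birk m x \<le> t" if "- int n \<le> m" for m
    using that by (induction m rule: int_ge_induct) (auto intro: step low)
  from this[of "int n"] show False using gr[of n x] n by (simp add: n_def)
qed

lemma lap_unique:
  assumes "birk n x \<le> t" "t < birk (n + 1) x" "birk m x \<le> t" "t < birk (m + 1) x"
  shows "m = n"
  using assms birk_mono[of "m + 1" n x] birk_mono[of "n + 1" m x] by linarith

abbreviation "flow_space \<equiv> special_flow_space {0..<1} f"
abbreviation "flow \<equiv> special_flow {0..<1} (rotation \<alpha>) f"
abbreviation "flow_measure \<equiv> special_flow_measure circle_measure f"

lemma the_inv_rotation:
  assumes "x \<in> {0..<1}"
  shows "the_inv_into {0..<1} (rotation \<alpha>) x = frac (x - \<alpha>)"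
proof (rule the_inv_into_f_eq)
  show "inj_on (rotation \<alpha>) {0..<1}"
  proof
    fix y z :: real assume yz: "y \<in> {0..<1}" "z \<in> {0..<1}" "rotation \<alpha> y = rotation \<alpha> z"
    then have "frac (frac (y + \<alpha>) - \<alpha>) = frac (frac (z + \<alpha>) - \<alpha>)" by (simp add: rotation_def)
    then show "y = z" using yz frac_frac_add[of "_ + \<alpha>" "- \<alpha>"] by (simp add: frac_eq)
  qed
  show "rotation \<alpha> (frac (x - \<alpha>)) = x" using assms by (simp add: rotation_def frac_eq)
  show "frac (x - \<alpha>) \<in> {0..<1}" by (simp add: frac_lt_1)
qed

lemma int_iterate_rotation:
  assumes "x \<in> {0..<1}"
  shows "int_iterate {0..<1} (rotation \<alpha>) n x = frac (x + of_int n * \<alpha>)"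
proof -
  have pos: "(rotation \<alpha> ^^ k) x = frac (x + real k * \<alpha>)" for k
  proof (induction k)
    case (Suc k)
    then show ?case by (simp add: rotation_def algebra_simps)
  qed (use assms in \<open>simp add: frac_eq\<close>)
  have neg: "(the_inv_into {0..<1} (rotation \<alpha>) ^^ k) x = frac (x - real k * \<alpha>)" for k
  proof (induction k)
    case (Suc k)
    then show ?case
      using the_inv_rotation[of "frac (x - real k * \<alpha>)"] frac_frac_add[of "x - real k * \<alpha>" "- \<alpha>"]
      by (simp add: frac_lt_1 algebra_simps)
  qed (use assms in \<open>simp add: frac_eq\<close>)
  show ?thesis
    using pos[of "nat n"] neg[of "nat (- n)"] by (simp add: int_iterate_def)
qed

lemma birkhoff_sum_rotation:
  "x \<in> {0..<1} \<Longrightarrow> birkhoff_sum {0..<1} (rotation \<alpha>) f n x = birk n x"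
  by (simp add: birkhoff_sum_def birk_def int_iterate_rotation)

lemma flow_eq:
  assumes "x \<in> {0..<1}" "birk n x \<le> t + s" "t + s < birk (n + 1) x"
  shows "flow t (x, s) = (frac (x + of_int n * \<alpha>), t + s - birk n x)"
proof -
  have "(THE n. birk n x \<le> t + s \<and> t + s < birk (n + 1) x) = n"
    using assms lap_unique[of _ x "t + s"] by (intro the_equality) blast+
  then show ?thesis using assms
    by (simp add: special_flow_def birkhoff_sum_rotation int_iterate_rotation)
qed

lemma flow_cases:
  assumes "z \<in> flow_space"
  obtains x s n where "z = (x, s)" "x \<in> {0..<1}" "0 \<le> s" "s < f x" "birk n x \<le> t + s" "t + s < birk (n + 1) x"
    "flow t z = (frac (x + of_int n * \<alpha>), t + s - birk n x)"
proof -
  obtain x s where z: "z = (x, s)" "x \<in> {0..<1}" "0 \<le> s" "s < f x"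
    using assms by (auto simp: special_flow_space_def)
  obtain n where n: "birk n x \<le> t + s" "t + s < birk (n + 1) x" using lap_exists by blast
  show ?thesis using that[OF z n] flow_eq[OF z(2) n] z(1) by simp
qed

lemma flow_in_space: "z \<in> flow_space \<Longrightarrow> flow t z \<in> flow_space"
  by (erule flow_cases[where t = t]) (auto simp: special_flow_space_def frac_lt_1 birk_Suc)

lemma flow_0:
  assumes "z \<in> flow_space"
  shows "flow 0 z = z"
proof -
  obtain x s where z: "z = (x, s)" "x \<in> {0..<1}" "0 \<le> s" "s < f x"
    using assms by (auto simp: special_flow_space_def)
  then show ?thesis using flow_eq[of x 0 0 s] birk_Suc[of 0 x] by (simp add: frac_eq)
qed

text \<open>
  By the cocycle identity, \<open>m\<close> returns after \<open>n\<close> returns are \<open>n + m\<close> returns.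
\<close>

lemma flow_add:
  assumes "z \<in> flow_space"
  shows "flow (s + t) z = flow s (flow t z)"
proof -
  obtain x u n where z: "z = (x, u)" "x \<in> {0..<1}" "flow t z = (frac (x + of_int n * \<alpha>), t + u - birk n x)"
    using flow_cases[OF assms, of t] by metis
  let ?y = "frac (x + of_int n * \<alpha>)"
  obtain m where m: "birk m ?y \<le> s + (t + u - birk n x)" "s + (t + u - birk n x) < birk (m + 1) ?y"
    using lap_exists by blast
  have nm: "birk (n + m) x = birk n x + birk m ?y" "birk (n + m + 1) x = birk n x + birk (m + 1) ?y"
    using birk_add[of n m x] birk_add[of n "m + 1" x] by (simp_all add: add.assoc)
  have "flow s (flow t z) = (frac (?y + of_int m * \<alpha>), s + (t + u - birk n x) - birk m ?y)"
    unfolding z(3) by (rule flow_eq) (use m in \<open>auto simp: frac_lt_1\<close>)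
  moreover have "flow (s + t) z = (frac (x + of_int (n + m) * \<alpha>), (s + t) + u - birk (n + m) x)"
    unfolding z(1) by (rule flow_eq) (use m nm z in auto)
  ultimately show ?thesis using nm by (simp add: algebra_simps)
qed

end

section \<open>The invariant measure of the special flow\<close>

context rotation_flow
begin

definition "strip = circle_measure \<Otimes>\<^sub>M (lborel :: real measure)"

lemma space_strip: "space strip = {0..<1} \<times> UNIV"
  by (simp add: strip_def space_pair_measure)

lemma borel_measurable_circle:
  "u \<in> borel_measurable borel \<Longrightarrow> u \<in> borel_measurable circle_measure"
  unfolding circle_measure_def by (auto intro: measurable_restrict_space1)

lemma fst_strip [measurable]: "fst \<in> measurable strip circle_measure"
  unfolding strip_def by simp

lemma snd_strip [measurable]: "snd \<in> borel_measurable strip"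
  using measurable_snd[of circle_measure lborel] by (simp add: strip_def)

lemma measurable_strip_Pair:
  "u \<in> measurable M circle_measure \<Longrightarrow> v \<in> borel_measurable M \<Longrightarrow> (\<lambda>z. (u z, v z)) \<in> measurable M strip"
  unfolding strip_def by (rule measurable_Pair) simp_all

lemma birk_fst [measurable]: "(\<lambda>z. birk n (fst z)) \<in> borel_measurable strip"
  by (rule measurable_compose[OF fst_strip]) (auto intro: borel_measurable_circle)

lemma f_fst [measurable]: "(\<lambda>z. f (fst z)) \<in> borel_measurable strip"
  by (rule measurable_compose[OF fst_strip]) (auto intro: borel_measurable_circle)

lemma flow_space_sets [measurable]: "flow_space \<in> sets strip"
proof -
  have "flow_space = {z \<in> space strip. 0 \<le> snd z \<and> snd z < f (fst z)}"
    by (auto simp: special_flow_space_def space_strip)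
  also have "\<dots> \<in> sets strip" by measurable
  finally show ?thesis .
qed

lemma emeasure_strip:
  assumes "A \<in> sets strip"
  shows "emeasure strip A = (\<integral>\<^sup>+x. emeasure lborel {s. (x, s) \<in> A} \<partial>circle_measure)"
  using lborel.emeasure_pair_measure_alt[OF assms[unfolded strip_def]] by (simp add: strip_def vimage_def)

lemma emeasure_flow_space: "emeasure strip flow_space = ennreal (\<integral>x. f x \<partial>circle_measure)"
proof -
  have "emeasure strip flow_space = (\<integral>\<^sup>+x. emeasure lborel {s. (x, s) \<in> flow_space} \<partial>circle_measure)"
    by (rule emeasure_strip) measurable
  also have "\<dots> = (\<integral>\<^sup>+x. ennreal (f x) \<partial>circle_measure)"
  proof (rule nn_integral_cong)
    fix x :: real assume "x \<in> space circle_measure"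
    then have "{s. (x, s) \<in> flow_space} = {0..<f x}" by (auto simp: special_flow_space_def)
    then show "emeasure lborel {s. (x, s) \<in> flow_space} = ennreal (f x)"
      using positive[of x] by simp
  qed
  also have "\<dots> = ennreal (\<integral>x. f x \<partial>circle_measure)"
    using L1 positive by (intro nn_integral_eq_integral) (auto intro: less_imp_le)
  finally show ?thesis .
qed

lemma integral_f_pos: "0 < (\<integral>x. f x \<partial>circle_measure)"
proof -
  interpret prob_space circle_measure by (rule prob_space_circle_measure)
  have "\<not> (AE x in circle_measure. f x = 0)"
    using positive by (simp add: less_imp_neq[symmetric] AE_False)
  then have "(\<integral>x. f x \<partial>circle_measure) \<noteq> 0"
    using integral_nonneg_eq_0_iff_AE[OF L1] positive by (simp add: less_imp_le)
  then show ?thesis using positive by (simp add: order_less_le less_imp_le integral_nonneg)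
qed

definition "mass = (\<integral>x. f x \<partial>circle_measure)"

lemma mass_pos: "0 < mass" unfolding mass_def by (rule integral_f_pos)

lemma flow_measure_eq: "flow_measure = scale_measure (ennreal (1 / mass)) (restrict_space strip flow_space)"
proof -
  have "1 / ennreal mass = ennreal (1 / mass)"
    using mass_pos by (simp add: divide_ennreal[symmetric])
  then show ?thesis
    unfolding special_flow_measure_def Let_def strip_def[symmetric] space_circle_measure
    by (simp add: emeasure_flow_space mass_def[symmetric])
qed

lemma space_flow_measure [simp]: "space flow_measure = flow_space"
  using sets.sets_into_space[OF flow_space_sets]
  by (simp add: flow_measure_eq space_scale_measure space_restrict_space Int_absorb2)

lemma sets_flow_measure: "sets flow_measure = sets (restrict_space strip flow_space)"
  by (simp add: flow_measure_eq)

lemma sets_flow_measure_iff: "A \<in> sets flow_measure \<longleftrightarrow> A \<in> sets strip \<and> A \<subseteq> flow_space"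
  unfolding sets_flow_measure
  using sets.sets_into_space[OF flow_space_sets]
  by (subst sets_restrict_space_iff) (auto simp: Int_absorb2)

lemma emeasure_flow_measure:
  assumes "A \<in> sets strip" "A \<subseteq> flow_space"
  shows "emeasure flow_measure A = ennreal (1 / mass) * emeasure strip A"
proof -
  have "flow_space \<inter> space strip \<in> sets strip"
    using sets.sets_into_space[OF flow_space_sets] by (simp add: Int_absorb2)
  then show ?thesis using assms by (simp add: flow_measure_eq emeasure_restrict_space)
qed

lemma prob_space_flow_measure: "prob_space flow_measure"
proof
  have "emeasure flow_measure flow_space = ennreal (1 / mass) * ennreal mass"
    by (simp add: emeasure_flow_measure emeasure_flow_space mass_def[symmetric])
  also have "\<dots> = 1" using mass_pos by (subst ennreal_mult[symmetric]) auto
  finally show "emeasure flow_measure (space flow_measure) = 1" by simp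
qed

lemma measurable_strip_flow: "u \<in> measurable strip N \<Longrightarrow> u \<in> measurable flow_measure N"
  unfolding measurable_cong_sets[OF sets_flow_measure refl] by (rule measurable_restrict_space1)

text \<open>
  On the part of the space where \<open>n\<close> returns to the base occur, the flow acts by a shear of the strip.
\<close>

definition shear :: "int \<Rightarrow> real \<Rightarrow> real \<times> real \<Rightarrow> real \<times> real" where
  "shear n t = (\<lambda>(x, s). (frac (x + of_int n * \<alpha>), t + s - birk n x))"

definition lap_set :: "int \<Rightarrow> real \<Rightarrow> (real \<times> real) set" where
  "lap_set n t = {(x, s). (x, s) \<in> flow_space \<and> birk n x \<le> t + s \<and> t + s < birk (n + 1) x}"

lemma shear_measurable [measurable]: "shear n t \<in> measurable strip strip"
proof -
  have "shear n t = (\<lambda>z. (frac (fst z + of_int n * \<alpha>), t + snd z - birk n (fst z)))"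
    by (simp add: shear_def case_prod_unfold)
  moreover have "\<dots> \<in> measurable strip strip"
    by (intro measurable_strip_Pair measurable_compose[OF fst_strip frac_rotation_measurable]) simp
  ultimately show ?thesis by simp
qed

lemma lap_set_sets [measurable]: "lap_set n t \<in> sets strip"
proof -
  have "lap_set n t = {z \<in> space strip. z \<in> flow_space \<and> birk n (fst z) \<le> t + snd z \<and> t + snd z < birk (n + 1) (fst z)}"
    by (auto simp: lap_set_def space_strip special_flow_space_def)
  also have "\<dots> \<in> sets strip" by measurable
  finally show ?thesis .
qed

lemma emeasure_shear:
  assumes A: "A \<in> sets strip"
  shows "emeasure strip (shear n t -` A \<inter> space strip) = emeasure strip A"
proof -
  let ?F = "\<lambda>x. emeasure lborel {s. (x, s) \<in> A}"
  have F: "?F \<in> borel_measurable circle_measure"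
    using lborel.measurable_emeasure_Pair[OF A[unfolded strip_def]] by (simp add: vimage_def)
  have sec: "{s. (x, s) \<in> A} \<in> sets borel" for x
    using sets_Pair1[OF A[unfolded strip_def], of x] by (simp add: vimage_def)
  have "emeasure strip (shear n t -` A \<inter> space strip)
      = (\<integral>\<^sup>+x. emeasure lborel {s. (x, s) \<in> shear n t -` A \<inter> space strip} \<partial>circle_measure)"
    by (rule emeasure_strip) (use A in measurable)
  also have "\<dots> = (\<integral>\<^sup>+x. ?F (frac (x + of_int n * \<alpha>)) \<partial>circle_measure)"
  proof (rule nn_integral_cong)
    fix x :: real assume "x \<in> space circle_measure"
    then have "{s. (x, s) \<in> shear n t -` A \<inter> space strip}
        = {s. s + (t - birk n x) \<in> {s. (frac (x + of_int n * \<alpha>), s) \<in> A}}"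
      by (auto simp: shear_def space_strip algebra_simps)
    then show "emeasure lborel {s. (x, s) \<in> shear n t -` A \<inter> space strip} = ?F (frac (x + of_int n * \<alpha>))"
      using emeasure_lborel_translate[OF sec] by simp
  qed
  also have "\<dots> = (\<integral>\<^sup>+x. ?F x \<partial>distr circle_measure circle_measure (\<lambda>x. frac (x + of_int n * \<alpha>)))"
    using F by (subst nn_integral_distr) auto
  also have "\<dots> = emeasure strip A"
    by (simp add: distr_frac_rotation emeasure_strip[OF A])
  finally show ?thesis .
qed

lemma disjoint_lap_sets: "disjoint_family (\<lambda>n. lap_set n t)"
  by (auto simp: disjoint_family_on_def lap_set_def dest: lap_unique)

lemma Union_lap_sets: "(\<Union>n. lap_set n t) = flow_space"
  using lap_exists by (auto simp: lap_set_def)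

lemma flow_eq_shear: "z \<in> lap_set n t \<Longrightarrow> flow t z = shear n t z"
  by (auto simp: lap_set_def shear_def special_flow_space_def flow_eq)

text \<open>
  The inverse of the shear undoes the same number of returns: it belongs to the time \<open>- t\<close> and to \<open>- n\<close> returns.
\<close>

lemma shear_lap_set:
  "z \<in> space strip \<Longrightarrow> shear n t z \<in> lap_set (- n) (- t) \<longleftrightarrow> z \<in> lap_set n t"
proof -
  assume "z \<in> space strip"
  then obtain x s where z: "z = (x, s)" "x \<in> {0..<1}" by (auto simp: space_strip)
  have b: "birk (- n) (x + of_int n * \<alpha>) = - birk n x" using birk_minus[of n "x + of_int n * \<alpha>"] by simp
  have b': "birk (- n + 1) (x + of_int n * \<alpha>) = - birk n x + f x"
    using birk_Suc[of "- n" "x + of_int n * \<alpha>"] b by simp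
  show ?thesis
    using b b' birk_Suc[of n x] z by (auto simp: lap_set_def shear_def special_flow_space_def frac_lt_1)
qed

text \<open>
  The sets \<open>lap_set n t\<close> partition the space, and so do their images \<open>lap_set (- n) (- t)\<close> under the shears,
  which preserve the measure.
\<close>

lemma emeasure_flow_vimage:
  assumes A: "A \<in> sets strip" "A \<subseteq> flow_space"
  shows "flow t -` A \<inter> flow_space \<in> sets strip"
    and "emeasure strip (flow t -` A \<inter> flow_space) = emeasure strip A"
proof -
  let ?V = "\<lambda>n. shear n t -` (A \<inter> lap_set (- n) (- t)) \<inter> space strip"
  have ls: "lap_set n t \<subseteq> space strip" for n
    using sets.sets_into_space[OF lap_set_sets] .
  have V: "?V n = flow t -` A \<inter> lap_set n t" for n
  proof (rule set_eqI)
    fix z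
    have "z \<in> ?V n \<longleftrightarrow> shear n t z \<in> A \<and> z \<in> lap_set n t"
      using shear_lap_set[of z n t] ls[of n] by blast
    then show "z \<in> ?V n \<longleftrightarrow> z \<in> flow t -` A \<inter> lap_set n t"
      by (metis IntE IntI flow_eq_shear vimage_eq)
  qed
  have eq: "flow t -` A \<inter> flow_space = (\<Union>n. ?V n)"
    using Union_lap_sets[of t] unfolding V by blast
  have Vs: "?V n \<in> sets strip" for n using A by measurable
  then show "flow t -` A \<inter> flow_space \<in> sets strip"
    unfolding eq by (intro sets.countable_UN image_subsetI)
  have dV: "disjoint_family ?V"
    unfolding V using disjoint_lap_sets[of t] by (auto simp: disjoint_family_on_def)
  have "emeasure strip (flow t -` A \<inter> flow_space) = (\<integral>\<^sup>+n. emeasure strip (?V n) \<partial>count_space UNIV)"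
    unfolding eq by (rule emeasure_UN_countable) (use Vs dV in auto)
  also have "\<dots> = (\<integral>\<^sup>+n. emeasure strip (A \<inter> lap_set (- n) (- t)) \<partial>count_space UNIV)"
    by (rule nn_integral_cong) (use A in \<open>intro emeasure_shear; measurable\<close>)
  also have "\<dots> = emeasure strip (\<Union>n. A \<inter> lap_set (- n) (- t))"
  proof (rule emeasure_UN_countable[symmetric])
    show "disjoint_family (\<lambda>n. A \<inter> lap_set (- n) (- t))"
      using disjoint_lap_sets[of "- t"] unfolding disjoint_family_on_def
      by (metis (no_types, lifting) UNIV_I disjoint_iff_not_equal IntD2 neg_equal_iff_equal)
  qed (use A in auto)
  also have "(\<Union>n. A \<inter> lap_set (- n) (- t)) = A"
  proof -
    have "(\<Union>n. lap_set (- n) (- t)) = (\<Union>n. lap_set n (- t))"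
      by (auto, metis minus_minus)
    then show ?thesis using A Union_lap_sets[of "- t"] by auto
  qed
  finally show "emeasure strip (flow t -` A \<inter> flow_space) = emeasure strip A" .
qed

lemma flow_measurable [measurable]: "flow t \<in> measurable flow_measure flow_measure"
proof (rule measurableI)
  fix A assume "A \<in> sets flow_measure"
  then show "flow t -` A \<inter> space flow_measure \<in> sets flow_measure"
    using emeasure_flow_vimage[of A t] by (auto simp: sets_flow_measure_iff)
qed (simp add: flow_in_space)

lemma distr_flow: "distr flow_measure flow_measure (flow t) = flow_measure"
proof (rule measure_eqI)
  fix A assume "A \<in> sets (distr flow_measure flow_measure (flow t))"
  then have A: "A \<in> sets strip" "A \<subseteq> flow_space" "A \<in> sets flow_measure" by (auto simp: sets_flow_measure_iff)
  then show "emeasure (distr flow_measure flow_measure (flow t)) A = emeasure flow_measure A"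
    using emeasure_flow_vimage[of A t] by (simp add: emeasure_distr emeasure_flow_measure)
qed simp

lemma flow_jointly_measurable:
  "(\<lambda>(t, z). flow t z) \<in> measurable (borel \<Otimes>\<^sub>M flow_measure) flow_measure"
proof -
  let ?J = "borel \<Otimes>\<^sub>M flow_measure :: (real \<times> real \<times> real) measure"
  have id: "(\<lambda>z. z) \<in> measurable flow_measure strip"
    using measurable_strip_flow[of "\<lambda>z. z" strip] by simp
  have z[measurable]: "snd \<in> measurable ?J strip"
    by (rule measurable_compose[OF measurable_snd id])
  have x[measurable]: "(\<lambda>w. fst (snd w)) \<in> measurable ?J circle_measure"
    by (rule measurable_compose[OF z fst_strip])
  have s[measurable]: "(\<lambda>w. snd (snd w)) \<in> borel_measurable ?J"
    by (rule measurable_compose[OF z snd_strip])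
  have b[measurable]: "(\<lambda>w. birk n (fst (snd w))) \<in> borel_measurable ?J" for n
    by (rule measurable_compose[OF z birk_fst])
  define P where "P n w \<longleftrightarrow> birk n (fst (snd w)) \<le> fst w + snd (snd w) \<and> fst w + snd (snd w) < birk (n + 1) (fst (snd w))"
    for n and w :: "real \<times> real \<times> real"
  define L where "L w = (THE n. P n w)" for w
  define G where "G n w = (frac (fst (snd w) + of_int n * \<alpha>), fst w + snd (snd w) - birk n (fst (snd w)))"
    for n and w :: "real \<times> real \<times> real"
  have "L \<in> measurable ?J (count_space UNIV)" unfolding L_def[abs_def]
  proof (rule measurable_THE[where I = UNIV])
    show "Measurable.pred ?J (P n)" for n unfolding P_def by measurable
    show "i = j" if "P i w" "P j w" for w i j
      using that lap_unique unfolding P_def by blast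
  qed auto
  moreover have "G n \<in> measurable ?J strip" for n
    unfolding G_def[abs_def] by (intro measurable_strip_Pair measurable_compose[OF x frac_rotation_measurable]) simp
  ultimately have "(\<lambda>w. G (L w) w) \<in> measurable ?J strip" by (rule measurable_compose_countable[rotated])
  moreover have eq: "(\<lambda>(t, z). flow t z) w = G (L w) w" if "w \<in> space ?J" for w
  proof -
    have "w = (fst w, snd w)" "snd w \<in> flow_space" using that by (auto simp: space_pair_measure)
    then obtain t y where w: "w = (t, y)" "y \<in> flow_space" by blast
    obtain v s n where y: "y = (v, s)" "birk n v \<le> t + s" "t + s < birk (n + 1) v"
      "flow t y = (frac (v + of_int n * \<alpha>), t + s - birk n v)" using flow_cases[OF w(2), of t] by metis
    have "P n w" using y by (simp add: P_def w)
    moreover have "m = n" if "P m w" for m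
      using that \<open>P n w\<close> lap_unique unfolding P_def by blast
    ultimately have "L w = n" unfolding L_def by (rule the_equality)
    then show ?thesis using y by (simp add: w G_def)
  qed
  ultimately have "(\<lambda>(t, z). flow t z) \<in> measurable ?J strip" by (subst measurable_cong[OF eq])
  then have "(\<lambda>(t, z). flow t z) \<in> measurable ?J (restrict_space strip flow_space)"
    by (intro measurable_restrict_space2) (auto simp: space_pair_measure flow_in_space)
  then show ?thesis by (simp add: measurable_cong_sets[OF refl sets_flow_measure])
qed

lemma flow_measure_preserving: "measure_preserving_flow flow_measure flow"
  unfolding measure_preserving_flow_def
  using flow_jointly_measurable flow_0 flow_add distr_flow by simp

text \<open>
  An invariant set consists of full fibres, and the set of their base points is invariant under the rotation.
\<close>

lemma flow_ergodic: "ergodic_flow flow_measure flow"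
  unfolding ergodic_flow_def
proof (intro conjI flow_measure_preserving ballI impI)
  interpret P: prob_space flow_measure by (rule prob_space_flow_measure)
  fix A assume "A \<in> sets flow_measure" and inv: "\<forall>t. flow t -` A \<inter> space flow_measure = A"
  then have A: "A \<in> sets strip" "A \<subseteq> flow_space" by (auto simp: sets_flow_measure_iff)
  have iff: "flow t z \<in> A \<longleftrightarrow> z \<in> A" if "z \<in> flow_space" for t z
    using inv that by auto
  define B where "B = {x \<in> {0..<1}. (x, 0) \<in> A}"
  have base: "(\<lambda>x. (x, 0)) \<in> measurable circle_measure strip"
    by (rule measurable_strip_Pair) simp_all
  have "B = (\<lambda>x. (x, 0)) -` A \<inter> space circle_measure" by (auto simp: B_def)
  also have "\<dots> \<in> sets circle_measure" using base A(1) by (rule measurable_sets)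
  finally have Bs: "B \<in> sets circle_measure" .
  have fibre: "(x, s) \<in> A \<longleftrightarrow> x \<in> B" if "(x, s) \<in> flow_space" for x s
  proof -
    have x: "x \<in> {0..<1}" "0 \<le> s" "s < f x" using that by (auto simp: special_flow_space_def)
    then have "flow s (x, 0) = (x, s)"
      using flow_eq[of x 0 s 0] birk_Suc[of 0 x] by (simp add: frac_eq)
    moreover have "(x, 0) \<in> flow_space" using x by (simp add: special_flow_space_def)
    ultimately show ?thesis using iff[of "(x, 0)" s] x by (simp add: B_def)
  qed
  have "frac (x + \<alpha>) \<in> B \<longleftrightarrow> x \<in> B" if x: "x \<in> {0..<1}" for x
  proof -
    have sp: "(x, 0) \<in> flow_space" using x positive[of x] by (simp add: special_flow_space_def)
    have "flow (f x) (x, 0) = (frac (x + \<alpha>), 0)"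
      using flow_eq[of x 1 "f x" 0] birk_Suc[of 0 x] birk_Suc[of 1 x] x positive[of "x + \<alpha>"] by simp
    then show ?thesis using iff[OF sp, of "f x"] x by (simp add: B_def frac_lt_1)
  qed
  then consider "emeasure circle_measure B = 0" | "emeasure circle_measure ({0..<1} - B) = 0"
    using irrational_rotation_ergodic[OF irrational Bs] by blast
  then show "measure flow_measure A = 0 \<or> measure flow_measure A = 1"
  proof cases
    case 1
    have "emeasure strip A \<le> emeasure strip (B \<times> UNIV)"
      using A fibre Bs by (intro emeasure_mono) (auto simp: strip_def)
    also have "\<dots> = 0" using 1 Bs unfolding strip_def by (subst lborel.emeasure_pair_measure_Times) auto
    finally have "measure flow_measure A = 0" using A by (simp add: emeasure_flow_measure measure_def)
    then show ?thesis ..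
  next
    case 2
    have Cs: "{0..<1} - B \<in> sets circle_measure" using Bs sets.compl_sets[OF Bs] by simp
    have "emeasure strip (flow_space - A) \<le> emeasure strip (({0..<1} - B) \<times> UNIV)"
      using fibre Cs by (intro emeasure_mono) (auto simp: special_flow_space_def strip_def)
    also have "\<dots> = 0" using 2 Cs unfolding strip_def by (subst lborel.emeasure_pair_measure_Times) auto
    finally have "measure flow_measure (flow_space - A) = 0"
      using A by (simp add: emeasure_flow_measure measure_def)
    then have "measure flow_measure A = 1"
      using P.prob_compl[OF \<open>A \<in> sets flow_measure\<close>] by simp
    then show ?thesis ..
  qed
qed

lemma Metric_space_flow: "Metric_space flow_space (special_flow_dist circle_dist)"
proof -
  interpret C: Metric_space "{0..<1}" circle_dist by (rule Metric_space_circle)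
  show ?thesis
  proof
    fix u v w :: "real \<times> real"
    show "0 \<le> special_flow_dist circle_dist u v" by (auto simp: special_flow_dist_def split: prod.split)
    show "special_flow_dist circle_dist u v = special_flow_dist circle_dist v u"
      using C.commute by (auto simp: special_flow_dist_def split: prod.split)
    show "special_flow_dist circle_dist u v = 0 \<longleftrightarrow> u = v" if "u \<in> flow_space" "v \<in> flow_space"
      using that C.zero C.nonneg
      by (auto simp: special_flow_dist_def special_flow_space_def add_nonneg_eq_0_iff)
    show "special_flow_dist circle_dist u w \<le> special_flow_dist circle_dist u v + special_flow_dist circle_dist v w"
      if "u \<in> flow_space" "v \<in> flow_space" "w \<in> flow_space"
      using that C.triangle[of "fst u" "fst v" "fst w"]
      by (auto simp: special_flow_dist_def special_flow_space_def)
  qed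
qed

text \<open>
  Away from the fibres above \<open>F\<close>, the space is relatively open in a locally closed subset of the plane. Adding finitely many
  segments leaves it a \<open>G\<^sub>\<delta>\<close> set, which is completely metrizable in the topology of the plane.
\<close>

lemma standard_borel_flow_measure:
  assumes F: "finite F" and cont: "continuous_on ({0..<1} - F) f"
  shows "standard_borel flow_measure"
proof -
  let ?\<tau> = "top_of_set flow_space"
  have gd: "gdelta_in euclidean flow_space"
  proof -
    let ?U = "{z. z \<in> ({0..<1} - F) \<times> {0..} \<and> snd z < f (fst z)}"
    have gdc: "gdelta_in euclidean S" if "closed S" for S :: "'c :: metric_space set"
      using that closed_imp_gdelta_in[of euclidean S] metrizable_space_euclidean by simp
    have gdo: "gdelta_in euclidean S" if "open S" for S :: "'c :: metric_space set"
      using that open_imp_gdelta_in[of euclidean S] by simp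
    have c2: "continuous_on (({0..<1} - F) \<times> {0..}) (\<lambda>z. f (fst z) - snd z)"
      by (intro continuous_intros continuous_on_compose2[OF cont]) auto
    have "openin (top_of_set (({0..<1} - F) \<times> {0..})) ((({0..<1} - F) \<times> {0..}) \<inter> (\<lambda>z. f (fst z) - snd z) -` {0<..})"
      by (rule continuous_openin_preimage_gen[OF c2]) simp
    then obtain W where W: "open W" "(({0..<1} - F) \<times> {0..}) \<inter> (\<lambda>z. f (fst z) - snd z) -` {0<..} = (({0..<1} - F) \<times> {0..}) \<inter> W"
      by (auto simp: openin_open)
    have base: "(({0..<1} - F) \<times> {0::real..}) = ({0..} \<times> {0..}) \<inter> (({..<1} - F) \<times> (UNIV :: real set))" by auto
    have "closed F" using F by (rule finite_imp_closed)
    then have "gdelta_in euclidean (({0..<1} - F) \<times> {0::real..})"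
      unfolding base by (intro gdelta_in_Int gdc gdo closed_Times open_Times open_Diff) auto
    then have g1: "gdelta_in euclidean ((({0..<1} - F) \<times> {0..}) \<inter> W)"
      using gdo[OF W(1)] by (rule gdelta_in_Int)
    have g2: "gdelta_in euclidean (\<Union>p\<in>F \<inter> {0..<1}. {p} \<times> {0..<f p})" (is "gdelta_in _ (\<Union>p\<in>?F. _)")
    proof -
      have one: "gdelta_in euclidean ({p} \<times> {0..<f p})" for p :: real
      proof -
        have "{p} \<times> {0..<f p} = ({p} \<times> {0..}) \<inter> (UNIV \<times> {..<f p})" by auto
        then show ?thesis by (simp only:) (intro gdelta_in_Int gdc gdo closed_Times open_Times; simp)
      qed
      have "gdelta_in euclidean (\<Union>p\<in>G. {p} \<times> {0..<f p})" if "finite G" for G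
        using that by (induction G) (auto intro!: gdelta_in_Un one)
      then show ?thesis using F by simp
    qed
    have "flow_space = ((({0..<1} - F) \<times> {0..}) \<inter> W) \<union> (\<Union>p\<in>F \<inter> {0..<1}. {p} \<times> {0..<f p})"
      unfolding W(2)[symmetric] by (auto simp: special_flow_space_def)
    then show ?thesis using gdelta_in_Un[OF g1 g2] by simp
  qed
  have "completely_metrizable_space ?\<tau>"
    using completely_metrizable_space_gdelta_in[OF completely_metrizable_space_euclidean gd] .
  moreover have "second_countable ?\<tau>"
  proof -
    have "second_countable (euclidean :: (real \<times> real) topology)"
    proof -
      obtain \<B> :: "(real \<times> real) set set" where B: "countable \<B>" "\<And>X. X \<in> \<B> \<Longrightarrow> open X"
        "\<And>S. open S \<Longrightarrow> \<exists>U\<subseteq>\<B>. S = \<Union>U" using univ_second_countable by metis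
      have "\<exists>V\<in>\<B>. z \<in> V \<and> V \<subseteq> U" if "open U" "z \<in> U" for U z
        using B(3)[OF that(1)] that(2) by (elim exE conjE) blast
      then show ?thesis unfolding second_countable_def
        using B(1,2) by (intro exI[of _ \<B>]) simp
    qed
    then show ?thesis by (rule second_countable_subtopology)
  qed
  moreover have "sets flow_measure = sigma_sets (space flow_measure) {U. openin ?\<tau> U}"
  proof -
    have bs: "flow_space \<in> sets borel"
    proof -
      have "flow_space = {z \<in> space (borel \<Otimes>\<^sub>M borel). 0 \<le> fst z \<and> fst z < 1 \<and> 0 \<le> snd z \<and> snd z < f (fst z)}"
        by (auto simp: special_flow_space_def space_pair_measure)
      also have "\<dots> \<in> sets (borel \<Otimes>\<^sub>M borel)" by measurable
      finally show ?thesis by (simp only: borel_prod)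
    qed
    have op: "{U. openin ?\<tau> U} = (\<inter>) flow_space ` {U. open U}" by (auto simp: openin_open)
    have id1: "(\<lambda>z. z) \<in> measurable (restrict_space borel ({0..<1} \<times> (UNIV :: real set))) strip"
    proof -
      have "(\<lambda>z. (fst z, snd z)) \<in> measurable (restrict_space borel ({0..<1} \<times> (UNIV :: real set))) strip"
      proof (rule measurable_strip_Pair)
        show "fst \<in> measurable (restrict_space borel ({0..<1} \<times> (UNIV :: real set))) circle_measure"
          unfolding circle_measure_def
          by (rule measurable_restrict_space2)
             (auto simp: space_restrict_space
               intro!: measurable_restrict_space1 borel_measurable_continuous_onI continuous_intros)
        show "snd \<in> measurable (restrict_space borel ({0..<1} \<times> (UNIV :: real set))) borel"
          by (intro measurable_restrict_space1 borel_measurable_continuous_onI continuous_intros)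
      qed
      then show ?thesis by simp
    qed
    have id2: "(\<lambda>z. z) \<in> measurable strip borel"
    proof -
      have "(\<lambda>z. (fst z, snd z)) \<in> measurable strip (borel \<Otimes>\<^sub>M borel)"
        by (intro measurable_Pair measurable_compose[OF fst_strip] snd_strip borel_measurable_circle) simp
      then show ?thesis by (simp add: borel_prod)
    qed
    have "sets flow_measure = sets (restrict_space borel flow_space)"
    proof (intro equalityI subsetI)
      fix A assume "A \<in> sets flow_measure"
      then have A: "A \<in> sets strip" "A \<subseteq> flow_space" by (auto simp: sets_flow_measure_iff)
      have "A \<inter> ({0..<1} \<times> UNIV) \<in> sets (restrict_space borel ({0..<1} \<times> (UNIV :: real set)))"
        using measurable_sets[OF id1 A(1)] by (simp add: space_restrict_space)
      moreover have "A \<inter> ({0..<1} \<times> UNIV) = A" using A(2) by (auto simp: special_flow_space_def)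
      ultimately have "A \<in> sets borel"
        by (subst (asm) sets_restrict_space_iff) (auto simp: borel_prod[symmetric])
      then show "A \<in> sets (restrict_space borel flow_space)"
        using A bs by (subst sets_restrict_space_iff) auto
    next
      fix A assume "A \<in> sets (restrict_space borel flow_space)"
      then have A: "A \<in> sets borel" "A \<subseteq> flow_space"
        using bs by (auto simp: sets_restrict_space_iff)
      then show "A \<in> sets flow_measure"
        using measurable_sets[OF id2 A(1)] by (auto simp: sets_flow_measure_iff space_strip special_flow_space_def Int_absorb2 subset_iff)
    qed
    also have "\<dots> = sigma_sets flow_space {U. openin ?\<tau> U}"
    proof -
      have sb: "sets borel = sigma_sets UNIV {U :: (real \<times> real) set. open U}" by (simp add: borel_def)
      show ?thesis unfolding sets_restrict_space op sb
        by (rule sigma_sets_Int) (use bs sb in auto)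
    qed
    finally show ?thesis by simp
  qed
  ultimately show ?thesis unfolding standard_borel_def by (intro exI[of _ ?\<tau>]) simp
qed

end

section \<open>From drifting Birkhoff sums to the SWR-property\<close>

text \<open>
  The windows in which the orbits of two points run parallel. The factor 4 is a convenient choice; what matters is
  that the length of the window is comparable to its distance from 0. The window may lie on either side of 0, which
  is where the switch between the two directions of time in the SWR-property comes from.
\<close>

definition drifts :: "real \<Rightarrow> real \<Rightarrow> real \<Rightarrow> real \<Rightarrow> nat \<Rightarrow> (int \<Rightarrow> real) \<Rightarrow> bool" where
  "drifts c1 c2 \<kappa> e N D \<longleftrightarrow> (\<exists>(R::nat) (L::nat) (b::int) p. N < R \<and> \<kappa> * real R \<le> real L \<and>
     c1 \<le> \<bar>p\<bar> \<and> \<bar>p\<bar> \<le> c2 \<and>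
     (int R \<le> b \<and> b + int L \<le> 4 * int R \<or> - 4 * int R \<le> b \<and> b + int L \<le> - int R) \<and>
     (\<forall>n\<in>{b..b + int L}. \<bar>D n - p\<bar> \<le> e))"

lemma drifts_antimono: "N \<le> N' \<Longrightarrow> drifts c1 c2 \<kappa> e N' D \<Longrightarrow> drifts c1 c2 \<kappa> e N D"
  unfolding drifts_def by (meson le_less_trans)

text \<open>Truncate \<open>g\<close> at a height above which little of its integral remains.\<close>

lemma integral_small_of_measure_small:
  assumes M: "finite_measure M" and g: "integrable M g" "\<And>x. 0 \<le> (g x :: real)" and e: "0 < e"
  shows "\<exists>\<tau>>0. \<forall>A\<in>sets M. measure M A \<le> \<tau> \<longrightarrow> (\<integral>x. g x * indicator A x \<partial>M) \<le> e"
proof -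
  interpret finite_measure M by fact
  have [measurable]: "g \<in> borel_measurable M" using g by auto
  have "(\<lambda>n. \<integral>x. min (g x) (real n) \<partial>M) \<longlonglongrightarrow> (\<integral>x. g x \<partial>M)"
  proof (rule integral_dominated_convergence[where w = g])
    show "AE x in M. (\<lambda>n. min (g x) (real n)) \<longlonglongrightarrow> g x"
    proof (rule AE_I2, rule tendsto_eventually)
      fix x
      obtain N :: nat where "g x \<le> real N" using real_arch_simple by blast
      then have "min (g x) (real n) = g x" if "N \<le> n" for n using that by (simp add: min_def)
      then show "\<forall>\<^sub>F n in sequentially. min (g x) (real n) = g x" by (auto simp: eventually_sequentially)
    qed
  qed (use g in auto)
  then have "\<forall>\<^sub>F n in sequentially. (\<integral>x. g x \<partial>M) - e / 2 < (\<integral>x. min (g x) (real n) \<partial>M)"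
    using e by (intro order_tendstoD) auto
  then obtain n :: nat where n: "(\<integral>x. g x \<partial>M) - e / 2 < (\<integral>x. min (g x) (real n) \<partial>M)"
    by (auto simp: eventually_sequentially)
  have im: "integrable M (\<lambda>x. min (g x) (real n))"
    by (rule Bochner_Integration.integrable_bound[OF g(1)]) (use g(2) in \<open>auto simp: min_def\<close>)
  show ?thesis
  proof (intro exI[of _ "e / (2 * (real n + 1))"] conjI ballI impI)
    show "0 < e / (2 * (real n + 1))" using e by simp
    fix A assume A: "A \<in> sets M" "measure M A \<le> e / (2 * (real n + 1))"
    have iA: "integrable M (\<lambda>x. real n * indicator A x)"
      using A by (intro integrable_mult_right) (auto simp: integrable_indicator_iff emeasure_eq_measure)
    have "(\<integral>x. g x * indicator A x \<partial>M) \<le> (\<integral>x. (g x - min (g x) (real n)) + real n * indicator A x \<partial>M)"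
    proof (rule integral_mono)
      show "integrable M (\<lambda>x. g x * indicator A x)"
        using integrable_mult_indicator[OF A(1) g(1)] by (simp add: mult.commute)
      show "g x * indicator A x \<le> (g x - min (g x) (real n)) + real n * indicator A x" for x
        using g(2)[of x] by (auto simp: indicator_def min_def)
    qed (intro Bochner_Integration.integrable_add Bochner_Integration.integrable_diff g(1) im iA)
    also have "\<dots> = (\<integral>x. g x \<partial>M) - (\<integral>x. min (g x) (real n) \<partial>M) + real n * measure M A"
      using A(1) sets.sets_into_space[OF A(1)] im iA g(1)
      by (simp add: Int_absorb1)
    also have "real n * measure M A \<le> real n * (e / (2 * (real n + 1)))"
      using A by (intro mult_left_mono) auto
    also have "\<dots> \<le> e / 2" using e by (simp add: field_simps)
    finally show "(\<integral>x. g x * indicator A x \<partial>M) \<le> e" using n by linarith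
  qed
qed

lemma multiples_in_interval:
  fixes c D t0 :: real
  assumes "0 < t0" "0 \<le> c" "3 * t0 \<le> D"
  shows "\<exists>m l :: nat. c / t0 \<le> m \<and> m \<le> c / t0 + 1 \<and> D / t0 - 3 \<le> l \<and> l \<le> D / t0 \<and>
    (\<forall>n\<in>{m..m + l}. c < real n * t0 \<and> real n * t0 < c + D)"
proof -
  define m where "m = nat (\<lfloor>c / t0\<rfloor> + 1)"
  define l where "l = nat (\<lfloor>D / t0\<rfloor> - 2)"
  have c0: "0 \<le> c / t0" and D0: "3 \<le> D / t0" using assms by (simp_all add: field_simps)
  have m: "real m = of_int \<lfloor>c / t0\<rfloor> + 1" unfolding m_def using c0 by simp
  have l: "real l = of_int \<lfloor>D / t0\<rfloor> - 2"
  proof -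
    have "3 \<le> \<lfloor>D / t0\<rfloor>" using D0 by (simp add: le_floor_iff)
    then show ?thesis unfolding l_def by simp
  qed
  have "c < real n * t0 \<and> real n * t0 < c + D" if "n \<in> {m..m + l}" for n
  proof -
    have "c / t0 < real m" unfolding m by linarith
    also have "real m \<le> real n" using that by simp
    finally have 1: "c / t0 < real n" .
    have "real n \<le> real m + real l" using that by simp
    also have "\<dots> < c / t0 + D / t0" unfolding m l by linarith
    finally have 2: "real n < (c + D) / t0" by (simp add: add_divide_distrib)
    show ?thesis using 1 2 assms(1) by (simp add: field_simps)
  qed
  moreover have "c / t0 \<le> m" "m \<le> c / t0 + 1" "D / t0 - 3 \<le> l" "l \<le> D / t0"
    unfolding m l by linarith+
  ultimately show ?thesis by blast
qed

context rotation_flow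
begin

text \<open>
  The relative precision \<open>\<tau>\<close> refers to the relative length \<open>\<kappa>\<close> of the window: short windows have
  to be more precise.
\<close>

definition birkhoff_drift :: "real \<Rightarrow> real \<Rightarrow> bool" where
  "birkhoff_drift c1 c2 \<longleftrightarrow> (\<forall>\<tau>>0. \<exists>\<kappa> X0. 0 < \<kappa> \<and> \<kappa> \<le> 1 \<and>
     X0 \<in> sets circle_measure \<and> 1 - \<tau> < measure circle_measure X0 \<and>
     (\<forall>N. \<exists>\<delta>>0. \<forall>x\<in>X0. \<forall>y\<in>X0. x \<noteq> y \<longrightarrow> circle_dist x y < \<delta> \<longrightarrow>
       drifts c1 c2 \<kappa> (\<tau> * \<kappa>) N (\<lambda>n. birk n x - birk n y)))"

lemma flow_funpow:
  assumes "z \<in> flow_space"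
  shows "(flow t ^^ n) z = flow (real n * t) z"
proof (induction n)
  case 0
  then show ?case using flow_0[OF assms] by simp
next
  case (Suc n)
  then show ?case using flow_add[OF assms, of t "real n * t"] by (simp add: algebra_simps)
qed

text \<open>
  As long as the first orbit is at least \<open>\<eta>\<close> away from the ends of its current lap, the second one, shifted by
  \<open>p\<close>, is in the lap with the same number.
\<close>

lemma flow_close:
  assumes z: "(x, u) \<in> flow_space" and w: "(y, u') \<in> flow_space"
    and lo: "birk n x + \<eta> \<le> t + u" and hi: "t + u < birk (n + 1) x - \<eta>"
    and e: "\<bar>birk n x - birk n y - p\<bar> \<le> e" "\<bar>birk (n + 1) x - birk (n + 1) y - p\<bar> \<le> e"
    and small: "e + \<bar>u - u'\<bar> \<le> \<eta>" "circle_dist x y + \<bar>u - u'\<bar> + e < \<epsilon>"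
  shows "special_flow_dist circle_dist (flow t (x, u)) (flow (t + - p) (y, u')) < \<epsilon>"
proof -
  have xy: "x \<in> {0..<1}" "y \<in> {0..<1}" using z w by (auto simp: special_flow_space_def)
  have e0: "0 \<le> e" using e(1) by linarith
  have "flow t (x, u) = (frac (x + of_int n * \<alpha>), t + u - birk n x)"
    by (rule flow_eq) (use xy lo hi small e0 in auto)
  moreover have "flow (t + - p) (y, u') = (frac (y + of_int n * \<alpha>), t + - p + u' - birk n y)"
    by (rule flow_eq) (use xy lo hi small e in linarith)+
  ultimately show ?thesis using small e
    by (simp add: special_flow_dist_def circle_dist_frac) (simp add: circle_dist_def)
qed

definition margin :: "real \<Rightarrow> (real \<times> real) set" where
  "margin \<eta> = {z \<in> flow_space. snd z < \<eta> \<or> f (fst z) - \<eta> \<le> snd z}"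

lemma margin_sets: "margin \<eta> \<in> sets strip"
proof -
  have "margin \<eta> = flow_space \<inter> {z \<in> space strip. snd z < \<eta> \<or> f (fst z) - \<eta> \<le> snd z}"
    by (auto simp: margin_def space_strip special_flow_space_def)
  also have "\<dots> \<in> sets strip" by measurable
  finally show ?thesis .
qed

lemma measure_margin: "0 < \<eta> \<Longrightarrow> measure flow_measure (margin \<eta>) \<le> 2 * \<eta> / mass"
proof -
  assume \<eta>: "0 < \<eta>"
  have "emeasure strip (margin \<eta>) = (\<integral>\<^sup>+x. emeasure lborel {s. (x, s) \<in> margin \<eta>} \<partial>circle_measure)"
    by (rule emeasure_strip) (rule margin_sets)
  also have "\<dots> \<le> (\<integral>\<^sup>+x. ennreal (2 * \<eta>) \<partial>circle_measure)"
  proof (rule nn_integral_mono)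
    fix x :: real assume "x \<in> space circle_measure"
    have "emeasure lborel {s. (x, s) \<in> margin \<eta>} \<le> emeasure lborel ({0..\<eta>} \<union> {f x - \<eta>..f x})"
      by (intro emeasure_mono) (auto simp: margin_def special_flow_space_def)
    also have "\<dots> \<le> emeasure lborel {0..\<eta>} + emeasure lborel {f x - \<eta>..f x}"
      by (intro emeasure_subadditive) auto
    also have "\<dots> = ennreal (2 * \<eta>)" using \<eta> by (simp flip: ennreal_plus)
    finally show "emeasure lborel {s. (x, s) \<in> margin \<eta>} \<le> ennreal (2 * \<eta>)" .
  qed
  also have "\<dots> = ennreal (2 * \<eta>)"
    using prob_space.emeasure_space_1[OF prob_space_circle_measure] by simp
  finally have "emeasure flow_measure (margin \<eta>) \<le> ennreal (1 / mass) * ennreal (2 * \<eta>)"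
    by (subst emeasure_flow_measure) (auto simp: margin_sets intro: mult_left_mono, auto simp: margin_def)
  also have "\<dots> = ennreal (2 * \<eta> / mass)" using mass_pos \<eta> by (simp flip: ennreal_mult)
  finally show ?thesis using mass_pos \<eta> by (simp add: measure_def enn2real_leI)
qed

lemma margin_orbit_density:
  assumes \<lambda>: "0 < r" and \<eta>: "0 < \<eta>" "2 * \<eta> / mass / r \<le> e"
  shows "\<exists>Y\<in>sets flow_measure. measure flow_measure Y \<le> e \<and>
    (\<forall>z\<in>flow_space - Y. \<forall>n\<ge>1. real (card {j \<in> {..<n}. flow (real j * t) z \<in> margin \<eta>}) \<le> r * real n)"
proof -
  interpret P: prob_space flow_measure by (rule prob_space_flow_measure)
  have ms: "margin \<eta> \<in> sets flow_measure"
    unfolding sets_flow_measure_iff using margin_sets by (auto simp: margin_def)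
  let ?Y = "{z \<in> space flow_measure. \<exists>n\<ge>1. r * real n < (\<Sum>j<n. indicat_real (margin \<eta>) ((flow t ^^ j) z))}"
  have sub: "margin \<eta> \<inter> flow_space = margin \<eta>" by (auto simp: margin_def)
  have int: "integrable flow_measure (indicat_real (margin \<eta>))"
    using ms by (auto simp: sub integrable_indicator_iff P.emeasure_eq_measure)
  have I: "(\<integral>z. indicat_real (margin \<eta>) z \<partial>flow_measure) = measure flow_measure (margin \<eta>)"
    using ms by (simp add: sub)
  have "?Y \<in> sets flow_measure"
    by (rule maximal_inequality(1)) (use int flow_measurable distr_flow \<lambda> P.finite_measure_axioms in auto)
  moreover have "measure flow_measure ?Y \<le> e"
  proof -
    have "measure flow_measure ?Y \<le> (\<integral>z. indicat_real (margin \<eta>) z \<partial>flow_measure) / r"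
      by (rule maximal_inequality(2)) (use int flow_measurable distr_flow \<lambda> P.finite_measure_axioms in auto)
    also have "\<dots> \<le> 2 * \<eta> / mass / r"
      unfolding I using measure_margin[OF \<eta>(1)] \<lambda> by (intro divide_right_mono) auto
    finally show ?thesis using \<eta> by linarith
  qed
  moreover have "real (card {j \<in> {..<n}. flow (real j * t) z \<in> margin \<eta>}) \<le> r * real n"
    if z: "z \<in> flow_space - ?Y" and n: "1 \<le> n" for z n
  proof -
    have "(\<Sum>j<n. indicat_real (margin \<eta>) ((flow t ^^ j) z)) = real (card {j \<in> {..<n}. flow (real j * t) z \<in> margin \<eta>})"
      using z by (simp add: flow_funpow indicator_def sum_of_bool_eq lessThan_def Collect_conj_eq)
    then show ?thesis using z n by (auto simp: not_less)
  qed
  ultimately show ?thesis by blast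
qed

text \<open>
  The maximal inequality for \<open>f\<close> itself. With the linear growth from below it makes the number of
  returns and the flow time comparable.
\<close>

lemma birk_linear_bound:
  assumes e: "0 < e"
  shows "\<exists>K>0. \<exists>Y\<in>sets circle_measure. measure circle_measure Y \<le> e \<and>
    (\<forall>x\<in>{0..<1} - Y. \<forall>n\<ge>1. birk (int n) x \<le> K * real n \<and> - birk (- int n) x \<le> K * real (n + 1))"
proof -
  interpret P: prob_space circle_measure by (rule prob_space_circle_measure)
  define K where "K = 2 * mass / e"
  have K: "0 < K" using mass_pos e by (simp add: K_def)
  define Y where "Y \<beta> = {x \<in> space circle_measure. \<exists>n\<ge>1. K * real n < (\<Sum>j<n. f (((\<lambda>x. frac (x + \<beta>)) ^^ j) x))}" for \<beta>
  have iter: "f (((\<lambda>x. frac (x + \<beta>)) ^^ j) x) = f (x + real j * \<beta>)" for \<beta> x j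
  proof -
    have "frac (((\<lambda>x. frac (x + \<beta>)) ^^ j) x) = frac (x + real j * \<beta>)"
      by (induction j) (simp_all add: algebra_simps, metis add.assoc add.commute frac_frac_add frac_add_frac)
    then show ?thesis by (metis f_frac)
  qed
  have Ys: "Y \<beta> \<in> sets circle_measure" and Ym: "measure circle_measure (Y \<beta>) \<le> e / 2" for \<beta>
  proof -
    show "Y \<beta> \<in> sets circle_measure" unfolding Y_def
      by (rule maximal_inequality(1))
         (use L1 distr_frac_rotation positive K P.finite_measure_axioms in \<open>auto intro: less_imp_le\<close>)
    have "measure circle_measure (Y \<beta>) \<le> mass / K" unfolding Y_def mass_def
      by (rule maximal_inequality(2))
         (use L1 distr_frac_rotation positive K P.finite_measure_axioms in \<open>auto intro: less_imp_le\<close>)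
    also have "\<dots> = e / 2" using mass_pos e by (simp add: K_def)
    finally show "measure circle_measure (Y \<beta>) \<le> e / 2" .
  qed
  have "measure circle_measure (Y \<alpha> \<union> Y (- \<alpha>)) \<le> measure circle_measure (Y \<alpha>) + measure circle_measure (Y (- \<alpha>))"
    by (rule measure_Un_le) (rule Ys)+
  then have "measure circle_measure (Y \<alpha> \<union> Y (- \<alpha>)) \<le> e" using Ym[of \<alpha>] Ym[of "- \<alpha>"] by linarith
  moreover have "birk (int n) x \<le> K * real n \<and> - birk (- int n) x \<le> K * real (n + 1)"
    if x: "x \<in> {0..<1} - (Y \<alpha> \<union> Y (- \<alpha>))" and n: "1 \<le> n" for x n
  proof -
    have 1: "(\<Sum>j<n. f (x + real j * \<alpha>)) \<le> K * real n"
      using x n unfolding Y_def iter by (auto simp: not_less)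
    have "n + 1 \<ge> 1" by simp
    then have 2: "(\<Sum>j<n + 1. f (x + real j * (- \<alpha>))) \<le> K * real (n + 1)"
      using x unfolding Y_def iter by (auto simp: not_less simp del: sum.lessThan_Suc)
    have 3: "- birk (- int m) x = (\<Sum>j<m. f (x + real (Suc j) * (- \<alpha>)))" for m
    proof (induction m)
      case (Suc m)
      have "birk (- int m) x = birk (- int (Suc m)) x + f (x + of_int (- int (Suc m)) * \<alpha>)"
        using birk_Suc[of "- int (Suc m)" x] by simp
      moreover have "x + of_int (- int (Suc m)) * \<alpha> = x + real (Suc m) * (- \<alpha>)"
        by (simp add: algebra_simps)
      ultimately show ?case using Suc by simp
    qed simp
    have "(\<Sum>j<n. f (x + real (Suc j) * (- \<alpha>))) \<le> (\<Sum>j<n + 1. f (x + real j * (- \<alpha>)))"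
      using sum.lessThan_Suc_shift[of "\<lambda>j. f (x + real j * (- \<alpha>))" n] positive[of x] by simp
    then show ?thesis using 1 2 3[of n] by (simp add: birk_of_nat)
  qed
  ultimately show ?thesis using K Ys by (intro exI[of _ K] conjI bexI[of _ "Y \<alpha> \<union> Y (- \<alpha>)"]) auto
qed

lemma measure_over_base:
  assumes "A \<in> sets circle_measure"
  shows "{z \<in> flow_space. fst z \<in> A} \<in> sets flow_measure"
    and "measure flow_measure {z \<in> flow_space. fst z \<in> A} = (\<integral>x. f x * indicator A x \<partial>circle_measure) / mass"
proof -
  let ?W = "{z \<in> flow_space. fst z \<in> A}"
  have "?W = flow_space \<inter> (fst -` A \<inter> space strip)"
    by (auto simp: space_strip special_flow_space_def)
  also have "\<dots> \<in> sets strip"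
    using measurable_sets[OF fst_strip assms] flow_space_sets by auto
  finally have W: "?W \<in> sets strip" .
  then show Ws: "?W \<in> sets flow_measure" by (auto simp: sets_flow_measure_iff)
  have "emeasure strip ?W = (\<integral>\<^sup>+x. emeasure lborel {s. (x, s) \<in> ?W} \<partial>circle_measure)"
    by (rule emeasure_strip) (rule W)
  also have "\<dots> = (\<integral>\<^sup>+x. ennreal (f x * indicator A x) \<partial>circle_measure)"
  proof (rule nn_integral_cong)
    fix x :: real assume "x \<in> space circle_measure"
    then have "{s. (x, s) \<in> ?W} = (if x \<in> A then {0..<f x} else {})"
      by (auto simp: special_flow_space_def)
    then show "emeasure lborel {s. (x, s) \<in> ?W} = ennreal (f x * indicator A x)"
      using positive[of x] by simp
  qed
  also have "\<dots> = ennreal (\<integral>x. f x * indicator A x \<partial>circle_measure)"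
  proof (rule nn_integral_eq_integral)
    show "integrable circle_measure (\<lambda>x. f x * indicator A x)"
      using integrable_mult_indicator[OF assms L1] by (simp add: mult.commute)
    show "AE x in circle_measure. 0 \<le> f x * indicator A x"
      using positive by (intro AE_I2) (simp add: indicator_def less_imp_le)
  qed
  finally have "emeasure flow_measure ?W = ennreal (1 / mass) * ennreal (\<integral>x. f x * indicator A x \<partial>circle_measure)"
    using W by (subst emeasure_flow_measure) auto
  moreover have "0 \<le> (\<integral>x. f x * indicator A x \<partial>circle_measure)"
    using positive by (intro Bochner_Integration.integral_nonneg) (simp add: indicator_def less_imp_le)
  ultimately show "measure flow_measure ?W = (\<integral>x. f x * indicator A x \<partial>circle_measure) / mass"
    using mass_pos by (simp add: measure_def enn2real_mult)
qed

text \<open>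
  A window of returns yields a window of flow times of comparable relative length. The assumptions \<open>large\<close>
  absorb all additive constants, such as the rounding to multiples of \<open>t0\<close>.
\<close>

lemma flow_times_in_window:
  fixes b :: int and L R N n0 :: nat and K c0 \<kappa> t0 \<sigma> :: real
  assumes z: "(x, u) \<in> flow_space"
    and gr: "\<And>n x. n0 \<le> n \<Longrightarrow> c0 * real n \<le> birk (int n) x" and c0: "0 < c0"
    and K: "0 < K" "\<And>n. n \<ge> 1 \<Longrightarrow> birk (int n) x \<le> K * real n \<and> - birk (- int n) x \<le> K * real (n + 1)"
    and t0: "0 < t0" and \<kappa>: "0 < \<kappa>" "\<kappa> \<le> 1"
    and win: "\<sigma> = 1 \<and> int R \<le> b \<and> b + int L \<le> 4 * int R \<or> \<sigma> = - 1 \<and> - 4 * int R \<le> b \<and> b + int L \<le> - int R"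
    and L: "\<kappa> * real R \<le> real L"
    and large: "real n0 + 1 \<le> \<kappa> * real R" "(real N + 1) * t0 < c0 * (real R - 1)"
      "6 * t0 \<le> c0 * \<kappa> * real R" "2 * (real N + 1) * t0 < c0 * \<kappa> * real R" "t0 \<le> K * real R"
  shows "\<exists>m l :: nat. N < m \<and> N < l \<and> c0 / (14 * K) * \<kappa> * real m \<le> real l \<and>
    (\<forall>n\<in>{m..m + l}. birk b x \<le> \<sigma> * (real n * t0) + u \<and> \<sigma> * (real n * t0) + u < birk (b + int L) x)"
proof -
  have u: "0 \<le> u" "u < f x" using z by (auto simp: special_flow_space_def)
  have "\<kappa> * real R \<le> 1 * real R" using \<kappa> by (intro mult_right_mono) auto
  then have R: "real n0 + 1 \<le> real R" "1 \<le> real R" using large(1) by linarith+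
  have f1: "birk 1 x = f x" using birk_Suc[of 0 x] by simp
  define D where "D = birk (b + int L) x - birk b x"
  \<comment> \<open>The beginning of the window of flow times, seen from the present in the direction \<open>\<sigma>\<close>.\<close>
  define c where "c = (if \<sigma> = 1 then birk b x - u else u - birk (b + int L) x)"
  have "D = birk (int L) (x + of_int b * \<alpha>)" unfolding D_def by (simp add: birk_add)
  moreover have "n0 \<le> L" using large(1) L by linarith
  ultimately have "c0 * real L \<le> D" using gr by simp
  moreover have "c0 * (\<kappa> * real R) \<le> c0 * real L" using L c0 by (intro mult_left_mono) auto
  ultimately have D: "c0 * \<kappa> * real R \<le> D" by (simp add: mult.assoc)
  have c_lower: "c0 * (real R - 1) \<le> c"
  proof (cases "\<sigma> = 1")
    case True
    then have b: "int R \<le> b" using win by auto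
    have "c0 * real (R - 1) \<le> birk (int (R - 1)) (x + of_int 1 * \<alpha>)"
      using R by (intro gr) linarith
    also have "\<dots> = birk (int R) x - birk 1 x"
      using birk_add[of 1 "int (R - 1)" x] R by (simp add: of_nat_diff)
    also have "\<dots> \<le> birk b x - birk 1 x" using birk_mono[OF b] by simp
    finally show ?thesis using True u f1 R by (simp add: c_def of_nat_diff)
  next
    case False
    then have b: "b + int L \<le> - int R" using win by auto
    have "c0 * real R \<le> birk (int R) (x - of_int (int R) * \<alpha>)" using R by (intro gr) linarith
    also have "\<dots> = - birk (- int R) x" by (simp add: birk_minus)
    also have "\<dots> \<le> - birk (b + int L) x" using birk_mono[OF b] by simp
    finally show ?thesis using False u c0 by (simp add: c_def algebra_simps)
  qed
  have c_upper: "c \<le> 6 * K * real R"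
  proof (cases "\<sigma> = 1")
    case True
    then have b: "b \<le> int (4 * R)" using win by auto
    have "birk b x \<le> K * real (4 * R)"
      using birk_mono[OF b, of x] K(2)[of "4 * R"] R by linarith
    then have "c \<le> 4 * (K * real R)" using True u by (simp add: c_def)
    then show ?thesis using K(1) R mult_nonneg_nonneg[of K "real R"] by linarith
  next
    case False
    then have b: "- int (4 * R) \<le> b + int L" using win by auto
    have "- birk (b + int L) x \<le> K * real (4 * R + 1)"
      using birk_mono[OF b, of x] K(2)[of "4 * R"] R by linarith
    moreover have "f x \<le> K" using K(2)[of 1] f1 by simp
    ultimately have "c \<le> 4 * (K * real R) + 2 * K" using False u by (simp add: c_def algebra_simps)
    moreover have "K * 1 \<le> K * real R" using K(1) R by (intro mult_left_mono) auto
    ultimately show ?thesis by simp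
  qed
  have "0 \<le> c0 * (real R - 1)" using c0 R by simp
  then have c0': "0 \<le> c" using c_lower by linarith
  obtain m l :: nat where ml: "c / t0 \<le> m" "m \<le> c / t0 + 1" "D / t0 - 3 \<le> l"
    "\<forall>n\<in>{m..m + l}. c < real n * t0 \<and> real n * t0 < c + D"
    using multiples_in_interval[OF t0 c0', of D] D large(3) t0 by auto
  have "(real N + 1) * t0 < c" using large(2) c_lower by linarith
  then have "real N + 1 < c / t0" using t0 by (simp add: field_simps)
  then have "N < m" using ml(1) by linarith
  moreover have l: "c0 * \<kappa> * real R / (2 * t0) \<le> real l"
  proof -
    define a where "a = c0 * \<kappa> * real R / t0"
    have "a \<le> D / t0" unfolding a_def using D t0 by (intro divide_right_mono) auto
    moreover have "6 \<le> a" using large(3) t0 by (simp add: a_def field_simps)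
    moreover have "c0 * \<kappa> * real R / (2 * t0) = a / 2" by (simp add: a_def)
    ultimately show ?thesis using ml(3) by linarith
  qed
  moreover have "N < l"
  proof -
    have "real N + 1 < c0 * \<kappa> * real R / (2 * t0)" using large(4) t0 by (simp add: field_simps)
    then show ?thesis using l by linarith
  qed
  moreover have "c0 / (14 * K) * \<kappa> * real m \<le> real l"
  proof -
    define a where "a = K * real R / t0"
    have "c / t0 \<le> 6 * K * real R / t0" using c_upper t0 by (intro divide_right_mono) auto
    moreover have "6 * K * real R / t0 = 6 * a" "7 * K * real R / t0 = 7 * a" by (simp_all add: a_def)
    moreover have "1 \<le> a" using large(5) t0 by (simp add: a_def field_simps)
    ultimately have "real m \<le> 7 * K * real R / t0" using ml(2) by linarith
    then have "c0 / (14 * K) * \<kappa> * real m \<le> c0 / (14 * K) * \<kappa> * (7 * K * real R / t0)"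
      using c0 K(1) \<kappa> by (intro mult_left_mono) auto
    also have "\<dots> = c0 * \<kappa> * real R / (2 * t0)" using K(1) by (simp add: field_simps)
    finally show ?thesis using l by linarith
  qed
  moreover have "birk b x \<le> \<sigma> * (real n * t0) + u \<and> \<sigma> * (real n * t0) + u < birk (b + int L) x"
    if "n \<in> {m..m + l}" for n
  proof -
    have "c < real n * t0" "real n * t0 < c + D" using ml(4) that by blast+
    moreover have "\<sigma> = 1 \<or> \<sigma> = - 1" using win by blast
    ultimately show ?thesis by (auto simp: c_def D_def)
  qed
  ultimately show ?thesis by blast
qed

lemma close_outside_margin:
  assumes z: "(x, u) \<in> flow_space" and w: "(y, u') \<in> flow_space"
    and t: "birk b x \<le> t + u" "t + u < birk (b + int L) x"
    and out: "flow t (x, u) \<notin> margin \<eta>"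
    and e: "\<And>n. n \<in> {b..b + int L} \<Longrightarrow> \<bar>birk n x - birk n y - p\<bar> \<le> e"
    and small: "e + \<bar>u - u'\<bar> \<le> \<eta>" "circle_dist x y + \<bar>u - u'\<bar> + e < \<epsilon>"
  shows "special_flow_dist circle_dist (flow t (x, u)) (flow (t + - p) (y, u')) < \<epsilon>"
proof -
  obtain n where n: "birk n x \<le> t + u" "t + u < birk (n + 1) x" using lap_exists by blast
  have x: "x \<in> {0..<1}" using z by (auto simp: special_flow_space_def)
  have "b < n + 1" using birk_mono[of "n + 1" b x] n t by linarith
  moreover have "n < b + int L" using birk_mono[of "b + int L" n x] n t by linarith
  ultimately have nb: "n \<in> {b..b + int L}" "n + 1 \<in> {b..b + int L}" by auto
  have "flow t (x, u) = (frac (x + of_int n * \<alpha>), t + u - birk n x)" using flow_eq[OF x n] .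
  moreover have "flow t (x, u) \<in> flow_space" by (rule flow_in_space[OF z])
  ultimately have "birk n x + \<eta> \<le> t + u" "t + u < birk (n + 1) x - \<eta>"
    using out birk_Suc[of n x] by (auto simp: margin_def not_less not_le)
  then show ?thesis using flow_close[OF z w _ _ e[OF nb(1)] e[OF nb(2)] small] by blast
qed

lemma card_window_ge:
  assumes "finite S" "\<And>n. n \<in> {m..m + l} \<Longrightarrow> n \<notin> S \<Longrightarrow> Q n"
  shows "real l + 1 - real (card S) \<le> real (card {n \<in> {m..m + l :: nat}. Q n})"
proof -
  have "{m..m + l} \<subseteq> {n \<in> {m..m + l}. Q n} \<union> S" using assms by auto
  then have "card {m..m + l} \<le> card ({n \<in> {m..m + l}. Q n} \<union> S)"
    using assms by (intro card_mono) auto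
  also have "\<dots> \<le> card {n \<in> {m..m + l}. Q n} + card S" by (rule card_Un_le)
  finally show ?thesis by simp
qed

text \<open>
  The times \<open>n * t0\<close> at which the two points are not close are visits to \<open>margin \<eta>\<close>, the part of the space near
  its floor and its roof. By the maximal inequality these have, outside a small set, density at most \<open>r\<close> in every
  initial segment of an orbit, hence density of order \<open>r / \<kappa>\<close> in windows whose length is \<open>\<kappa>\<close> times their
  starting time. This forces \<open>\<eta>\<close> to be a small multiple of \<open>\<kappa>\<close>, which is why the drift has to be
  constant up to \<open>\<tau> * \<kappa>\<close> and not just up to \<open>\<tau>\<close>.
\<close>

lemma switchable_R_of_drift:
  assumes t0: "0 < t0" and c1: "0 < c1"
    and drift: "birkhoff_drift c1 c2"
  shows "switchable_R flow_measure (special_flow_dist circle_dist) flow t0 ({- c2..- c1} \<union> {c1..c2})"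
  unfolding switchable_R_def
proof (intro allI impI)
  interpret P: prob_space flow_measure by (rule prob_space_flow_measure)
  interpret C: prob_space circle_measure by (rule prob_space_circle_measure)
  fix \<epsilon>' :: real assume "0 < \<epsilon>'"
  define \<epsilon> where "\<epsilon> = min \<epsilon>' 1"
  have \<epsilon>: "0 < \<epsilon>" "\<epsilon> \<le> 1" "\<epsilon> \<le> \<epsilon>'" using \<open>0 < \<epsilon>'\<close> by (auto simp: \<epsilon>_def)
  obtain c0 n0 where c0: "0 < c0" and gr: "\<And>n x. n0 \<le> n \<Longrightarrow> c0 * real n \<le> birk (int n) x"
    by (rule birk_growth) blast
  have "0 < mass * \<epsilon> / 8" using mass_pos \<epsilon> by simp
  then obtain \<tau>1 where \<tau>1: "0 < \<tau>1"
    "\<And>A. A \<in> sets circle_measure \<Longrightarrow> measure circle_measure A \<le> \<tau>1 \<Longrightarrow> (\<integral>x. f x * indicator A x \<partial>circle_measure) \<le> mass * \<epsilon> / 8"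
    using integral_small_of_measure_small[OF C.finite_measure_axioms L1 less_imp_le[OF positive]] by metis
  have "0 < \<tau>1 / 2" using \<tau>1 by simp
  then obtain K Y1 where K: "0 < K" and Y1: "Y1 \<in> sets circle_measure" "measure circle_measure Y1 \<le> \<tau>1 / 2"
    and KY: "\<And>x n. x \<in> {0..<1} - Y1 \<Longrightarrow> n \<ge> 1 \<Longrightarrow> birk (int n) x \<le> K * real n \<and> - birk (- int n) x \<le> K * real (n + 1)"
    using birk_linear_bound by metis
  define \<theta> where "\<theta> = min 1 (c0 / (14 * K))"
  have \<theta>: "0 < \<theta>" "\<theta> \<le> 1" "\<theta> \<le> c0 / (14 * K)" using c0 K by (auto simp: \<theta>_def)
  \<comment> \<open>The last term makes \<open>\<tau> * \<kappa>\<close> at most half of the margin \<open>\<eta>\<close> below, for whatever \<open>\<kappa>\<close> belongs to \<open>\<tau>\<close>.\<close>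
  define \<tau> where "\<tau> = min (\<epsilon> / 2) (min (\<tau>1 / 2) (\<epsilon>\<^sup>2 * \<theta> * mass / 192))"
  have \<tau>: "0 < \<tau>" "\<tau> \<le> \<epsilon> / 2" "\<tau> \<le> \<tau>1 / 2" "\<tau> \<le> \<epsilon>\<^sup>2 * \<theta> * mass / 192"
    using \<epsilon> \<theta> \<tau>1 mass_pos by (auto simp: \<tau>_def)
  obtain \<kappa> X0 where \<kappa>: "0 < \<kappa>" "\<kappa> \<le> 1" and X0: "X0 \<in> sets circle_measure" "1 - \<tau> < measure circle_measure X0"
    and dr: "\<And>N::nat. \<exists>\<delta>>0. \<forall>x\<in>X0. \<forall>y\<in>X0. x \<noteq> y \<longrightarrow> circle_dist x y < \<delta> \<longrightarrow>
        drifts c1 c2 \<kappa> (\<tau> * \<kappa>) N (\<lambda>n. birk n x - birk n y)"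
    using drift \<tau>(1) unfolding birkhoff_drift_def by metis
  define \<kappa>' where "\<kappa>' = \<theta> * \<kappa>"
  have \<kappa>': "0 < \<kappa>'" "\<kappa>' \<le> 1" using \<theta> \<kappa> by (auto simp: \<kappa>'_def mult_le_one)
  \<comment> \<open>The density of visits that is harmless in windows of relative length \<open>\<kappa>'\<close>, and a margin that achieves it
    outside a set of measure \<open>\<epsilon> / 8\<close>.\<close>
  define r where "r = \<epsilon> * \<kappa>' / 6"
  define \<eta> where "\<eta> = \<epsilon> * r * mass / 16"
  have r: "0 < r" and \<eta>: "0 < \<eta>" using \<epsilon> \<kappa>' mass_pos by (auto simp: r_def \<eta>_def)
  have \<tau>\<eta>: "\<tau> * \<kappa> \<le> \<eta> / 2"
  proof -
    have "\<tau> * \<kappa> \<le> \<epsilon>\<^sup>2 * \<theta> * mass / 192 * \<kappa>" using \<tau> \<kappa> by (intro mult_right_mono) auto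
    also have "\<dots> = \<eta> / 2" by (simp add: \<eta>_def r_def \<kappa>'_def power2_eq_square)
    finally show ?thesis .
  qed
  have \<tau>\<kappa>: "\<tau> * \<kappa> \<le> \<epsilon> / 2" using mult_mono[of \<tau> "\<epsilon> / 2" \<kappa> 1] \<tau> \<kappa> \<epsilon> by simp
  have density: "2 * \<eta> / mass / r \<le> \<epsilon> / 8" using r mass_pos by (simp add: \<eta>_def)
  obtain Y2 where Y2: "Y2 \<in> sets flow_measure" "measure flow_measure Y2 \<le> \<epsilon> / 8"
    "\<forall>z\<in>flow_space - Y2. \<forall>n\<ge>1. real (card {j \<in> {..<n}. flow (real j * t0) z \<in> margin \<eta>}) \<le> r * real n"
    using margin_orbit_density[OF r \<eta> density, of t0] by (elim bexE conjE) (rule that)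
  obtain Y3 where Y3: "Y3 \<in> sets flow_measure" "measure flow_measure Y3 \<le> \<epsilon> / 8"
    "\<forall>z\<in>flow_space - Y3. \<forall>n\<ge>1. real (card {j \<in> {..<n}. flow (real j * (- t0)) z \<in> margin \<eta>}) \<le> r * real n"
    using margin_orbit_density[OF r \<eta> density, of "- t0"] by (elim bexE conjE) (rule that)
  define A where "A = ({0..<1} - X0) \<union> Y1"
  have X0c: "{0..<1} - X0 \<in> sets circle_measure" using sets.compl_sets[OF X0(1)] by simp
  have A: "A \<in> sets circle_measure" using X0c Y1 by (auto simp: A_def)
  have "measure circle_measure ({0..<1} - X0) = 1 - measure circle_measure X0"
    using C.prob_compl[OF X0(1)] by simp
  then have "measure circle_measure A \<le> \<tau>1"
    using measure_Un_le[OF X0c Y1(1)] Y1(2) X0(2) \<tau>(3) unfolding A_def by linarith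
  then have "(\<integral>x. f x * indicator A x \<partial>circle_measure) / mass \<le> mass * \<epsilon> / 8 / mass"
    using \<tau>1(2)[OF A] mass_pos by (intro divide_right_mono) auto
  then have WA: "measure flow_measure {z \<in> flow_space. fst z \<in> A} \<le> \<epsilon> / 8"
    using measure_over_base(2)[OF A] mass_pos by simp
  let ?W = "{z \<in> flow_space. fst z \<in> A}"
  let ?B = "?W \<union> (Y2 \<union> Y3)"
  define Z where "Z = flow_space - ?B"
  have Bs: "?B \<in> sets flow_measure" using measure_over_base(1)[OF A] Y2(1) Y3(1) by auto
  have "measure flow_measure ?B \<le> measure flow_measure ?W + (measure flow_measure Y2 + measure flow_measure Y3)"
    using measure_Un_le[OF measure_over_base(1)[OF A], of "Y2 \<union> Y3"] measure_Un_le[OF Y2(1) Y3(1)] Y2(1) Y3(1)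
    by (meson add_left_mono order_trans sets.Un)
  then have Bm: "measure flow_measure ?B < \<epsilon>" using WA Y2(2) Y3(2) \<epsilon>(1) by linarith
  have Z: "Z \<in> sets flow_measure" "1 - \<epsilon>' < measure flow_measure Z"
    using sets.compl_sets[OF Bs] P.prob_compl[OF Bs] Bm \<epsilon>(3) by (auto simp: Z_def)
  show "\<exists>\<kappa>>0. \<forall>N::nat. \<exists>\<delta>>0. \<exists>Z\<in>sets flow_measure. measure flow_measure Z > 1 - \<epsilon>' \<and>
       (\<forall>x\<in>Z. \<forall>y\<in>Z. special_flow_dist circle_dist x y < \<delta> \<and> x \<notin> range (\<lambda>t. flow t y) \<longrightarrow>
         (\<exists>m l :: nat. \<exists>p\<in>{- c2..- c1} \<union> {c1..c2}. m > N \<and> l > N \<and> real l / real m \<ge> \<kappa> \<and>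
           (real (card {n \<in> {m..m + l}.
               special_flow_dist circle_dist (flow (real n * t0) x) (flow (real n * t0 + p) y) < \<epsilon>'}) / real l > 1 - \<epsilon>' \<or>
            real (card {n \<in> {m..m + l}.
               special_flow_dist circle_dist (flow (- (real n * t0)) x) (flow (- (real n * t0) + p) y) < \<epsilon>'}) / real l > 1 - \<epsilon>')))"
  proof (rule exI[of _ \<kappa>'], intro conjI \<kappa>'(1) allI)
    fix N :: nat
    define X where "X = (real n0 + 1) / \<kappa> + ((real N + 1) * t0 / c0 + 1) + 6 * t0 / (c0 * \<kappa>) + 2 * (real N + 1) * t0 / (c0 * \<kappa>) + t0 / K"
    obtain N' :: nat where N': "X < real N'" using reals_Archimedean2 by blast
    obtain \<delta>1 where \<delta>1: "0 < \<delta>1" "\<And>x y. x \<in> X0 \<Longrightarrow> y \<in> X0 \<Longrightarrow> x \<noteq> y \<Longrightarrow> circle_dist x y < \<delta>1 \<Longrightarrow>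
        drifts c1 c2 \<kappa> (\<tau> * \<kappa>) N' (\<lambda>n. birk n x - birk n y)"
      using dr[of N'] by metis
    define \<delta> where "\<delta> = min \<delta>1 (min (\<eta> / 2) (\<epsilon> / 2))"
    have \<delta>: "0 < \<delta>" "\<delta> \<le> \<delta>1" "\<delta> \<le> \<eta> / 2" "\<delta> \<le> \<epsilon> / 2" using \<delta>1 \<eta> \<epsilon> by (auto simp: \<delta>_def)
    show "\<exists>\<delta>>0. \<exists>Z\<in>sets flow_measure. measure flow_measure Z > 1 - \<epsilon>' \<and>
       (\<forall>x\<in>Z. \<forall>y\<in>Z. special_flow_dist circle_dist x y < \<delta> \<and> x \<notin> range (\<lambda>t. flow t y) \<longrightarrow>
         (\<exists>m l :: nat. \<exists>p\<in>{- c2..- c1} \<union> {c1..c2}. m > N \<and> l > N \<and> real l / real m \<ge> \<kappa>' \<and>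
           (real (card {n \<in> {m..m + l}.
               special_flow_dist circle_dist (flow (real n * t0) x) (flow (real n * t0 + p) y) < \<epsilon>'}) / real l > 1 - \<epsilon>' \<or>
            real (card {n \<in> {m..m + l}.
               special_flow_dist circle_dist (flow (- (real n * t0)) x) (flow (- (real n * t0) + p) y) < \<epsilon>'}) / real l > 1 - \<epsilon>')))"
    proof (intro exI[of _ \<delta>] conjI \<delta>(1) bexI[of _ Z] Z ballI impI)
      fix z w assume zw: "z \<in> Z" "w \<in> Z" "special_flow_dist circle_dist z w < \<delta> \<and> z \<notin> range (\<lambda>t. flow t w)"
      obtain x u y u' where xy: "z = (x, u)" "w = (y, u')" by (cases z, cases w) blast
      have fs: "(x, u) \<in> flow_space" "(y, u') \<in> flow_space" using zw xy by (auto simp: Z_def)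
      then have x01: "x \<in> {0..<1}" "y \<in> {0..<1}" by (auto simp: special_flow_space_def)
      have xA: "x \<notin> A" "y \<notin> A" using zw fs xy by (auto simp: Z_def)
      have d: "circle_dist x y + \<bar>u - u'\<bar> < \<delta>" using zw xy by (simp add: special_flow_dist_def)
      have ne: "x \<noteq> y"
      proof
        assume "x = y"
        then have "flow (u - u') (y, u') = (x, u)"
          using flow_eq[of y 0 "u - u'" u'] fs birk_Suc[of 0 y] by (simp add: special_flow_space_def frac_eq)
        then show False using zw xy by (metis rangeI)
      qed
      have cd: "circle_dist x y < \<delta>1" using d \<delta> by linarith
      have X0xy: "x \<in> X0" "y \<in> X0" using xA x01 by (auto simp: A_def)
      obtain R L :: nat and b :: int and p where R: "N' < R" "\<kappa> * real R \<le> real L"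
        and p: "c1 \<le> \<bar>p\<bar>" "\<bar>p\<bar> \<le> c2"
        and win: "int R \<le> b \<and> b + int L \<le> 4 * int R \<or> - 4 * int R \<le> b \<and> b + int L \<le> - int R"
        and bp: "\<forall>n\<in>{b..b + int L}. \<bar>birk n x - birk n y - p\<bar> \<le> \<tau> * \<kappa>"
        using \<delta>1(2)[OF X0xy ne cd] unfolding drifts_def by (elim exE conjE) (rule that)
      define \<sigma> :: real where "\<sigma> = (if int R \<le> b \<and> b + int L \<le> 4 * int R then 1 else - 1)"
      have win': "\<sigma> = 1 \<and> int R \<le> b \<and> b + int L \<le> 4 * int R \<or> \<sigma> = - 1 \<and> - 4 * int R \<le> b \<and> b + int L \<le> - int R"
        using win by (auto simp: \<sigma>_def)
      have "X < real R" using N' R(1) by linarith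
      moreover have "0 \<le> (real n0 + 1) / \<kappa>" "0 \<le> (real N + 1) * t0 / c0" "0 \<le> 6 * t0 / (c0 * \<kappa>)"
        "0 \<le> 2 * (real N + 1) * t0 / (c0 * \<kappa>)" "0 \<le> t0 / K"
        using t0 c0 \<kappa> K by auto
      ultimately have "(real n0 + 1) / \<kappa> < real R" "(real N + 1) * t0 / c0 < real R - 1" "6 * t0 / (c0 * \<kappa>) < real R"
        "2 * (real N + 1) * t0 / (c0 * \<kappa>) < real R" "t0 / K < real R"
        unfolding X_def by linarith+
      then have large: "real n0 + 1 \<le> \<kappa> * real R" "(real N + 1) * t0 < c0 * (real R - 1)"
        "6 * t0 \<le> c0 * \<kappa> * real R" "2 * (real N + 1) * t0 < c0 * \<kappa> * real R" "t0 \<le> K * real R"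
        using c0 \<kappa>(1) K by (simp_all add: pos_divide_less_eq mult.commute mult.left_commute)
      have Kx: "\<And>n. n \<ge> 1 \<Longrightarrow> birk (int n) x \<le> K * real n \<and> - birk (- int n) x \<le> K * real (n + 1)"
        using KY[of x] x01 xA by (auto simp: A_def)
      obtain m l :: nat where ml: "N < m" "N < l" "c0 / (14 * K) * \<kappa> * real m \<le> real l"
        and times: "\<And>n. n \<in> {m..m + l} \<Longrightarrow> birk b x \<le> \<sigma> * (real n * t0) + u"
          "\<And>n. n \<in> {m..m + l} \<Longrightarrow> \<sigma> * (real n * t0) + u < birk (b + int L) x"
        using flow_times_in_window[OF fs(1) gr c0 K Kx t0 \<kappa> win' R(2) large] by metis
      define S where "S = {j \<in> {..<m + l + 1}. flow (real j * (\<sigma> * t0)) z \<in> margin \<eta>}"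
      have \<kappa>m: "\<kappa>' * real m \<le> real l"
      proof -
        have "\<theta> * (\<kappa> * real m) \<le> c0 / (14 * K) * (\<kappa> * real m)" using \<theta> \<kappa> by (intro mult_right_mono) auto
        then show ?thesis using ml(3) by (simp add: \<kappa>'_def mult.assoc)
      qed
      have cS: "real (card S) \<le> \<epsilon> * real l / 2"
      proof -
        have "z \<in> flow_space - Y2" "z \<in> flow_space - Y3" using zw by (auto simp: Z_def)
        then have "real (card S) \<le> r * real (m + l + 1)"
          unfolding S_def using Y2(3)[rule_format, of z "m + l + 1"] Y3(3)[rule_format, of z "m + l + 1"] win' by auto
        moreover have "\<kappa>' * real (m + l + 1) \<le> 3 * real l"
        proof -
          have "\<kappa>' * (real l + 1) \<le> 1 * (real l + 1)" using \<kappa>' by (intro mult_right_mono) auto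
          moreover have "1 \<le> real l" using ml by linarith
          ultimately show ?thesis using \<kappa>m by (simp add: algebra_simps)
        qed
        then have "\<epsilon> / 6 * (\<kappa>' * real (m + l + 1)) \<le> \<epsilon> / 6 * (3 * real l)"
          using \<epsilon> by (intro mult_left_mono) auto
        ultimately show ?thesis by (simp add: r_def)
      qed
      have close: "special_flow_dist circle_dist (flow (\<sigma> * (real n * t0)) z) (flow (\<sigma> * (real n * t0) + - p) w) < \<epsilon>'"
        if n: "n \<in> {m..m + l}" "n \<notin> S" for n
        unfolding xy
      proof (rule close_outside_margin[OF fs times[OF n(1)] _ bp[rule_format]])
        show "flow (\<sigma> * (real n * t0)) (x, u) \<notin> margin \<eta>"
          using n by (auto simp: S_def xy mult.left_commute)
        have "0 \<le> circle_dist x y" by (simp add: circle_dist_def)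
        then show "\<tau> * \<kappa> + \<bar>u - u'\<bar> \<le> \<eta>" using \<tau>\<eta> d \<delta> by linarith
        show "circle_dist x y + \<bar>u - u'\<bar> + \<tau> * \<kappa> < \<epsilon>'" using \<tau>\<kappa> d \<delta> \<epsilon> by linarith
      qed
      have "real l + 1 - real (card S) \<le> real (card {n \<in> {m..m + l}.
          special_flow_dist circle_dist (flow (\<sigma> * (real n * t0)) z) (flow (\<sigma> * (real n * t0) + - p) w) < \<epsilon>'})"
        by (rule card_window_ge) (use close in \<open>auto simp: S_def\<close>)
      moreover have "(1 - \<epsilon>') * real l < real l + 1 - real (card S)"
      proof -
        have "\<epsilon> * real l \<le> \<epsilon>' * real l" using \<epsilon> by (intro mult_right_mono) auto
        moreover have "0 \<le> \<epsilon> * real l" using \<epsilon> by simp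
        ultimately show ?thesis using cS by (simp add: algebra_simps)
      qed
      ultimately have count: "1 - \<epsilon>' < real (card {n \<in> {m..m + l}.
          special_flow_dist circle_dist (flow (\<sigma> * (real n * t0)) z) (flow (\<sigma> * (real n * t0) + - p) w) < \<epsilon>'}) / real l"
        using ml by (simp add: pos_less_divide_eq)
      show "\<exists>m l :: nat. \<exists>p\<in>{- c2..- c1} \<union> {c1..c2}. m > N \<and> l > N \<and> real l / real m \<ge> \<kappa>' \<and>
           (real (card {n \<in> {m..m + l}.
               special_flow_dist circle_dist (flow (real n * t0) z) (flow (real n * t0 + p) w) < \<epsilon>'}) / real l > 1 - \<epsilon>' \<or>
            real (card {n \<in> {m..m + l}.
               special_flow_dist circle_dist (flow (- (real n * t0)) z) (flow (- (real n * t0) + p) w) < \<epsilon>'}) / real l > 1 - \<epsilon>')"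
      proof (rule exI[of _ m], rule exI[of _ l], rule bexI[of _ "- p"], intro conjI ml(1,2))
        show "\<kappa>' \<le> real l / real m" using \<kappa>m ml by (simp add: pos_le_divide_eq)
        show "- p \<in> {- c2..- c1} \<union> {c1..c2}" using p by auto
      qed (use count win' in auto)
    qed
  qed
qed

theorem SWR_of_drift:
  assumes "finite F" "continuous_on ({0..<1} - F) f" and c1: "0 < c1"
    and drift: "birkhoff_drift c1 c2"
  shows "SWR_property flow_measure (special_flow_dist circle_dist) flow"
  unfolding SWR_property_def
proof (intro conjI)
  show "prob_space flow_measure" by (rule prob_space_flow_measure)
  show "standard_borel flow_measure" using assms(1,2) by (rule standard_borel_flow_measure)
  show "Metric_space (space flow_measure) (special_flow_dist circle_dist)" using Metric_space_flow by simp
  show "ergodic_flow flow_measure flow" by (rule flow_ergodic)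
  have "{t0. 0 < t0 \<and> switchable_R flow_measure (special_flow_dist circle_dist) flow t0 ({- c2..- c1} \<union> {c1..c2})} = {0<..}"
    using switchable_R_of_drift[OF _ c1 drift] by auto
  moreover have "uncountable {0::real<..}"
  proof
    assume "countable {0::real<..}"
    moreover have "{0<..<1::real} \<subseteq> {0<..}" by auto
    ultimately show False using countable_subset uncountable_open_interval[of 0 "1::real"] by auto
  qed
  ultimately show "\<exists>P. compact P \<and> 0 \<notin> P \<and>
      uncountable {t0. 0 < t0 \<and> switchable_R flow_measure (special_flow_dist circle_dist) flow t0 P}"
    using c1 by (intro exI[of _ "{- c2..- c1} \<union> {c1..c2}"]) (auto intro!: compact_Un)
qed

end

section \<open>Orbits of rotations of bounded type\<close>

locale bounded_type_rotation =
  fixes \<alpha> :: real and q :: "nat \<Rightarrow> nat" and r :: real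
  assumes irrational: "\<alpha> \<notin> \<rat>"
    and denominators: "denominators \<alpha> q"
    and bounded_type: "\<And>n. real (q (Suc n)) < r * real (q n)"
begin

definition err :: "nat \<Rightarrow> real" where
  "err s = circle_norm (real (q s) * \<alpha>)"

lemma strict_mono_q: "strict_mono q" and q_0 [simp]: "q 0 = 1"
  and err_less: "1 \<le> k \<Longrightarrow> k < q (Suc s) \<Longrightarrow> k \<noteq> q s \<Longrightarrow> err s < circle_norm (real k * \<alpha>)"
  using denominators by (auto simp: denominators_def err_def)

lemma q_less_Suc: "q s < q (Suc s)"
  using strict_mono_q by (simp add: strict_mono_Suc_iff)

lemma q_mono: "s \<le> t \<Longrightarrow> q s \<le> q t"
  using strict_mono_q by (simp add: strict_mono_less_eq)

lemma q_pos [simp]: "0 < q s"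
  using q_mono[of 0 s] by simp

lemma q_ge_index: "s \<le> q s"
  using strict_mono_q by (rule strict_mono_imp_increasing)

lemma r_gt_1: "1 < r"
  using bounded_type[of 0] q_less_Suc[of 0] by simp

lemma q_le_power: "real (q (s + j)) \<le> r ^ j * real (q s)"
proof (induction j)
  case (Suc j)
  have "real (q (s + Suc j)) \<le> r * real (q (s + j))" using bounded_type[of "s + j"] by simp
  also have "\<dots> \<le> r * (r ^ j * real (q s))" using Suc r_gt_1 by (intro mult_left_mono) auto
  finally show ?case by simp
qed simp

definition num :: "nat \<Rightarrow> int" where
  "num s = round (real (q s) * \<alpha>)"

definition serr :: "nat \<Rightarrow> real" where
  "serr s = real (q s) * \<alpha> - of_int (num s)"

lemma abs_serr: "\<bar>serr s\<bar> = err s"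
  by (simp add: serr_def err_def num_def circle_norm_def)

lemma err_pos: "0 < err s"
proof -
  have "real (q s) * \<alpha> \<notin> \<int>"
  proof
    assume "real (q s) * \<alpha> \<in> \<int>"
    then have "real (q s) * \<alpha> / real (q s) \<in> \<rat>" by (intro Rats_divide) (auto simp: Ints_subset_Rats[THEN subsetD])
    then show False using irrational by simp
  qed
  then have "err s \<noteq> 0" by (simp add: err_def circle_norm_eq_0_iff)
  then show ?thesis unfolding err_def using circle_norm_nonneg[of "real (q s) * \<alpha>"] by linarith
qed

lemma err_Suc_less: "err (Suc s) < err s"
  using err_less[of "q s" "Suc s"] q_less_Suc[of s] q_less_Suc[of "Suc s"] by (simp add: err_def Suc_leI)

lemma err_le: "1 \<le> k \<Longrightarrow> k < q (Suc s) \<Longrightarrow> err s \<le> circle_norm (real k * \<alpha>)"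
  using err_less[of k s] by (cases "k = q s") (auto simp: err_def)

lemma err_upper: "err s < 2 / real (q (Suc s))"
proof -
  define N where "N = q (Suc s) - 1"
  have N: "0 < N" "q (Suc s) = N + 1" using q_less_Suc[of s] q_pos[of s] unfolding N_def by linarith+
  obtain h k where k: "0 < k" "k \<le> int N" "\<bar>of_int k * \<alpha> - of_int h\<bar> < 1 / real N"
    using Dirichlet_approx[OF N(1)] by metis
  have "err s \<le> circle_norm (real (nat k) * \<alpha>)" using k N by (intro err_le) auto
  also have "\<dots> < 1 / real N" using circle_norm_le[of "real (nat k) * \<alpha>" h] k by simp
  also have "\<dots> \<le> 2 / real (q (Suc s))" using N by (simp add: field_simps)
  finally show ?thesis .
qed

text \<open>
  A common divisor \<open>d\<close> could be cancelled, giving a smaller denominator whose error is smaller by the factor \<open>d\<close>.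
\<close>

lemma coprime_num: "coprime (num s) (int (q s))"
proof (rule ccontr)
  assume "\<not> coprime (num s) (int (q s))"
  then have g: "gcd (num s) (int (q s)) \<noteq> 1" by (simp add: coprime_iff_gcd_eq_1)
  define d where "d = nat (gcd (num s) (int (q s)))"
  have gp: "0 < gcd (num s) (int (q s))" by simp
  then have d: "2 \<le> d" using g unfolding d_def by linarith
  have id: "int d = gcd (num s) (int (q s))" using gp unfolding d_def by simp
  then obtain a b where ab: "num s = int d * a" "int (q s) = int d * b" by (metis dvd_def gcd_dvd1 gcd_dvd2)
  have "0 < int d * b" using ab(2) q_pos[of s] by linarith
  then have b: "0 < b" using d by (simp add: zero_less_mult_iff)
  define k where "k = nat b"
  have k': "int k = b" "0 < k" using b unfolding k_def by simp_all
  have "int (q s) = int (d * k)" using ab(2) k'(1) by simp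
  then have k: "0 < k" "q s = d * k" using k'(2) by (simp_all only: of_nat_eq_iff)
  have "k < q s" using k d by simp
  then have "err s < circle_norm (real k * \<alpha>)" using k(1) q_less_Suc[of s] by (intro err_less) linarith+
  also have "\<dots> \<le> \<bar>real k * \<alpha> - of_int a\<bar>" by (rule circle_norm_le)
  also have "\<dots> \<le> real d * \<bar>real k * \<alpha> - of_int a\<bar>" using d by (simp add: mult_le_cancel_right1)
  also have "\<dots> = \<bar>real d * (real k * \<alpha> - of_int a)\<bar>" by (simp add: abs_mult)
  also have "real d * (real k * \<alpha> - of_int a) = serr s"
    by (simp add: serr_def ab(1) k(2) algebra_simps)
  finally show False by (simp add: abs_serr)
qed

text \<open>
  The determinant of two consecutive convergents is a nonzero integer, since they are in lowest terms and have different
  denominators.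
\<close>

lemma err_lower: "1 / (2 * real (q (Suc s))) \<le> err s"
proof -
  have "num (Suc s) * int (q s) \<noteq> num s * int (q (Suc s))"
  proof
    assume "num (Suc s) * int (q s) = num s * int (q (Suc s))"
    then have "int (q (Suc s)) dvd num (Suc s) * int (q s)" by simp
    then have "int (q (Suc s)) dvd int (q s)"
      using coprime_num[of "Suc s"] by (simp add: coprime_commute coprime_dvd_mult_right_iff)
    then show False using q_less_Suc[of s] q_pos[of s] by (auto dest!: dvd_imp_le)
  qed
  then have "1 \<le> \<bar>num (Suc s) * int (q s) - num s * int (q (Suc s))\<bar>" by linarith
  then have "1 \<le> \<bar>of_int (num (Suc s) * int (q s) - num s * int (q (Suc s))) :: real\<bar>" by linarith
  also have "of_int (num (Suc s) * int (q s) - num s * int (q (Suc s)))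
      = real (q (Suc s)) * serr s - real (q s) * serr (Suc s)"
    by (simp add: serr_def algebra_simps)
  also have "\<bar>\<dots>\<bar> \<le> real (q (Suc s)) * err s + real (q s) * err (Suc s)"
    using abs_triangle_ineq4[of "real (q (Suc s)) * serr s" "real (q s) * serr (Suc s)"]
    by (simp add: abs_mult abs_serr)
  also have "\<dots> \<le> real (q (Suc s)) * err s + real (q (Suc s)) * err s"
    using q_less_Suc[of s] err_Suc_less[of s] err_pos[of "Suc s"]
    by (intro add_left_mono mult_mono) auto
  finally show ?thesis by (simp add: field_simps)
qed

lemma orbit_separated:
  assumes "m \<noteq> n" "\<bar>m - n\<bar> < int (q s)"
  shows "1 / (2 * real (q s)) \<le> circle_norm (of_int m * \<alpha> - of_int n * \<alpha>)"
proof -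
  define k where "k = nat \<bar>m - n\<bar>"
  have k: "1 \<le> k" "k < q s" using assms unfolding k_def by linarith+
  then obtain s' where s': "s = Suc s'" by (cases s) auto
  have "1 / (2 * real (q s)) \<le> circle_norm (real k * \<alpha>)"
    using err_lower[of s'] err_le[of k s'] k s' by simp
  also have "real k * \<alpha> = (if n \<le> m then of_int m * \<alpha> - of_int n * \<alpha> else - (of_int m * \<alpha> - of_int n * \<alpha>))"
    by (simp add: k_def algebra_simps)
  finally show ?thesis
    using circle_norm_commute[of "of_int m * \<alpha>" "of_int n * \<alpha>"] by (simp split: if_splits)
qed

text \<open>
  The signed errors of consecutive denominators alternate, since two errors of equal sign could
  be subtracted to beat the record of the smaller denominator. Hence those two steps apart have equal sign,
  and their difference beats the record unless it is at least the denominator in between.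
\<close>

lemma serr_alternate: "serr s * serr (Suc s) < 0"
proof (rule ccontr)
  assume same: "\<not> serr s * serr (Suc s) < 0"
  define k where "k = q (Suc s) - q s"
  have k: "1 \<le> k" "k < q (Suc s)" using q_less_Suc[of s] q_pos[of s] unfolding k_def by linarith+
  have "err s \<le> circle_norm (real k * \<alpha>)" using k by (rule err_le)
  also have "\<dots> \<le> \<bar>real k * \<alpha> - of_int (num (Suc s) - num s)\<bar>" by (rule circle_norm_le)
  also have "real k * \<alpha> - of_int (num (Suc s) - num s) = serr (Suc s) - serr s"
    using q_less_Suc[of s] by (simp add: k_def serr_def of_nat_diff algebra_simps)
  finally have "err s \<le> \<bar>serr (Suc s) - serr s\<bar>" .
  moreover have "\<bar>serr (Suc s)\<bar> < \<bar>serr s\<bar>" "0 < \<bar>serr (Suc s)\<bar>"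
    using err_Suc_less[of s] err_pos[of "Suc s"] by (simp_all only: abs_serr)
  ultimately show False using same abs_serr[of s]
    by (auto simp: not_less zero_le_mult_iff abs_if split: if_splits)
qed

lemma q_double: "2 * q s \<le> q (s + 2)"
proof -
  define k where "k = q (s + 2) - q s"
  have qs: "q s < q (Suc s)" "q (Suc s) < q (s + 2)" using q_less_Suc[of s] q_less_Suc[of "Suc s"] by simp_all
  have "q (Suc s) \<le> k"
  proof (rule ccontr)
    assume "\<not> q (Suc s) \<le> k"
    then have "1 \<le> k" "k < q (Suc s)" using qs unfolding k_def by linarith+
    then have "err s \<le> circle_norm (real k * \<alpha>)" by (rule err_le)
    also have "\<dots> \<le> \<bar>real k * \<alpha> - of_int (num (s + 2) - num s)\<bar>" by (rule circle_norm_le)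
    also have "real k * \<alpha> - of_int (num (s + 2) - num s) = serr (s + 2) - serr s"
      using qs by (simp add: k_def serr_def of_nat_diff algebra_simps)
    finally have 1: "err s \<le> \<bar>serr (s + 2) - serr s\<bar>" .
    have 2: "\<bar>serr (s + 2)\<bar> < \<bar>serr s\<bar>" "0 < \<bar>serr (s + 2)\<bar>"
      using err_Suc_less[of s] err_Suc_less[of "Suc s"] err_pos[of "s + 2"] by (simp_all add: abs_serr del: zero_less_abs_iff)
    have "serr s * serr (Suc s) < 0" "serr (Suc s) * serr (s + 2) < 0"
      using serr_alternate[of s] serr_alternate[of "Suc s"] by simp_all
    then have "0 < serr s \<and> 0 < serr (s + 2) \<or> serr s < 0 \<and> serr (s + 2) < 0"
      by (auto simp: mult_less_0_iff)
    then show False using 1 2 abs_serr[of s] by linarith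
  qed
  then show ?thesis using qs unfolding k_def by linarith
qed

lemma q_power: "2 ^ j * q s \<le> q (s + 2 * j)"
proof (induction j)
  case (Suc j)
  then show ?case using q_double[of "s + 2 * j"] by (simp add: algebra_simps)
qed simp

text \<open>
  Modulo 1, the first \<open>q s\<close> multiples of \<open>num s / q s\<close> run through all multiples of \<open>1 / q s\<close>, and those of \<open>\<alpha>\<close> stay
  within \<open>2 / q s\<close> of them.
\<close>

lemma orbit_visits:
  fixes x c :: real and b :: int
  shows "\<exists>n\<in>{b..<b + int (q s)}. \<exists>z::int.
    c < x + of_int n * \<alpha> - of_int z \<and> x + of_int n * \<alpha> - of_int z < c + 6 / real (q s)"
proof -
  let ?Q = "real (q s)"
  have Q: "0 < ?Q" by simp
  define y where "y = x + of_int b * \<alpha>"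
  \<comment> \<open>Aim at the middle of the interval: this leaves room for the rounding and for the error below \<open>2 / q s\<close>.\<close>
  define j where "j = \<lceil>(c - y) * ?Q + 5 / 2\<rceil>"
  have j: "(c - y) * ?Q + 5 / 2 \<le> of_int j" "of_int j < (c - y) * ?Q + 7 / 2"
    unfolding j_def by linarith+
  obtain u v where uv: "u * num s + v * int (q s) = 1"
    using bezout_int[of "num s" "int (q s)"] coprime_num[of s] by (auto simp: coprime_iff_gcd_eq_1)
  define n where "n = (j * u) mod int (q s)"
  have n: "0 \<le> n" "n < int (q s)" by (simp_all add: n_def)
  obtain w where w: "n * num s = j + w * int (q s)"
  proof -
    have n_eq: "n = j * u - int (q s) * ((j * u) div int (q s))"
      unfolding n_def by (simp add: minus_mult_div_eq_mod)
    have "n * num s = (j * u - int (q s) * ((j * u) div int (q s))) * num s"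
      by (subst n_eq) (rule refl)
    also have "\<dots> = j * (u * num s) - int (q s) * ((j * u) div int (q s)) * num s"
      by (simp add: algebra_simps)
    also have "u * num s = 1 - v * int (q s)" using uv by simp
    finally have "n * num s = j + (- j * v - (j * u) div int (q s) * num s) * int (q s)"
      by (simp add: algebra_simps)
    then show ?thesis by (rule that)
  qed
  have a: "\<alpha> = (of_int (num s) + serr s) / ?Q" by (simp add: serr_def)
  have "?Q * (y + of_int n * \<alpha> - of_int w) = ?Q * y + of_int (n * num s) + of_int n * serr s - ?Q * of_int w"
    by (subst a) (simp add: field_simps)
  also have "\<dots> = ?Q * y + of_int j + of_int n * serr s" by (simp add: w algebra_simps)
  finally have eq: "?Q * (y + of_int n * \<alpha> - of_int w) = ?Q * y + of_int j + of_int n * serr s" .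
  have "\<bar>of_int n * serr s\<bar> \<le> ?Q * err s"
    using n by (simp add: abs_mult abs_serr) (intro mult_right_mono, auto simp: err_def)
  also have "\<dots> < ?Q * (2 / real (q (Suc s)))" using err_upper[of s] Q by (intro mult_strict_left_mono)
  also have "\<dots> \<le> 2" using q_less_Suc[of s] by (simp add: field_simps)
  finally have small: "\<bar>of_int n * serr s\<bar> < 2" .
  have "?Q * c < ?Q * (y + of_int n * \<alpha> - of_int w)" "?Q * (y + of_int n * \<alpha> - of_int w) < ?Q * c + 6"
    unfolding eq using j small by (auto simp: algebra_simps abs_less_iff)
  moreover have "?Q * c + 6 = ?Q * (c + 6 / ?Q)" by (simp add: distrib_left)
  ultimately have "c < y + of_int n * \<alpha> - of_int w" "y + of_int n * \<alpha> - of_int w < c + 6 / ?Q"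
    using Q by (simp_all only: mult_less_cancel_left_pos)
  moreover have "y + of_int n * \<alpha> = x + of_int (b + n) * \<alpha>" by (simp add: y_def algebra_simps)
  ultimately show ?thesis using n by (intro bexI[of _ "b + n"] exI[of _ w]) auto
qed

end

section \<open>Sums of derivatives along separated points\<close>

lemma singular_profileD:
  assumes "singular_profile g" "0 < x" "x < 1"
  shows "0 < g x" and "(g has_real_derivative deriv g x) (at x)" and "deriv g x \<le> 0"
proof -
  show "0 < g x" using assms by (simp add: singular_profile_def)
  have "g differentiable_on {0<..<1}" using assms by (simp add: singular_profile_def C2_on_def)
  then show D: "(g has_real_derivative deriv g x) (at x)"
    using assms by (simp add: differentiable_on_eq_differentiable_at DERIV_deriv_iff_real_differentiable)
  have am: "antimono_on {0<..<1} g" using assms by (simp add: singular_profile_def)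
  show "deriv g x \<le> 0"
  proof (rule ccontr)
    assume "\<not> deriv g x \<le> 0"
    then obtain d where d: "0 < d" "\<And>h. 0 < h \<Longrightarrow> h < d \<Longrightarrow> g x < g (x + h)"
      using DERIV_pos_inc_right[OF D] by auto
    define h where "h = min (d / 2) ((1 - x) / 2)"
    have h: "0 < h" "h < d" "x + h < 1" using d assms by (auto simp: h_def min_def field_simps)
    have "g (x + h) \<le> g x" using am h assms by (intro monotone_onD[OF am]) auto
    then show False using d(2)[of h] h by simp
  qed
qed

lemma singular_profile_antimono:
  "singular_profile g \<Longrightarrow> 0 < x \<Longrightarrow> x \<le> y \<Longrightarrow> y < 1 \<Longrightarrow> g y \<le> g x"
  unfolding singular_profile_def by (auto dest!: monotone_onD[of _ _ _ g x y])

lemma singular_profile_deriv_mono: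
  "singular_profile g \<Longrightarrow> 0 < x \<Longrightarrow> x \<le> y \<Longrightarrow> y < 1 \<Longrightarrow> deriv g x \<le> deriv g y"
  unfolding singular_profile_def by (auto dest!: monotone_onD[of _ _ _ "deriv g" x y])

lemma singular_profile_decrease:
  assumes "singular_profile g" "0 < x" "x \<le> y" "y < 1"
  shows "- deriv g y * (y - x) \<le> g x - g y"
proof (cases "x = y")
  case False
  then have "x < y" using assms by simp
  then obtain z where z: "x < z" "z < y" "g y - g x = (y - x) * deriv g z"
    using MVT2[of x y g "deriv g"] singular_profileD(2)[OF assms(1)] assms by auto
  have "deriv g z \<le> deriv g y" using z assms by (intro singular_profile_deriv_mono) auto
  then have "(y - x) * deriv g z \<le> (y - x) * deriv g y" using assms by (intro mult_left_mono) auto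
  then show ?thesis using z(3) by (simp add: algebra_simps)
qed simp

lemma sum_deriv_separated_reals:
  assumes g: "singular_profile g" and D: "finite D" "\<And>d. d \<in> D \<Longrightarrow> w \<le> d \<and> d < 1"
    and sep: "\<And>d e. d \<in> D \<Longrightarrow> e \<in> D \<Longrightarrow> d < e \<Longrightarrow> \<rho> \<le> e - d"
    and \<rho>: "0 < \<rho>" and w: "0 < w" "w < 1"
  shows "(\<Sum>d\<in>D. - deriv g d) \<le> - deriv g w + g w / \<rho>"
proof -
  have "(\<Sum>d\<in>D. - deriv g d) \<le> - deriv g w + (g w - g v) / \<rho>" if "\<And>d. d \<in> D \<Longrightarrow> d \<le> v" "w \<le> v" "v < 1" for v
    using D sep that
  proof (induction D arbitrary: v rule: finite_linorder_max_induct)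
    case empty
    have "0 \<le> (g w - g v) / \<rho>" using singular_profile_antimono[OF g w(1)] empty \<rho> by simp
    then show ?case using singular_profileD(3)[OF g w] by simp
  next
    case (insert b A)
    have b: "w \<le> b" "b < 1" "b \<le> v" using insert by auto
    have gb: "g v \<le> g b" using singular_profile_antimono[OF g, of b v] b insert w by auto
    have "b \<notin> A" using insert by auto
    then have eq: "(\<Sum>d\<in>insert b A. - deriv g d) = - deriv g b + (\<Sum>d\<in>A. - deriv g d)"
      using insert by simp
    show ?case
    proof (cases "A = {}")
      case True
      have "- deriv g b \<le> - deriv g w" using singular_profile_deriv_mono[OF g w(1) b(1,2)] by simp
      moreover have "0 \<le> (g w - g v) / \<rho>"
        using singular_profile_antimono[OF g w(1), of v] insert \<rho> by simp
      ultimately show ?thesis using eq True by simp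
    next
      case False
      define M where "M = Max A"
      have M: "M \<in> A" "\<And>d. d \<in> A \<Longrightarrow> d \<le> M" using False insert.hyps by (auto simp: M_def)
      have Mb: "\<rho> \<le> b - M" using insert.hyps insert.prems M by auto
      have "(\<Sum>d\<in>A. - deriv g d) \<le> - deriv g w + (g w - g M) / \<rho>"
        using insert.prems M by (intro insert.IH) auto
      moreover have "- deriv g b \<le> (g M - g b) / \<rho>"
      proof -
        have "- deriv g b * \<rho> \<le> - deriv g b * (b - M)"
          using Mb singular_profileD(3)[OF g, of b] b w by (intro mult_left_mono) auto
        also have "\<dots> \<le> g M - g b"
          using insert.prems(1)[of M] M Mb b \<rho> w by (intro singular_profile_decrease[OF g]) auto
        finally show ?thesis using \<rho> by (simp add: pos_le_divide_eq)
      qed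
      moreover have "(g w - g M) / \<rho> + (g M - g b) / \<rho> \<le> (g w - g v) / \<rho>"
        using gb \<rho> by (simp add: add_divide_distrib[symmetric] divide_right_mono)
      ultimately show ?thesis using eq by linarith
    qed
  qed
  moreover obtain v where "\<And>d. d \<in> D \<Longrightarrow> d \<le> v" "w \<le> v" "v < 1"
  proof (cases "D = {}")
    case True
    then show ?thesis using that[of w] w by simp
  next
    case False
    then show ?thesis using that[of "Max D"] D by (auto simp: Max_ge_iff)
  qed
  ultimately have "(\<Sum>d\<in>D. - deriv g d) \<le> - deriv g w + (g w - g v) / \<rho>" by blast
  moreover have "(g w - g v) / \<rho> \<le> g w / \<rho>"
    using singular_profileD(1)[OF g, of v] \<open>w \<le> v\<close> \<open>v < 1\<close> w \<rho> by (intro divide_right_mono) auto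
  ultimately show ?thesis by linarith
qed

lemma sum_deriv_one_side:
  assumes g: "singular_profile g" and D: "finite D" "\<And>d. d \<in> D \<Longrightarrow> u \<le> d \<and> d \<le> 1 / 2"
    and sep: "\<And>d e. d \<in> D \<Longrightarrow> e \<in> D \<Longrightarrow> d < e \<Longrightarrow> \<rho> \<le> e - d"
    and \<rho>: "0 < \<rho>" "\<rho> \<le> 1 / 4" and u: "0 < u" "u \<le> 1 / 2"
  shows "(\<Sum>d\<in>D. - deriv g d) \<le> 2 * (- deriv g u) + g \<rho> / \<rho>"
proof -
  define D1 D2 where "D1 = {d \<in> D. d < u + \<rho>}" and "D2 = {d \<in> D. u + \<rho> \<le> d}"
  have fin: "finite D1" "finite D2" using D by (auto simp: D1_def D2_def)
  have "D = D1 \<union> D2" "D1 \<inter> D2 = {}" by (auto simp: D1_def D2_def)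
  then have split: "(\<Sum>d\<in>D. - deriv g d) = (\<Sum>d\<in>D1. - deriv g d) + (\<Sum>d\<in>D2. - deriv g d)"
    using fin by (simp add: sum.union_disjoint)
  have du: "0 \<le> - deriv g u" using singular_profileD(3)[OF g, of u] u by simp
  have "(\<Sum>d\<in>D1. - deriv g d) \<le> - deriv g u"
  proof (cases "D1 = {}")
    case False
    then obtain d where d: "d \<in> D1" by blast
    have "D1 = {d}"
    proof -
      have "e = d" if "e \<in> D1" for e
      proof (rule ccontr)
        assume "e \<noteq> d"
        then have "\<rho> \<le> \<bar>e - d\<bar>" using sep[of e d] sep[of d e] that d unfolding D1_def by (cases "e < d") auto
        moreover have "u \<le> e" "u \<le> d" "e < u + \<rho>" "d < u + \<rho>" using that d D unfolding D1_def by auto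
        ultimately show False by linarith
      qed
      then show ?thesis using d by blast
    qed
    moreover have "deriv g u \<le> deriv g d"
      using d D u unfolding D1_def by (intro singular_profile_deriv_mono[OF g]) force+
    ultimately show ?thesis by simp
  qed (use du in simp)
  moreover have "(\<Sum>d\<in>D2. - deriv g d) \<le> - deriv g u + g \<rho> / \<rho>"
  proof -
    have w: "0 < u + \<rho>" "u + \<rho> < 1" using u \<rho> by auto
    have D2': "u + \<rho> \<le> d \<and> d < 1" if "d \<in> D2" for d using that D(2)[of d] by (auto simp: D2_def)
    have "(\<Sum>d\<in>D2. - deriv g d) \<le> - deriv g (u + \<rho>) + g (u + \<rho>) / \<rho>"
      by (rule sum_deriv_separated_reals[OF g fin(2) D2' _ \<rho>(1) w]) (use sep in \<open>auto simp: D2_def\<close>)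
    also have "- deriv g (u + \<rho>) \<le> - deriv g u"
      using singular_profile_deriv_mono[OF g u(1), of "u + \<rho>"] \<rho> w by simp
    also have "g (u + \<rho>) / \<rho> \<le> g \<rho> / \<rho>"
      using singular_profile_antimono[OF g \<rho>(1), of "u + \<rho>"] u w \<rho> by (intro divide_right_mono) auto
    finally show ?thesis by simp
  qed
  ultimately show ?thesis using split by linarith
qed

text \<open>
  Points of the circle that are \<open>\<rho>\<close>-separated have \<open>\<rho>\<close>-separated distances to \<open>a\<close> on each side of
  \<open>a\<close>. By convexity of \<open>g\<close>, all but the nearest terms are at most the decrease of \<open>g\<close> over the
  preceding gap, divided by \<open>\<rho>\<close>, so these terms telescope.
\<close>

lemma sum_deriv_separated:
  assumes g: "singular_profile g" and I: "finite I"
    and far: "\<And>i. i \<in> I \<Longrightarrow> u \<le> circle_norm (t i - a)"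
    and sep: "\<And>i j. i \<in> I \<Longrightarrow> j \<in> I \<Longrightarrow> i \<noteq> j \<Longrightarrow> \<rho> \<le> circle_norm (t i - t j)"
    and \<rho>: "0 < \<rho>" "\<rho> \<le> 1 / 4" and u: "0 < u" "u \<le> 1 / 2"
  shows "(\<Sum>i\<in>I. - deriv g (circle_norm (t i - a))) \<le> 4 * (- deriv g u) + 2 * (g \<rho> / \<rho>)"
proof -
  define s where "s i = t i - a - of_int (round (t i - a))" for i
  have s: "circle_norm (t i - a) = \<bar>s i\<bar>" for i by (simp add: s_def circle_norm_def)
  have dist: "circle_norm (t i - t j) \<le> \<bar>s i - s j\<bar>" for i j
  proof -
    have "t i - t j - of_int (round (t i - a) - round (t j - a)) = s i - s j" by (simp add: s_def)
    then show ?thesis by (metis circle_norm_le)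
  qed
  have side: "(\<Sum>i\<in>J. - deriv g (circle_norm (t i - a))) \<le> 2 * (- deriv g u) + g \<rho> / \<rho>"
    if J: "J \<subseteq> I" and one: "\<And>i j. i \<in> J \<Longrightarrow> j \<in> J \<Longrightarrow> \<bar>s i - s j\<bar> = \<bar>\<bar>s i\<bar> - \<bar>s j\<bar>\<bar>" for J
  proof -
    have sepJ: "\<rho> \<le> \<bar>\<bar>s i\<bar> - \<bar>s j\<bar>\<bar>" if "i \<in> J" "j \<in> J" "i \<noteq> j" for i j
    proof -
      have "i \<in> I" "j \<in> I" using that J by auto
      then show ?thesis using sep[OF _ _ that(3)] dist[of i j] one[OF that(1,2)] by fastforce
    qed
    have inj: "inj_on (\<lambda>i. \<bar>s i\<bar>) J" using sepJ \<rho>(1) by (force simp: inj_on_def)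
    have "(\<Sum>i\<in>J. - deriv g (circle_norm (t i - a))) = (\<Sum>d\<in>(\<lambda>i. \<bar>s i\<bar>) ` J. - deriv g d)"
      using inj by (simp add: sum.reindex s)
    also have "\<dots> \<le> 2 * (- deriv g u) + g \<rho> / \<rho>"
    proof (rule sum_deriv_one_side[OF g _ _ _ \<rho> u])
      show "finite ((\<lambda>i. \<bar>s i\<bar>) ` J)" using J I finite_subset by blast
      show "u \<le> d \<and> d \<le> 1 / 2" if "d \<in> (\<lambda>i. \<bar>s i\<bar>) ` J" for d
        using that far J circle_norm_le_half by (auto simp: s[symmetric])
      show "\<rho> \<le> e - d" if "d \<in> (\<lambda>i. \<bar>s i\<bar>) ` J" "e \<in> (\<lambda>i. \<bar>s i\<bar>) ` J" "d < e" for d e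
        using that sepJ by fastforce
    qed
    finally show ?thesis .
  qed
  have "I = {i \<in> I. 0 \<le> s i} \<union> {i \<in> I. s i < 0}" by auto
  then have "(\<Sum>i\<in>I. - deriv g (circle_norm (t i - a)))
      = (\<Sum>i\<in>{i \<in> I. 0 \<le> s i} \<union> {i \<in> I. s i < 0}. - deriv g (circle_norm (t i - a)))" by simp
  also have "\<dots> = (\<Sum>i\<in>{i \<in> I. 0 \<le> s i}. - deriv g (circle_norm (t i - a)))
      + (\<Sum>i\<in>{i \<in> I. s i < 0}. - deriv g (circle_norm (t i - a)))"
    using I by (intro sum.union_disjoint) auto
  also have "\<dots> \<le> (2 * (- deriv g u) + g \<rho> / \<rho>) + (2 * (- deriv g u) + g \<rho> / \<rho>)"
    by (intro add_mono side) auto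
  finally show ?thesis by simp
qed

section \<open>Profiles at the scale of the denominators\<close>

locale scaled_profile = bounded_type_rotation +
  fixes h :: "real \<Rightarrow> real" and C D1 D2 :: real
  assumes h_profile: "singular_profile h"
    and h_limit: "filterlim h at_top (at_right 0)"
    and C_gt: "C > 1"
    and D_pos: "D1 > 0" "D2 > 0"
    and D_upper: "\<And>s. D2 > - deriv h (1 / (C ^ 4 * real (q s))) / (real (q s) * h (1 / (2 * real (q s))))"
    and D_lower: "\<And>s. - deriv h (1 / (C ^ 4 * real (q s))) / (real (q s) * h (1 / (2 * real (q s)))) > D1"
    and h_ratio: "\<And>s. h (1 / (2 * real (q s))) / h (1 / (2 * real (q (Suc s)))) > D1"
begin

abbreviation "hq s \<equiv> h (1 / (2 * real (q s)))"

text \<open>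
  The derivative of a Birkhoff sum of length \<open>q s\<close> is at most of this order, if the orbit keeps a distance of
  order \<open>1 / q s\<close> from the singularities.
\<close>

definition H :: "nat \<Rightarrow> real" where
  "H s = real (q s) * hq s"

lemma q_neq_0 [simp]: "q s \<noteq> 0"
  using q_pos[of s] by linarith

lemma q_ge_1: "1 \<le> real (q s)"
  using q_pos[of s] by linarith

lemma half_q: "0 < 1 / (2 * real (q s))" "1 / (2 * real (q s)) < 1"
  using q_ge_1[of s] by (simp_all add: field_simps)

lemma hq_pos: "0 < hq s"
  using singular_profileD(1)[OF h_profile half_q] .

lemma H_pos: "0 < H s"
  using hq_pos[of s] by (simp add: H_def)

lemma hq_mono: "s \<le> t \<Longrightarrow> hq s \<le> hq t"
  using q_mono[of s t] q_ge_1[of s] q_ge_1[of t] half_q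
  by (intro singular_profile_antimono[OF h_profile]) (auto simp: frac_le)

lemma hq_power: "hq (s + j) \<le> (1 / D1) ^ j * hq s"
proof (induction j)
  case (Suc j)
  have "hq (s + Suc j) \<le> 1 / D1 * hq (s + j)"
    using h_ratio[of "s + j"] hq_pos[of "Suc (s + j)"] D_pos by (simp add: field_simps)
  also have "\<dots> \<le> 1 / D1 * ((1 / D1) ^ j * hq s)"
    using Suc D_pos by (intro mult_left_mono) auto
  finally show ?case by simp
qed simp

lemma H_power: "H (s + j) \<le> (r / D1) ^ j * H s"
proof -
  have "H (s + j) \<le> (r ^ j * real (q s)) * ((1 / D1) ^ j * hq s)"
    unfolding H_def using q_le_power[of s j] hq_power[of s j] hq_pos[of "s + j"] r_gt_1
    by (intro mult_mono) auto
  then show ?thesis by (simp add: H_def power_divide field_simps)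
qed

lemma hq_at_top: "filterlim hq at_top sequentially"
proof (rule filterlim_compose[OF h_limit])
  have "filterlim (\<lambda>s. real (q s)) at_top sequentially"
    by (rule filterlim_at_top_mono[OF filterlim_real_sequentially]) (simp add: q_ge_index)
  then have "filterlim (\<lambda>s. 2 * real (q s)) at_top sequentially"
    by (rule filterlim_tendsto_pos_mult_at_top[OF tendsto_const, rotated]) simp
  then have "((\<lambda>s. inverse (2 * real (q s))) \<longlongrightarrow> 0) sequentially"
    by (rule tendsto_inverse_0_at_top)
  then show "filterlim (\<lambda>s. 1 / (2 * real (q s))) (at_right 0) sequentially"
    using half_q(1) by (intro tendsto_imp_filterlim_at_right) (simp_all add: inverse_eq_divide)
qed

lemma hq_eventually_ge: "\<exists>s0. \<forall>s\<ge>s0. Z \<le> hq s"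
  using hq_at_top by (auto simp: filterlim_at_top eventually_sequentially)

lemma C4: "1 < C ^ 4"
  using C_gt by (simp add: one_less_power)

lemma C4_q: "0 < 1 / (C ^ 4 * real (q s))" "1 / (C ^ 4 * real (q s)) < 1"
proof -
  have "1 * 1 < C ^ 4 * real (q s)" using C4 q_ge_1[of s] by (intro mult_less_le_imp_less) auto
  then show "0 < 1 / (C ^ 4 * real (q s))" "1 / (C ^ 4 * real (q s)) < 1" by (simp_all add: field_simps)
qed

text \<open>
  The argument \<open>c / q s\<close> is at least one of those in the hypotheses, at a scale \<open>s + 2 * j\<close> with \<open>j\<close> depending only
  on \<open>c\<close>; passing between these scales costs a constant factor. The lower bound uses a scale \<open>s - 2 * j\<close>.
\<close>

lemma profile_upper:
  assumes c: "0 < c"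
  shows "\<exists>K>0. \<forall>s. c / real (q s) < 1 \<longrightarrow> h (c / real (q s)) \<le> K * hq s \<and> - deriv h (c / real (q s)) \<le> K * H s"
proof -
  obtain j :: nat where j: "max (1 / (2 * c)) (1 / (C ^ 4 * c)) < 2 ^ j"
    using real_arch_pow[of "2::real"] by (metis one_less_numeral_iff semiring_norm(76))
  define K where "K = max ((1 / D1) ^ (2 * j)) (D2 * (r / D1) ^ (2 * j))"
  have K: "0 < K" "(1 / D1) ^ (2 * j) \<le> K" "D2 * (r / D1) ^ (2 * j) \<le> K"
    using D_pos r_gt_1 by (auto simp: K_def less_max_iff_disj)
  show ?thesis
  proof (intro exI[of _ K] conjI K(1) allI impI)
    fix s assume c1: "c / real (q s) < 1"
    have qq: "2 ^ j * real (q s) \<le> real (q (s + 2 * j))"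
      using q_power[of j s] by (metis of_nat_le_iff of_nat_mult of_nat_numeral of_nat_power)
    have le: "1 / (z * real (q (s + 2 * j))) \<le> c / real (q s)" if z: "0 < z" "1 / (z * c) < 2 ^ j" for z
    proof -
      have "1 / (z * c) * real (q s) \<le> 2 ^ j * real (q s)" using z by (intro mult_right_mono) auto
      then have "1 / (z * c) * real (q s) \<le> real (q (s + 2 * j))" using qq by linarith
      then show ?thesis using z c q_pos[of s] q_pos[of "s + 2 * j"] by (simp add: field_simps)
    qed
    have le4: "1 / (C ^ 4 * real (q (s + 2 * j))) \<le> c / real (q s)"
      by (rule le) (use j C4 in auto)
    have "h (c / real (q s)) \<le> hq (s + 2 * j)"
      using le[of 2] j c1 half_q by (intro singular_profile_antimono[OF h_profile]) auto
    also have "\<dots> \<le> (1 / D1) ^ (2 * j) * hq s" by (rule hq_power)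
    also have "\<dots> \<le> K * hq s" using K hq_pos[of s] by (intro mult_right_mono) auto
    finally show "h (c / real (q s)) \<le> K * hq s" .
    have "- deriv h (c / real (q s)) \<le> - deriv h (1 / (C ^ 4 * real (q (s + 2 * j))))"
      using singular_profile_deriv_mono[OF h_profile C4_q(1) le4 c1] by simp
    also have "\<dots> \<le> D2 * H (s + 2 * j)"
      using D_upper[of "s + 2 * j"] H_pos[of "s + 2 * j"] by (simp add: H_def[symmetric] field_simps)
    also have "\<dots> \<le> D2 * ((r / D1) ^ (2 * j) * H s)" using D_pos H_power[of s "2 * j"] by (intro mult_left_mono) auto
    also have "\<dots> = D2 * (r / D1) ^ (2 * j) * H s" by simp
    also have "\<dots> \<le> K * H s" using K H_pos[of s] by (intro mult_right_mono) auto
    finally show "- deriv h (c / real (q s)) \<le> K * H s" .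
  qed
qed

definition profile_const :: "real \<Rightarrow> real" where
  "profile_const c = (SOME K. 0 < K \<and> (\<forall>s. c / real (q s) < 1 \<longrightarrow>
     h (c / real (q s)) \<le> K * hq s \<and> - deriv h (c / real (q s)) \<le> K * H s))"

lemma profile_const:
  assumes "0 < c"
  shows "0 < profile_const c"
    and "c / real (q s) < 1 \<Longrightarrow> h (c / real (q s)) \<le> profile_const c * hq s"
    and "c / real (q s) < 1 \<Longrightarrow> - deriv h (c / real (q s)) \<le> profile_const c * H s"
  using someI_ex[OF profile_upper[OF assms]] unfolding profile_const_def by auto

lemma profile_lower:
  assumes c: "0 < c"
  shows "\<exists>K>0. \<exists>s0. \<forall>s\<ge>s0. c / real (q s) < 1 \<and> K * H s \<le> - deriv h (c / real (q s))"
proof -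
  obtain j :: nat where j: "c * C ^ 4 < 2 ^ j"
    using real_arch_pow[of "2::real"] by (metis one_less_numeral_iff semiring_norm(76))
  have rD: "0 < (r / D1) ^ (2 * j)" using D_pos r_gt_1 by simp
  define K where "K = D1 / (r / D1) ^ (2 * j)"
  have K: "0 < K" using D_pos rD by (simp add: K_def)
  show ?thesis
  proof (intro exI[of _ K] conjI K exI[of _ "2 * j"] allI impI)
    fix s assume s: "2 * j \<le> s"
    define s' where "s' = s - 2 * j"
    have s': "s = s' + 2 * j" using s by (simp add: s'_def)
    have "2 ^ j * real (q s') \<le> real (q s)"
      using q_power[of j s'] unfolding s' by (metis of_nat_le_iff of_nat_mult of_nat_numeral of_nat_power)
    moreover have "c * C ^ 4 * real (q s') \<le> 2 ^ j * real (q s')" using j by (intro mult_right_mono) auto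
    ultimately have cq: "c * C ^ 4 * real (q s') \<le> real (q s)" by linarith
    define X where "X = C ^ 4 * real (q s')"
    have "c * X \<le> real (q s)" using cq by (simp only: X_def mult.assoc)
    moreover have "0 < X" unfolding X_def
    proof (rule mult_pos_pos)
      show "0 < C ^ 4" using C4 by linarith
    qed simp
    ultimately have "c / real (q s) \<le> 1 / X" using q_ge_1[of s] by (simp add: field_simps)
    then have le: "c / real (q s) \<le> 1 / (C ^ 4 * real (q s'))" by (simp only: X_def)
    then show "c / real (q s) < 1" using C4_q[of s'] by linarith
    have "H s \<le> (r / D1) ^ (2 * j) * H s'" unfolding s' by (rule H_power)
    then have "K * H s \<le> D1 * H s'" using rD D_pos by (simp add: K_def field_simps)
    also have "\<dots> \<le> - deriv h (1 / (C ^ 4 * real (q s')))"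
      using D_lower[of s'] H_pos[of s'] unfolding H_def by (intro less_imp_le) (simp only: pos_less_divide_eq)
    also have "\<dots> \<le> - deriv h (c / real (q s))"
      using le c C4_q[of s'] singular_profile_deriv_mono[OF h_profile, of "c / real (q s)" "1 / (C ^ 4 * real (q s'))"] by simp
    finally show "K * H s \<le> - deriv h (c / real (q s))" .
  qed
qed

text \<open>
  Since the derivative at \<open>1 / q s\<close> is comparable to the difference quotient \<open>h (1 / q s) / (1 / q s)\<close>,
  \<open>h\<close> grows at least by a constant factor from one denominator to the next but one.
\<close>

lemma profile_power_growth:
  "\<exists>w>1. \<exists>s0. \<forall>s\<ge>s0. \<forall>j. w ^ j * hq s \<le> hq (s + 2 * j)"
proof -
  obtain K s0 where K: "0 < K" and low: "\<And>s. s \<ge> s0 \<Longrightarrow> (1 / 2) / real (q s) < 1 \<and> K * H s \<le> - deriv h ((1 / 2) / real (q s))"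
    using profile_lower[of "1 / 2"] by auto
  have step: "(1 + K / 4) * hq s \<le> hq (s + 2)" if s: "s \<ge> s0" for s
  proof -
    let ?y = "1 / (2 * real (q s))" and ?x = "1 / (2 * real (q (s + 2)))"
    have "2 * real (q s) \<le> real (q (s + 2))" using q_double[of s] by linarith
    then have x: "?x \<le> ?y / 2" using q_pos[of s] q_pos[of "s + 2"] by (simp add: field_simps)
    have xy: "?x \<le> ?y" using \<open>2 * real (q s) \<le> real (q (s + 2))\<close> q_ge_1[of s] by (intro frac_le) auto
    have "K / 4 * hq s = K * H s * (?y / 2)" using q_pos[of s] by (simp add: H_def field_simps)
    also have "\<dots> \<le> - deriv h ?y * (?y / 2)" using low[OF s] half_q by (intro mult_right_mono) auto
    also have "\<dots> \<le> - deriv h ?y * (?y - ?x)"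
      using x singular_profileD(3)[OF h_profile half_q] by (intro mult_left_mono) auto
    also have "\<dots> \<le> h ?x - h ?y"
      by (rule singular_profile_decrease[OF h_profile half_q(1) xy half_q(2)])
    finally show ?thesis by (simp add: algebra_simps)
  qed
  have "(1 + K / 4) ^ j * hq s \<le> hq (s + 2 * j)" if s: "s \<ge> s0" for s j
  proof (induction j)
    case (Suc j)
    have "(1 + K / 4) ^ Suc j * hq s \<le> (1 + K / 4) * hq (s + 2 * j)" using Suc K by simp
    also have "\<dots> \<le> hq (s + 2 * Suc j)" using step[of "s + 2 * j"] s by simp
    finally show ?case .
  qed simp
  then show ?thesis using K by (intro exI[of _ "1 + K / 4"]) auto
qed

end

section \<open>Derivatives near and away from the singularities\<close>

lemma singularity_upper:
  assumes "has_singularity_of_type f g a A B" and g: "singular_profile g"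
  shows "\<exists>K>0. \<exists>\<eta>>0. \<forall>t. 0 < t \<longrightarrow> t < \<eta> \<longrightarrow>
    \<bar>deriv f (a + t)\<bar> \<le> K * - deriv g t \<and> \<bar>deriv f (a - t)\<bar> \<le> K * - deriv g t"
proof -
  have nz: "\<forall>\<^sub>F t in at_right 0. deriv g t \<noteq> 0"
    and R: "((\<lambda>x. deriv f x / deriv g (x - a)) \<longlongrightarrow> A) (at_right a)"
    and L: "((\<lambda>x. deriv f x / deriv g (a - x)) \<longlongrightarrow> - B) (at_left a)"
    and AB: "0 \<le> A" "0 \<le> B"
    using assms by (auto simp: has_singularity_of_type_def)
  have "((\<lambda>x. \<bar>deriv f x / deriv g (x - a)\<bar>) \<longlongrightarrow> \<bar>A\<bar>) (at_right a)" using R by (rule tendsto_rabs)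
  then have "\<forall>\<^sub>F x in at_right a. \<bar>deriv f x / deriv g (x - a)\<bar> < A + B + 1"
    using AB by (intro order_tendstoD) auto
  then have R': "\<forall>\<^sub>F t in at_right 0. \<bar>deriv f (t + a) / deriv g t\<bar> < A + B + 1"
    unfolding eventually_at_right_to_0[of _ a] by (rule eventually_mono) simp
  have "((\<lambda>x. \<bar>deriv f x / deriv g (a - x)\<bar>) \<longlongrightarrow> \<bar>- B\<bar>) (at_left a)" using L by (rule tendsto_rabs)
  then have "\<forall>\<^sub>F x in at_left a. \<bar>deriv f x / deriv g (a - x)\<bar> < A + B + 1"
    using AB by (intro order_tendstoD) auto
  then have L': "\<forall>\<^sub>F t in at_right 0. \<bar>deriv f (a - t) / deriv g t\<bar> < A + B + 1"
    unfolding eventually_at_left_to_right[of _ a] eventually_at_right_to_0[of _ "- a"]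
    by (rule eventually_mono) simp
  have "\<forall>\<^sub>F t in at_right 0. \<bar>deriv f (a + t)\<bar> \<le> (A + B + 1) * - deriv g t \<and> \<bar>deriv f (a - t)\<bar> \<le> (A + B + 1) * - deriv g t"
    using nz R' L' eventually_at_right_real[of 0 1, simplified]
  proof eventually_elim
    case (elim t)
    have neg: "\<bar>deriv g t\<bar> = - deriv g t" "0 < \<bar>deriv g t\<bar>"
      using singular_profileD(3)[OF g, of t] elim by auto
    have "\<bar>deriv f (t + a)\<bar> / \<bar>deriv g t\<bar> < A + B + 1" "\<bar>deriv f (a - t)\<bar> / \<bar>deriv g t\<bar> < A + B + 1"
      using elim by (simp_all add: abs_divide)
    then have "\<bar>deriv f (t + a)\<bar> < (A + B + 1) * \<bar>deriv g t\<bar>" "\<bar>deriv f (a - t)\<bar> < (A + B + 1) * \<bar>deriv g t\<bar>"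
      using neg(2) by (simp_all only: pos_divide_less_eq)
    then show ?case using neg by (simp add: add.commute)
  qed
  then obtain \<eta> where "0 < \<eta>" "\<forall>t>0. t < \<eta> \<longrightarrow>
      \<bar>deriv f (a + t)\<bar> \<le> (A + B + 1) * - deriv g t \<and> \<bar>deriv f (a - t)\<bar> \<le> (A + B + 1) * - deriv g t"
    by (auto simp: eventually_at_right_field)
  then show ?thesis using AB by (intro exI[of _ "A + B + 1"]) auto
qed

text \<open>
  The bound holds on the right of \<open>a\<close> if \<open>A > 0\<close>, and on its left otherwise.
\<close>

lemma singularity_lower:
  assumes "has_singularity_of_type f g a A B" and g: "singular_profile g" and pos: "0 < A\<^sup>2 + B\<^sup>2"
  shows "\<exists>\<sigma>\<in>{1, - 1}. \<exists>c>0. \<exists>\<eta>>0. \<forall>t. 0 < t \<longrightarrow> t < \<eta> \<longrightarrow> c * - deriv g t \<le> \<bar>deriv f (a + \<sigma> * t)\<bar>"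
proof -
  have R: "((\<lambda>x. deriv f x / deriv g (x - a)) \<longlongrightarrow> A) (at_right a)"
    and L: "((\<lambda>x. deriv f x / deriv g (a - x)) \<longlongrightarrow> - B) (at_left a)"
    and AB: "0 \<le> A" "0 \<le> B"
    using assms by (auto simp: has_singularity_of_type_def)
  have one: ?thesis
    if \<sigma>: "\<sigma> \<in> {1, - 1}" and c: "0 < c" and ev: "\<forall>\<^sub>F t in at_right 0. c < \<bar>deriv f (a + \<sigma> * t) / deriv g t\<bar>" for \<sigma> c
  proof -
    have "\<forall>\<^sub>F t in at_right 0. c * - deriv g t \<le> \<bar>deriv f (a + \<sigma> * t)\<bar>"
      using ev eventually_at_right_real[of 0 1, simplified]
    proof eventually_elim
      case (elim t)
      have nz: "deriv g t \<noteq> 0" using elim c by auto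
      have neg: "\<bar>deriv g t\<bar> = - deriv g t" using singular_profileD(3)[OF g, of t] elim by auto
      have "c < \<bar>deriv f (a + \<sigma> * t)\<bar> / \<bar>deriv g t\<bar>" using elim by (simp add: abs_divide)
      then have "c * \<bar>deriv g t\<bar> < \<bar>deriv f (a + \<sigma> * t)\<bar>" using nz by (simp add: pos_less_divide_eq)
      then show ?case using neg by simp
    qed
    then obtain \<eta> where "0 < \<eta>" "\<forall>t>0. t < \<eta> \<longrightarrow> c * - deriv g t \<le> \<bar>deriv f (a + \<sigma> * t)\<bar>"
      by (auto simp: eventually_at_right_field)
    then show ?thesis using \<sigma> c by blast
  qed
  show ?thesis
  proof (cases "A = 0")
    case False
    then have A: "0 < A / 2" "A / 2 < \<bar>A\<bar>" using AB by auto
    have "((\<lambda>x. \<bar>deriv f x / deriv g (x - a)\<bar>) \<longlongrightarrow> \<bar>A\<bar>) (at_right a)" using R by (rule tendsto_rabs)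
    then have "\<forall>\<^sub>F x in at_right a. A / 2 < \<bar>deriv f x / deriv g (x - a)\<bar>" using A by (intro order_tendstoD)
    then have "\<forall>\<^sub>F t in at_right 0. A / 2 < \<bar>deriv f (t + a) / deriv g (t + a - a)\<bar>"
      by (simp only: eventually_at_right_to_0[of _ a])
    then have ev: "\<forall>\<^sub>F t in at_right 0. A / 2 < \<bar>deriv f (a + 1 * t) / deriv g t\<bar>"
      by (rule eventually_mono) (simp add: add.commute)
    show ?thesis by (rule one[OF _ A(1) ev]) simp
  next
    case True
    then have B: "0 < B / 2" "B / 2 < \<bar>- B\<bar>" using AB pos by auto
    have "((\<lambda>x. \<bar>deriv f x / deriv g (a - x)\<bar>) \<longlongrightarrow> \<bar>- B\<bar>) (at_left a)" using L by (rule tendsto_rabs)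
    then have "\<forall>\<^sub>F x in at_left a. B / 2 < \<bar>deriv f x / deriv g (a - x)\<bar>" using B by (intro order_tendstoD)
    then have "\<forall>\<^sub>F t in at_right 0. B / 2 < \<bar>deriv f (- (t + - a)) / deriv g (a - - (t + - a))\<bar>"
      by (simp only: eventually_at_left_to_right[of _ a] eventually_at_right_to_0[of _ "- a"])
    then have ev: "\<forall>\<^sub>F t in at_right 0. B / 2 < \<bar>deriv f (a + - 1 * t) / deriv g t\<bar>"
      by (rule eventually_mono) simp
    show ?thesis by (rule one[OF _ B(1) ev]) simp
  qed
qed

locale singular_roof =
  fixes f :: "real \<Rightarrow> real" and k :: nat and a :: "nat \<Rightarrow> real" and G :: "nat \<Rightarrow> real \<Rightarrow> real" and A B :: "nat \<Rightarrow> real"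
  assumes periodic: "\<And>y. f (y + 1) = f y"
    and C2: "C2_on {y. \<forall>i\<in>{1..k}. y - a i \<notin> \<int>} f"
    and G_profile: "\<And>i. i \<in> {1..k} \<Longrightarrow> singular_profile (G i)"
    and type_G: "\<And>i. i \<in> {1..k} \<Longrightarrow> has_singularity_of_type f (G i) (a i) (A i) (B i)"
begin

abbreviation "regular \<equiv> {y. \<forall>i\<in>{1..k}. y - a i \<notin> \<int>}"

lemma regular_iff: "y \<in> regular \<longleftrightarrow> (\<forall>i\<in>{1..k}. 0 < circle_norm (y - a i))"
proof -
  have "0 < circle_norm z \<longleftrightarrow> z \<notin> \<int>" for z
    using circle_norm_nonneg[of z] by (simp add: circle_norm_eq_0_iff[symmetric] less_le)
  then show ?thesis by simp
qed

lemma continuous_circle_norm: "continuous_on S (\<lambda>y. circle_norm (y - c))"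
proof (rule continuous_on_subset[OF _ subset_UNIV], rule continuous_onI)
  fix y e :: real assume "0 < e"
  show "\<exists>d>0. \<forall>y'\<in>UNIV. dist y' y < d \<longrightarrow> dist (circle_norm (y' - c)) (circle_norm (y - c)) \<le> e"
  proof (intro exI[of _ e] conjI \<open>0 < e\<close> ballI impI)
    fix y' assume "dist y' y < e"
    then show "dist (circle_norm (y' - c)) (circle_norm (y - c)) \<le> e"
      using circle_norm_diff_le[of "y' - c" "y - c"] circle_norm_diff_le[of "y - c" "y' - c"]
      by (simp add: dist_real_def)
  qed
qed

lemma open_regular: "open regular"
proof -
  have "regular = (\<Inter>i\<in>{1..k}. {y. 0 < circle_norm (y - a i)})"
    by (intro set_eqI) (simp only: regular_iff INT_iff mem_Collect_eq)
  moreover have "open {y. 0 < circle_norm (y - a i)}" for i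
    by (intro open_Collect_less continuous_on_const continuous_circle_norm)
  ultimately show ?thesis by (simp add: open_INT)
qed

lemma f_has_deriv: "y \<in> regular \<Longrightarrow> (f has_real_derivative deriv f y) (at y)"
  using C2 open_regular unfolding C2_on_def
  by (simp add: differentiable_on_eq_differentiable_at DERIV_deriv_iff_real_differentiable)

lemma f_continuous: "continuous_on regular f"
  using C2 unfolding C2_on_def by (blast intro: differentiable_imp_continuous_on)

lemma deriv_f_continuous: "continuous_on regular (deriv f)"
  using C2 unfolding C2_on_def by (blast intro: C1_differentiable_imp_continuous_on)

lemma f_add_int: "f (y + of_int n) = f y"
  using periodic by (rule periodic_add_of_int)

lemma deriv_f_add_int: "deriv f (y + of_int n) = deriv f y"
proof -
  have "(f has_field_derivative D) (at (y + of_int n)) \<longleftrightarrow> (f has_field_derivative D) (at y)" for D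
    using DERIV_shift[of f D y "of_int n"] by (simp add: f_add_int)
  then show ?thesis by (simp add: deriv_def)
qed

text \<open>
  Near a singularity its type gives the bound, and \<open>deriv f\<close> is bounded on the compact rest of the circle.
\<close>

lemma deriv_f_bound:
  "\<exists>K>0. \<forall>y\<in>regular. \<bar>deriv f y\<bar> \<le> K * (1 + (\<Sum>i\<in>{1..k}. - deriv (G i) (circle_norm (y - a i))))"
proof -
  have "\<forall>i\<in>{1..k}. \<exists>K>0. \<exists>\<eta>>0. \<forall>t. 0 < t \<longrightarrow> t < \<eta> \<longrightarrow>
    \<bar>deriv f (a i + t)\<bar> \<le> K * - deriv (G i) t \<and> \<bar>deriv f (a i - t)\<bar> \<le> K * - deriv (G i) t"
    using singularity_upper[OF type_G G_profile] by blast
  then obtain K \<eta> where K: "\<And>i. i \<in> {1..k} \<Longrightarrow> 0 < K i" and \<eta>: "\<And>i. i \<in> {1..k} \<Longrightarrow> 0 < \<eta> i"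
    and near: "\<And>i t. i \<in> {1..k} \<Longrightarrow> 0 < t \<Longrightarrow> t < \<eta> i \<Longrightarrow>
      \<bar>deriv f (a i + t)\<bar> \<le> K i * - deriv (G i) t \<and> \<bar>deriv f (a i - t)\<bar> \<le> K i * - deriv (G i) t"
    by (simp only: bchoice_iff Bex_def) metis
  define W where "W = {0..1} \<inter> (\<Inter>i\<in>{1..k}. {y. \<eta> i \<le> circle_norm (y - a i)})"
  have "compact W" unfolding W_def
    by (intro compact_Int_closed compact_Icc closed_INT ballI closed_Collect_le continuous_on_const continuous_circle_norm)
  moreover have "W \<subseteq> regular"
  proof
    fix y assume "y \<in> W"
    then have "\<eta> i \<le> circle_norm (y - a i)" if "i \<in> {1..k}" for i using that by (auto simp: W_def)
    then show "y \<in> regular" unfolding regular_iff using \<eta> by (metis less_le_trans)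
  qed
  ultimately have "bounded (deriv f ` W)"
    by (intro compact_imp_bounded compact_continuous_image continuous_on_subset[OF deriv_f_continuous])
  then obtain K0 where K0: "0 < K0" "\<And>y. y \<in> W \<Longrightarrow> \<bar>deriv f y\<bar> \<le> K0"
    unfolding bounded_pos by auto
  define KK where "KK = K0 + (\<Sum>i\<in>{1..k}. K i)"
  have sK: "0 \<le> (\<Sum>i\<in>{1..k}. K i)" using K by (intro sum_nonneg) (simp add: less_imp_le)
  have KK: "0 < KK" "K0 \<le> KK" using K0 sK by (auto simp: KK_def)
  have KiKK: "K i \<le> KK" if "i \<in> {1..k}" for i
    using member_le_sum[of i "{1..k}" K] that K K0 by (auto simp: KK_def less_imp_le)
  have "\<bar>deriv f y\<bar> \<le> KK * (1 + (\<Sum>i\<in>{1..k}. - deriv (G i) (circle_norm (y - a i))))" if y: "y \<in> regular" for y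
  proof -
    have nonneg: "0 \<le> - deriv (G i) (circle_norm (y - a i))" if "i \<in> {1..k}" for i
    proof -
      have "0 < circle_norm (y - a i)" using y that unfolding regular_iff by blast
      then show ?thesis
        using singular_profileD(3)[OF G_profile[OF that], of "circle_norm (y - a i)"]
          circle_norm_le_half[of "y - a i"] by simp
    qed
    show ?thesis
    proof (cases "\<exists>i\<in>{1..k}. circle_norm (y - a i) < \<eta> i")
      case True
      then obtain i where i: "i \<in> {1..k}" "circle_norm (y - a i) < \<eta> i" by blast
      define t where "t = circle_norm (y - a i)"
      have "0 < t" using i(1) y unfolding t_def regular_iff by blast
      moreover have "t < \<eta> i" using i(2) by (simp add: t_def)
      ultimately have t: "0 < t" "t < \<eta> i" .
      obtain n where n: "t = \<bar>y - a i - of_int n\<bar>" unfolding t_def using circle_norm_attained by blast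
      have "y - of_int n = a i + t \<or> y - of_int n = a i - t" using n by auto
      then have "\<bar>deriv f (y - of_int n)\<bar> \<le> K i * - deriv (G i) t" using near[OF i(1) t] by auto
      then have "\<bar>deriv f y\<bar> \<le> K i * - deriv (G i) t" using deriv_f_add_int[of "y - of_int n" n] by simp
      also have "\<dots> \<le> KK * - deriv (G i) t"
        using KiKK[OF i(1)] nonneg[OF i(1)] by (intro mult_right_mono) (auto simp: t_def)
      also have "- deriv (G i) t \<le> (\<Sum>i\<in>{1..k}. - deriv (G i) (circle_norm (y - a i)))"
        unfolding t_def using i nonneg by (intro member_le_sum[of i "{1..k}" "\<lambda>i. - deriv (G i) (circle_norm (y - a i))"]) auto
      finally show ?thesis using KK(1) by (simp add: algebra_simps)
    next
      case False
      have "frac y - a i = y - a i - of_int \<lfloor>y\<rfloor>" for i by (simp add: frac_def)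
      then have "circle_norm (frac y - a i) = circle_norm (y - a i)" for i by (metis circle_norm_diff_of_int)
      then have "frac y \<in> W" using False frac_ge_0[of y] frac_lt_1[of y] by (auto simp: W_def not_less)
      then have "\<bar>deriv f (frac y)\<bar> \<le> K0" by (rule K0(2))
      moreover have "deriv f (frac y) = deriv f y"
        using deriv_f_add_int[of "frac y" "\<lfloor>y\<rfloor>"] by (simp add: frac_def)
      ultimately have "\<bar>deriv f y\<bar> \<le> KK * 1" using KK by simp
      also have "\<dots> \<le> KK * (1 + (\<Sum>i\<in>{1..k}. - deriv (G i) (circle_norm (y - a i))))"
        using nonneg KK(1) by (intro mult_left_mono) (auto intro!: sum_nonneg)
      finally show ?thesis .
    qed
  qed
  then show ?thesis using KK(1) by blast
qed

definition deriv_const :: real where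
  "deriv_const = (SOME K. 0 < K \<and> (\<forall>y\<in>regular. \<bar>deriv f y\<bar> \<le>
     K * (1 + (\<Sum>i\<in>{1..k}. - deriv (G i) (circle_norm (y - a i))))))"

lemma deriv_const:
  shows "0 < deriv_const"
    and "y \<in> regular \<Longrightarrow> \<bar>deriv f y\<bar> \<le> deriv_const * (1 + (\<Sum>i\<in>{1..k}. - deriv (G i) (circle_norm (y - a i))))"
  using someI_ex[OF deriv_f_bound] unfolding deriv_const_def by blast+

lemma mean_value_segment:
  assumes reg: "\<And>z. \<bar>y - z\<bar> \<le> \<bar>y - y'\<bar> \<Longrightarrow> z \<in> regular"
  shows "\<exists>z. (y \<le> z \<and> z \<le> y' \<or> y' \<le> z \<and> z \<le> y) \<and> f y - f y' = (y - y') * deriv f z"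
proof (cases y y' rule: linorder_cases)
  case less
  obtain z where "y < z" "z < y'" "f y' - f y = (y' - y) * deriv f z"
    using MVT2[OF less, of f "deriv f"] f_has_deriv[OF reg] by force
  then show ?thesis by (intro exI[of _ z]) (auto simp: algebra_simps)
next
  case greater
  obtain z where "y' < z" "z < y" "f y - f y' = (y - y') * deriv f z"
    using MVT2[OF greater, of f "deriv f"] f_has_deriv[OF reg] by force
  then show ?thesis by (intro exI[of _ z]) auto
qed auto

text \<open>A mean value point is needed for each term separately; the separation survives this choice.\<close>

lemma variation_bound:
  fixes I :: "int set" and u :: "nat \<Rightarrow> real"
  assumes I: "finite I" and \<rho>: "0 < \<rho>" "\<rho> \<le> 1 / 4"
    and sep: "\<forall>m\<in>I. \<forall>n\<in>I. m \<noteq> n \<longrightarrow> \<rho> + \<bar>y - y'\<bar> \<le> circle_norm (of_int m * \<alpha> - of_int n * \<alpha>)"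
    and u: "\<forall>i\<in>{1..k}. 0 < u i \<and> u i \<le> 1 / 2"
    and far: "\<forall>n\<in>I. \<forall>i\<in>{1..k}. u i + \<bar>y - y'\<bar> \<le> circle_norm (y + of_int n * \<alpha> - a i)"
  shows "(\<Sum>n\<in>I. \<bar>f (y + of_int n * \<alpha>) - f (y' + of_int n * \<alpha>)\<bar>) \<le>
      \<bar>y - y'\<bar> * (deriv_const * (real (card I) + (\<Sum>i\<in>{1..k}. 4 * (- deriv (G i) (u i)) + 2 * (G i \<rho> / \<rho>))))"
proof -
  let ?d = "\<bar>y - y'\<bar>" and ?K = deriv_const
  note K = deriv_const(1) and bound = deriv_const(2)
  have seg: "u i \<le> circle_norm (z + of_int n * \<alpha> - a i)"
    if "n \<in> I" "i \<in> {1..k}" "\<bar>y - z\<bar> \<le> ?d" for n i z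
  proof -
    have "u i + ?d \<le> circle_norm (y + of_int n * \<alpha> - a i)" using far that by blast
    also have "\<dots> \<le> circle_norm (z + of_int n * \<alpha> - a i) + \<bar>y - z\<bar>"
      using circle_norm_diff_le[of "y + of_int n * \<alpha> - a i" "z + of_int n * \<alpha> - a i"] by simp
    finally show ?thesis using that by linarith
  qed
  have "\<exists>z. f (y + of_int n * \<alpha>) - f (y' + of_int n * \<alpha>) = (y - y') * deriv f (z + of_int n * \<alpha>)
      \<and> (y \<le> z \<and> z \<le> y' \<or> y' \<le> z \<and> z \<le> y)" if n: "n \<in> I" for n
  proof -
    have reg: "z \<in> regular" if "\<bar>(y + of_int n * \<alpha>) - z\<bar> \<le> \<bar>(y + of_int n * \<alpha>) - (y' + of_int n * \<alpha>)\<bar>" for z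
      unfolding regular_iff using seg[OF n, of _ "z - of_int n * \<alpha>"] u that by fastforce
    let ?y = "y + of_int n * \<alpha>" and ?y' = "y' + of_int n * \<alpha>"
    have "\<exists>z. (?y \<le> z \<and> z \<le> ?y' \<or> ?y' \<le> z \<and> z \<le> ?y) \<and> f ?y - f ?y' = (?y - ?y') * deriv f z"
      by (rule mean_value_segment) (rule reg)
    then obtain z where "?y \<le> z \<and> z \<le> ?y' \<or> ?y' \<le> z \<and> z \<le> ?y" "f ?y - f ?y' = (?y - ?y') * deriv f z" by blast
    then show ?thesis by (intro exI[of _ "z - of_int n * \<alpha>"]) auto
  qed
  then obtain z where z:
    "\<And>n. n \<in> I \<Longrightarrow> f (y + of_int n * \<alpha>) - f (y' + of_int n * \<alpha>) = (y - y') * deriv f (z n + of_int n * \<alpha>)"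
    "\<And>n. n \<in> I \<Longrightarrow> y \<le> z n \<and> z n \<le> y' \<or> y' \<le> z n \<and> z n \<le> y"
    by metis
  have zd: "\<bar>y - z n\<bar> \<le> ?d" if "n \<in> I" for n using z(2)[OF that] by linarith
  let ?t = "\<lambda>n. z n + of_int n * \<alpha>"
  have reg: "?t n \<in> regular" if "n \<in> I" for n
    unfolding regular_iff using seg[OF that _ zd[OF that]] u by fastforce
  have sep_t: "\<rho> \<le> circle_norm (?t m - ?t n)" if "m \<in> I" "n \<in> I" "m \<noteq> n" for m n
  proof -
    have "\<rho> + ?d \<le> circle_norm (of_int m * \<alpha> - of_int n * \<alpha>)" using sep that by blast
    also have "\<dots> \<le> circle_norm (?t m - ?t n) + \<bar>(of_int m * \<alpha> - of_int n * \<alpha>) - (?t m - ?t n)\<bar>"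
      by (rule circle_norm_diff_le)
    also have "\<bar>(of_int m * \<alpha> - of_int n * \<alpha>) - (?t m - ?t n)\<bar> = \<bar>z m - z n\<bar>" by simp
    also have "\<dots> \<le> ?d" using z(2)[OF that(1)] z(2)[OF that(2)] by linarith
    finally show ?thesis by simp
  qed
  have "(\<Sum>n\<in>I. \<bar>f (y + of_int n * \<alpha>) - f (y' + of_int n * \<alpha>)\<bar>) = (\<Sum>n\<in>I. ?d * \<bar>deriv f (?t n)\<bar>)"
    using z(1) by (intro sum.cong) (auto simp: abs_mult)
  also have "\<dots> \<le> (\<Sum>n\<in>I. ?d * (?K * (1 + (\<Sum>i\<in>{1..k}. - deriv (G i) (circle_norm (?t n - a i))))))"
    using bound[OF reg] by (intro sum_mono mult_left_mono) auto
  also have "\<dots> = ?d * (?K * (real (card I) + (\<Sum>i\<in>{1..k}. \<Sum>n\<in>I. - deriv (G i) (circle_norm (?t n - a i)))))"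
    by (subst sum.swap) (simp add: sum_distrib_left[symmetric] sum.distrib)
  also have "\<dots> \<le> ?d * (?K * (real (card I) + (\<Sum>i\<in>{1..k}. 4 * (- deriv (G i) (u i)) + 2 * (G i \<rho> / \<rho>))))"
  proof (intro mult_left_mono add_left_mono sum_mono)
    fix i assume i: "i \<in> {1..k}"
    show "(\<Sum>n\<in>I. - deriv (G i) (circle_norm (?t n - a i))) \<le> 4 * (- deriv (G i) (u i)) + 2 * (G i \<rho> / \<rho>)"
      using seg[OF _ i zd] sep_t u i
      by (intro sum_deriv_separated[OF G_profile[OF i] I _ _ \<rho>]) auto
  qed (use K in auto)
  finally show ?thesis .
qed

end

section \<open>The drift of nearby orbits\<close>

locale drifting_roof = scaled_profile \<alpha> q r h C D1 D2 + singular_roof f k a G A B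
  for \<alpha> q r h C D1 D2 f k a G A B +
  fixes v :: nat and rad :: "nat \<Rightarrow> nat \<Rightarrow> real"
  assumes positive: "\<And>y. 0 < f y"
    and L1: "integrable circle_measure f"
    and sing_in: "\<And>i. i \<in> {1..k} \<Longrightarrow> a i \<in> {0..<1}"
    and E_nonempty: "v < k"
    and G_strong: "\<And>i. i \<in> {v + 1..k} \<Longrightarrow> G i = h"
    and E_strong: "\<And>i. i \<in> {v + 1..k} \<Longrightarrow> (A i)\<^sup>2 + (B i)\<^sup>2 > 0"
    and E_badly: "badly_approximable \<alpha> q (a ` {v + 1..k}) C"
    and G_small: "\<And>i. i \<in> {1..v} \<Longrightarrow> ((\<lambda>y. G i y / h y) \<longlongrightarrow> 0) (at_right 0)"
    and rad_in: "\<And>i s. i \<in> {1..v} \<Longrightarrow> rad i s \<in> {0<..<1}"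
    and rad_lower: "\<And>i s. i \<in> {1..v} \<Longrightarrow> rad i s > 1 / (real (q s) * h (1 / (2 * real (q s))))"
    and rad_deriv: "\<And>i. i \<in> {1..v} \<Longrightarrow> (\<lambda>s. deriv (G i) (rad i s) / deriv h (1 / (2 * real (q s)))) \<longlonglongrightarrow> 0"
    and rad_summable: "\<And>i. i \<in> {1..v} \<Longrightarrow> summable (\<lambda>s. real (q s) * rad i s)"
begin

text \<open>
  An orbit segment of length \<open>q s\<close> that keeps the distance \<open>rad i s\<close> from each weak singularity
  \<open>a i\<close> picks up at most this much derivative from them, up to a constant factor.
\<close>

definition weak :: "nat \<Rightarrow> real" where
  "weak s = (\<Sum>i\<in>{1..v}. 4 * (- deriv (G i) (rad i s)) + 8 * (real (q s) * G i (1 / (4 * real (q s)))))"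

lemma quarter_q: "0 < 1 / (4 * real (q s))" "1 / (4 * real (q s)) \<le> 1 / 4" "1 / (4 * real (q s)) < 1"
  using q_ge_1[of s] by (simp_all add: field_simps)

lemma v_le: "i \<in> {1..v} \<Longrightarrow> i \<in> {1..k}"
  using E_nonempty by simp

lemma weak_term_nonneg:
  assumes i: "i \<in> {1..v}"
  shows "0 \<le> 4 * (- deriv (G i) (rad i s)) + 8 * (real (q s) * G i (1 / (4 * real (q s))))"
proof (rule add_nonneg_nonneg)
  show "0 \<le> 4 * (- deriv (G i) (rad i s))"
    using singular_profileD(3)[OF G_profile[OF v_le[OF i]], of "rad i s"] rad_in[OF i, of s] by simp
  show "0 \<le> 8 * (real (q s) * G i (1 / (4 * real (q s))))"
    using singular_profileD(1)[OF G_profile[OF v_le[OF i]] quarter_q(1,3)[of s]] by simp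
qed

lemma weak_nonneg: "0 \<le> weak s"
  unfolding weak_def by (intro sum_nonneg weak_term_nonneg)

text \<open>
  The nearest point contributes \<open>G i' (rad i s)\<close>, which is small compared to \<open>h' (1 / (2 * q s))\<close> by the choice of
  \<open>rad\<close>. The others are \<open>1 / q s\<close> apart, so they only see \<open>G i\<close> at this scale, where it is small compared to \<open>h\<close>.
\<close>

lemma weak_negligible: "(\<lambda>s. weak s / H s) \<longlonglongrightarrow> 0"
proof -
  have one: "(\<lambda>s. (4 * (- deriv (G i) (rad i s)) + 8 * (real (q s) * G i (1 / (4 * real (q s))))) / H s) \<longlonglongrightarrow> 0"
    if i: "i \<in> {1..v}" for i
  proof -
    define K K' where "K = profile_const (1 / 2)" and "K' = profile_const (1 / 4)"
    have K: "- deriv h ((1 / 2) / real (q s)) \<le> K * H s" if "(1 / 2) / real (q s) < 1" for s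
      unfolding K_def using that by (intro profile_const) auto
    have K': "h ((1 / 4) / real (q s)) \<le> K' * hq s" if "(1 / 4) / real (q s) < 1" for s
      unfolding K'_def using that by (intro profile_const) auto
    have "(\<lambda>s. 4 * K * \<bar>deriv (G i) (rad i s) / deriv h (1 / (2 * real (q s)))\<bar>
        + 8 * K' * \<bar>G i (1 / (4 * real (q s))) / h (1 / (4 * real (q s)))\<bar>) \<longlonglongrightarrow> 4 * K * \<bar>0\<bar> + 8 * K' * \<bar>0\<bar>"
    proof (intro tendsto_intros rad_deriv[OF i])
      have "filterlim (\<lambda>s. real (q s)) at_top sequentially"
        by (rule filterlim_at_top_mono[OF filterlim_real_sequentially]) (simp add: q_ge_index)
      then have "filterlim (\<lambda>s. 4 * real (q s)) at_top sequentially"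
        by (rule filterlim_tendsto_pos_mult_at_top[OF tendsto_const, rotated]) simp
      then have "((\<lambda>s. inverse (4 * real (q s))) \<longlongrightarrow> 0) sequentially"
        by (rule tendsto_inverse_0_at_top)
      then have "filterlim (\<lambda>s. 1 / (4 * real (q s))) (at_right 0) sequentially"
        using quarter_q(1) by (intro tendsto_imp_filterlim_at_right) (simp_all add: inverse_eq_divide)
      then show "(\<lambda>s. G i (1 / (4 * real (q s))) / h (1 / (4 * real (q s)))) \<longlonglongrightarrow> 0"
        by (rule filterlim_compose[OF G_small[OF i]])
    qed
    then have lim: "(\<lambda>s. 4 * K * \<bar>deriv (G i) (rad i s) / deriv h (1 / (2 * real (q s)))\<bar>
        + 8 * K' * \<bar>G i (1 / (4 * real (q s))) / h (1 / (4 * real (q s)))\<bar>) \<longlonglongrightarrow> 0" by simp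
    have nz: "\<forall>\<^sub>F s in sequentially. deriv h (1 / (2 * real (q s))) \<noteq> 0"
    proof -
      obtain Kl s0 where Kl: "0 < Kl" "\<And>s. s \<ge> s0 \<Longrightarrow> Kl * H s \<le> - deriv h ((1 / 2) / real (q s))"
        using profile_lower[of "1 / 2"] by auto
      have "deriv h (1 / (2 * real (q s))) \<noteq> 0" if "s \<ge> s0" for s
      proof -
        have "0 < Kl * H s" using Kl(1) H_pos[of s] by (rule mult_pos_pos)
        then have "0 < - deriv h ((1 / 2) / real (q s))" using Kl(2)[OF that] by linarith
        then show ?thesis by simp
      qed
      then show ?thesis by (auto simp: eventually_sequentially)
    qed
    show ?thesis
    proof (rule tendsto_sandwich[OF _ _ tendsto_const lim])
      show "\<forall>\<^sub>F s in sequentially. 0 \<le> (4 * (- deriv (G i) (rad i s)) + 8 * (real (q s) * G i (1 / (4 * real (q s))))) / H s"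
        by (intro always_eventually allI divide_nonneg_pos H_pos weak_term_nonneg i)
      show "\<forall>\<^sub>F s in sequentially. (4 * (- deriv (G i) (rad i s)) + 8 * (real (q s) * G i (1 / (4 * real (q s))))) / H s
        \<le> 4 * K * \<bar>deriv (G i) (rad i s) / deriv h (1 / (2 * real (q s)))\<bar>
        + 8 * K' * \<bar>G i (1 / (4 * real (q s))) / h (1 / (4 * real (q s)))\<bar>"
        using nz
      proof eventually_elim
        case (elim s)
        define X Y where "X = \<bar>deriv (G i) (rad i s) / deriv h (1 / (2 * real (q s)))\<bar>"
          and "Y = \<bar>G i (1 / (4 * real (q s))) / h (1 / (4 * real (q s)))\<bar>"
        have XY: "0 \<le> X" "0 \<le> Y" by (simp_all add: X_def Y_def)
        have "- deriv (G i) (rad i s) \<le> X * - deriv h (1 / (2 * real (q s)))"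
          using elim singular_profileD(3)[OF h_profile half_q[of s]] by (simp add: X_def abs_divide)
        also have "\<dots> \<le> X * (K * H s)" using K[of s] half_q[of s] XY by (intro mult_left_mono) auto
        finally have 1: "- deriv (G i) (rad i s) \<le> K * X * H s" by (simp add: ac_simps)
        have "real (q s) * G i (1 / (4 * real (q s))) \<le> real (q s) * (Y * h (1 / (4 * real (q s))))"
          using singular_profileD(1)[OF h_profile quarter_q(1,3)[of s]] by (simp add: Y_def abs_divide)
        also have "\<dots> \<le> real (q s) * (Y * (K' * hq s))"
          using K'[of s] quarter_q[of s] XY by (intro mult_left_mono) auto
        finally have 2: "real (q s) * G i (1 / (4 * real (q s))) \<le> K' * Y * H s" by (simp add: H_def ac_simps)
        have "(4 * (- deriv (G i) (rad i s)) + 8 * (real (q s) * G i (1 / (4 * real (q s))))) \<le> (4 * K * X + 8 * K' * Y) * H s"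
          using 1 2 by (simp add: distrib_right)
        then show ?case using H_pos[of s] by (simp add: pos_divide_le_eq X_def Y_def)
      qed
    qed
  qed
  have "(\<lambda>s. \<Sum>i\<in>{1..v}. (4 * (- deriv (G i) (rad i s)) + 8 * (real (q s) * G i (1 / (4 * real (q s))))) / H s) \<longlonglongrightarrow> (\<Sum>i\<in>{1..v}. 0)"
    by (intro tendsto_sum one)
  then show ?thesis by (simp add: weak_def sum_divide_distrib)
qed

definition near :: "nat \<Rightarrow> real \<Rightarrow> bool" where
  "near s y \<longleftrightarrow> (\<exists>i\<in>{v + 1..k}. circle_norm (y - a i) \<le> 1 / (2 * C * real (q s)))"

lemma near_unique:
  assumes "near s (y + of_int m * \<alpha>)" "near s (y + of_int n * \<alpha>)"
    and "m \<in> {b..<b + int (q s)}" "n \<in> {b..<b + int (q s)}"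
  shows "m = n"
proof -
  let ?x = "y + of_int b * \<alpha>"
  have shift: "y + of_int j * \<alpha> = ?x + real (nat (j - b)) * \<alpha>" if "b \<le> j" for j
    using that by (simp add: algebra_simps)
  have "nat (m - b) = nat (n - b)"
  proof -
    have "nat (m - b) < q s" "nat (n - b) < q s" using assms(3,4) by auto
    moreover have "\<exists>b'\<in>a ` {v + 1..k}. circle_dist (?x + real (nat (j - b)) * \<alpha>) b' \<le> 1 / (2 * C * real (q s))"
      if "near s (y + of_int j * \<alpha>)" "b \<le> j" for j
      using that(1) unfolding near_def shift[OF that(2)] by (auto simp: circle_dist_def)
    ultimately show ?thesis using E_badly assms unfolding badly_approximable_def by (metis atLeastLessThan_iff)
  qed
  then show ?thesis using assms(3,4) by auto
qed

definition window_const :: real where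
  "window_const = deriv_const * (1 + real k * (4 * profile_const (1 / (4 * C)) + 8 * profile_const (1 / 4)))"

lemma window_const_pos: "0 < window_const"
proof -
  have "0 < profile_const (1 / (4 * C))" "0 < profile_const (1 / 4)" using C_gt by (auto intro: profile_const(1))
  then have "0 \<le> real k * (4 * profile_const (1 / (4 * C)) + 8 * profile_const (1 / 4))" by simp
  then show ?thesis using deriv_const(1) by (simp add: window_const_def add_pos_nonneg)
qed

text \<open>
  Two scales occur here: \<open>s\<close> limits the length of the window and the distance from the strong singularities,
  while the weak ones are controlled at the scale \<open>s'\<close> that fits the distance of the two points.
\<close>

lemma window_variation:
  assumes ss: "s \<le> s'" and I: "I \<subseteq> {b..<b + int (q s)}" and d: "\<bar>y - y'\<bar> \<le> 1 / (4 * C * real (q s'))"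
    and rad: "\<forall>i\<in>{1..v}. \<bar>y - y'\<bar> \<le> rad i s' \<and> rad i s' \<le> 1 / 2"
    and far: "\<forall>n\<in>I. \<not> near s (y + of_int n * \<alpha>) \<and> (\<forall>i\<in>{1..v}. 2 * rad i s' \<le> circle_norm (y + of_int n * \<alpha> - a i))"
  shows "(\<Sum>n\<in>I. \<bar>f (y + of_int n * \<alpha>) - f (y' + of_int n * \<alpha>)\<bar>)
    \<le> \<bar>y - y'\<bar> * (window_const * (real (q s) + H s + weak s'))"
proof -
  let ?d = "\<bar>y - y'\<bar>" and ?\<rho> = "1 / (4 * real (q s))"
  define Ku Kv where "Ku = profile_const (1 / (4 * C))" and "Kv = profile_const (1 / 4)"
  have C4: "0 < 1 / (4 * C)" and quarter: "(0::real) < 1 / 4" using C_gt by simp_all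
  have Ku: "0 < Ku" "(1 / (4 * C)) / real (q s) < 1 \<Longrightarrow> - deriv h ((1 / (4 * C)) / real (q s)) \<le> Ku * H s"
    unfolding Ku_def by (rule profile_const(1)[OF C4], rule profile_const(3)[OF C4])
  have Kv: "0 < Kv" "(1 / 4) / real (q s) < 1 \<Longrightarrow> h ((1 / 4) / real (q s)) \<le> Kv * hq s"
    unfolding Kv_def by (rule profile_const(1)[OF quarter], rule profile_const(2)[OF quarter])
  have Ke: "0 \<le> real k * (4 * Ku + 8 * Kv)" using Ku Kv by simp
  have fin: "finite I" using I by (rule finite_subset) simp
  have cI: "real (card I) \<le> real (q s)" using card_mono[OF _ I] by simp
  have qq: "real (q s) \<le> real (q s')" using q_mono[OF ss] by simp
  have "1 / (4 * C * real (q s')) \<le> 1 / (4 * C * real (q s))"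
    using qq C_gt q_ge_1[of s] by (intro frac_le) auto
  then have d1: "?d \<le> 1 / (4 * C * real (q s))" using d by linarith
  have "1 / (4 * C * real (q s)) \<le> ?\<rho>" using C_gt q_ge_1[of s] by (intro frac_le) auto
  then have d2: "?d \<le> ?\<rho>" using d1 by linarith
  define u where "u i = (if i \<le> v then rad i s' else (1 / (4 * C)) / real (q s))" for i
  have c1: "(1 / (4 * C)) / real (q s) \<le> 1 / 2" "0 < (1 / (4 * C)) / real (q s)"
  proof -
    have "1 * 1 \<le> C * real (q s)" using C_gt q_ge_1[of s] by (intro mult_mono) auto
    then show "(1 / (4 * C)) / real (q s) \<le> 1 / 2" "0 < (1 / (4 * C)) / real (q s)"
      using C_gt by (simp_all add: field_simps)
  qed
  have "(\<Sum>n\<in>I. \<bar>f (y + of_int n * \<alpha>) - f (y' + of_int n * \<alpha>)\<bar>) \<le>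
      ?d * (deriv_const * (real (card I) + (\<Sum>i\<in>{1..k}. 4 * (- deriv (G i) (u i)) + 2 * (G i ?\<rho> / ?\<rho>))))"
  proof (rule variation_bound[OF fin quarter_q(1,2)])
    show "\<forall>m\<in>I. \<forall>n\<in>I. m \<noteq> n \<longrightarrow> ?\<rho> + ?d \<le> circle_norm (of_int m * \<alpha> - of_int n * \<alpha>)"
    proof (intro ballI impI)
      fix m n assume mn: "m \<in> I" "n \<in> I" "m \<noteq> n"
      then have "m \<in> {b..<b + int (q s)}" "n \<in> {b..<b + int (q s)}" using I by auto
      then have "\<bar>m - n\<bar> < int (q s)" by auto
      then have "1 / (2 * real (q s)) \<le> circle_norm (of_int m * \<alpha> - of_int n * \<alpha>)"
        using orbit_separated mn(3) by blast
      moreover have "?\<rho> + ?\<rho> = 1 / (2 * real (q s))" by (simp add: field_simps)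
      ultimately show "?\<rho> + ?d \<le> circle_norm (of_int m * \<alpha> - of_int n * \<alpha>)" using d2 by linarith
    qed
    show "\<forall>i\<in>{1..k}. 0 < u i \<and> u i \<le> 1 / 2"
      using rad rad_in c1 by (auto simp: u_def)
    show "\<forall>n\<in>I. \<forall>i\<in>{1..k}. u i + ?d \<le> circle_norm (y + of_int n * \<alpha> - a i)"
    proof (intro ballI)
      fix n i assume n: "n \<in> I" and i: "i \<in> {1..k}"
      show "u i + ?d \<le> circle_norm (y + of_int n * \<alpha> - a i)"
      proof (cases "i \<le> v")
        case True
        then have "2 * rad i s' \<le> circle_norm (y + of_int n * \<alpha> - a i)" "?d \<le> rad i s'"
          using far n rad i by auto
        then show ?thesis using True by (simp add: u_def)
      next
        case False
        then have "1 / (2 * C * real (q s)) < circle_norm (y + of_int n * \<alpha> - a i)"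
          using far n i by (auto simp: near_def not_le)
        moreover have "1 / (2 * C * real (q s)) = (1 / (4 * C)) / real (q s) + 1 / (4 * C * real (q s))"
          using C_gt by (simp add: field_simps)
        ultimately show ?thesis using False d1 by (simp add: u_def)
      qed
    qed
  qed
  also have "\<dots> \<le> ?d * (window_const * (real (q s) + H s + weak s'))"
  proof (rule mult_left_mono)
    have un: "{1..k} = {1..v} \<union> {v + 1..k}" "{1..v} \<inter> {v + 1..k} = {}" using E_nonempty by auto
    have split: "(\<Sum>i\<in>{1..k}. 4 * (- deriv (G i) (u i)) + 2 * (G i ?\<rho> / ?\<rho>))
        = (\<Sum>i\<in>{1..v}. 4 * (- deriv (G i) (u i)) + 2 * (G i ?\<rho> / ?\<rho>))
        + (\<Sum>i\<in>{v + 1..k}. 4 * (- deriv (G i) (u i)) + 2 * (G i ?\<rho> / ?\<rho>))"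
      unfolding un(1) by (rule sum.union_disjoint) (use un(2) in auto)
    have "(\<Sum>i\<in>{1..v}. 4 * (- deriv (G i) (u i)) + 2 * (G i ?\<rho> / ?\<rho>)) \<le> weak s'"
      unfolding weak_def
    proof (rule sum_mono)
      fix i assume i: "i \<in> {1..v}"
      have "G i ?\<rho> \<le> G i (1 / (4 * real (q s')))"
        using qq quarter_q[of s] quarter_q[of s'] q_ge_1[of s]
        by (intro singular_profile_antimono[OF G_profile[OF v_le[OF i]]] frac_le) auto
      then have "real (q s) * G i ?\<rho> \<le> real (q s') * G i (1 / (4 * real (q s')))"
        using qq singular_profileD(1)[OF G_profile[OF v_le[OF i]] quarter_q(1,3)[of s]]
        by (intro mult_mono) auto
      moreover have "2 * (G i ?\<rho> / ?\<rho>) = 8 * (real (q s) * G i ?\<rho>)" by simp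
      moreover have "u i = rad i s'" using i by (simp add: u_def)
      ultimately show "4 * (- deriv (G i) (u i)) + 2 * (G i ?\<rho> / ?\<rho>)
          \<le> 4 * (- deriv (G i) (rad i s')) + 8 * (real (q s') * G i (1 / (4 * real (q s'))))"
        by (simp only:)
    qed
    moreover have "(\<Sum>i\<in>{v + 1..k}. 4 * (- deriv (G i) (u i)) + 2 * (G i ?\<rho> / ?\<rho>)) \<le> real k * (4 * Ku + 8 * Kv) * H s"
    proof -
      have "(\<Sum>i\<in>{v + 1..k}. 4 * (- deriv (G i) (u i)) + 2 * (G i ?\<rho> / ?\<rho>)) \<le> (\<Sum>i\<in>{v + 1..k}. (4 * Ku + 8 * Kv) * H s)"
      proof (rule sum_mono)
        fix i assume i: "i \<in> {v + 1..k}"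
        have "- deriv h ((1 / (4 * C)) / real (q s)) \<le> Ku * H s" using Ku(2) c1 by simp
        moreover have "2 * (h ?\<rho> / ?\<rho>) = 8 * (real (q s) * h ((1 / 4) / real (q s)))" by simp
        moreover have "real (q s) * h ((1 / 4) / real (q s)) \<le> real (q s) * (Kv * hq s)"
          using Kv(2) quarter_q[of s] by (intro mult_left_mono) auto
        moreover have "real (q s) * (Kv * hq s) = Kv * H s" by (simp add: H_def)
        ultimately have "4 * (- deriv h ((1 / (4 * C)) / real (q s))) + 2 * (h ?\<rho> / ?\<rho>) \<le> (4 * Ku + 8 * Kv) * H s"
          by (simp only: distrib_right)
        then show "4 * (- deriv (G i) (u i)) + 2 * (G i ?\<rho> / ?\<rho>) \<le> (4 * Ku + 8 * Kv) * H s"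
          using i G_strong[OF i] by (simp add: u_def)
      qed
      also have "\<dots> = real (k - v) * ((4 * Ku + 8 * Kv) * H s)" by simp
      also have "\<dots> \<le> real k * ((4 * Ku + 8 * Kv) * H s)"
        using Ku Kv H_pos[of s] by (intro mult_right_mono) auto
      finally show ?thesis by (simp only: mult.assoc)
    qed
    ultimately have "real (card I) + (\<Sum>i\<in>{1..k}. 4 * (- deriv (G i) (u i)) + 2 * (G i ?\<rho> / ?\<rho>))
        \<le> real (q s) + (real k * (4 * Ku + 8 * Kv) * H s + weak s')"
      using cI unfolding split by linarith
    also have "\<dots> \<le> (1 + real k * (4 * Ku + 8 * Kv)) * (real (q s) + H s + weak s')"
    proof -
      have "0 \<le> real k * (4 * Ku + 8 * Kv) * (real (q s) + weak s')"
        by (rule mult_nonneg_nonneg[OF Ke]) (use weak_nonneg[of s'] in simp)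
      then show ?thesis using H_pos[of s] by (simp add: algebra_simps)
    qed
    finally show "deriv_const * (real (card I) + (\<Sum>i\<in>{1..k}. 4 * (- deriv (G i) (u i)) + 2 * (G i ?\<rho> / ?\<rho>)))
        \<le> window_const * (real (q s) + H s + weak s')"
      unfolding window_const_def mult.assoc Ku_def Kv_def
        using deriv_const(1) by (intro mult_left_mono) (auto simp: mult.assoc)
  qed simp
  finally show ?thesis .
qed

text \<open>
  A visit of the orbit to a strong singularity at a distance of order \<open>1 / q s\<close> makes the two Birkhoff sums
  drift apart by a constant amount.
\<close>

lemma strong_visit_jump:
  "\<exists>c>0. \<exists>s0\<ge>6. \<forall>s\<ge>s0. \<forall>(y::real) y' b. 1 / H (Suc s) < \<bar>y - y'\<bar> \<longrightarrow> \<bar>y - y'\<bar> \<le> 1 / (4 * C * real (q s)) \<longrightarrow>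
    (\<forall>i\<in>{1..v}. \<bar>y - y'\<bar> \<le> rad i s) \<longrightarrow>
    (\<forall>n\<in>{b..<b + int (q (s - 6))}. \<not> near s (y + of_int n * \<alpha>) \<and>
        (\<forall>i\<in>{1..v}. 2 * rad i s \<le> circle_norm (y + of_int n * \<alpha> - a i))) \<longrightarrow>
    (\<exists>n\<in>{b..<b + int (q (s - 6))}. (\<exists>i\<in>{v + 1..k}. circle_norm (y + of_int n * \<alpha> - a i) \<le> 6 / real (q (s - 6)))
      \<and> c \<le> \<bar>f (y + of_int n * \<alpha>) - f (y' + of_int n * \<alpha>)\<bar>)"
proof -
  have k: "k \<in> {v + 1..k}" "k \<in> {1..k}" using E_nonempty by auto
  have hk: "has_singularity_of_type f h (a k) (A k) (B k)" using type_G[OF k(2)] G_strong[OF k(1)] by simp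
  obtain \<sigma> cl \<eta> where \<sigma>: "\<sigma> \<in> {1, - 1 :: real}" and cl: "0 < cl" and \<eta>: "0 < \<eta>"
    and low: "\<And>t. 0 < t \<Longrightarrow> t < \<eta> \<Longrightarrow> cl * - deriv h t \<le> \<bar>deriv f (a k + \<sigma> * t)\<bar>"
    using singularity_lower[OF hk h_profile E_strong[OF k(1)]] by metis
  have "0 < 7 * r ^ 6" using r_gt_1 by simp
  then obtain Kl s0 where Kl: "0 < Kl"
    and s0: "\<And>s. s \<ge> s0 \<Longrightarrow> 7 * r ^ 6 / real (q s) < 1 \<and> Kl * H s \<le> - deriv h (7 * r ^ 6 / real (q s))"
    using profile_lower by blast
  obtain N :: nat where N: "max 14 (7 / \<eta>) < real N" using reals_Archimedean2 by blast
  define c where "c = cl * Kl * (D1 / r)"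
  have c: "0 < c" using cl Kl D_pos r_gt_1 by (simp add: c_def)
  show ?thesis
  proof (intro exI[of _ c] exI[of _ "max s0 (N + 6)"] conjI c allI impI)
    show "6 \<le> max s0 (N + 6)" by simp
    fix s b and y y' :: real
    let ?d = "\<bar>y - y'\<bar>"
    assume s: "max s0 (N + 6) \<le> s" and dl: "1 / H (Suc s) < ?d" and du: "?d \<le> 1 / (4 * C * real (q s))"
      and rad: "\<forall>i\<in>{1..v}. ?d \<le> rad i s"
      and far: "\<forall>n\<in>{b..<b + int (q (s - 6))}. \<not> near s (y + of_int n * \<alpha>) \<and>
        (\<forall>i\<in>{1..v}. 2 * rad i s \<le> circle_norm (y + of_int n * \<alpha> - a i))"
    define Q where "Q = real (q (s - 6))"
    have Q1: "1 \<le> Q" using q_ge_1 by (simp add: Q_def)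
    have "real N \<le> Q" unfolding Q_def using s q_ge_index[of "s - 6"] by linarith
    then have QN: "14 < Q" "7 / \<eta> < Q" using N by linarith+
    have Q7: "7 / Q < 1 / 2" "7 / Q < \<eta>" using QN \<eta> Q1 by (simp_all add: field_simps)
    have Qs: "Q \<le> real (q s)" "real (q s) \<le> r ^ 6 * Q"
      using q_mono[of "s - 6" s] q_le_power[of "s - 6" 6] s by (simp_all add: Q_def)
    have dQ: "?d \<le> 1 / Q"
    proof -
      have "Q \<le> 4 * C * real (q s)" using Qs(1) C_gt mult_mono[of 1 "4 * C" Q "real (q s)"] Q1 by simp
      then have "1 / (4 * C * real (q s)) \<le> 1 / Q" using Q1 by (intro frac_le) auto
      then show ?thesis using du by linarith
    qed
    obtain n z where n: "n \<in> {b..<b + int (q (s - 6))}"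
      and nz: "(if \<sigma> = 1 then a k else a k - 6 / Q) < y + of_int n * \<alpha> - of_int z"
        "y + of_int n * \<alpha> - of_int z < (if \<sigma> = 1 then a k else a k - 6 / Q) + 6 / Q"
      using orbit_visits[of b "s - 6" "if \<sigma> = 1 then a k else a k - 6 / Q" y] unfolding Q_def by blast
    define t0 where "t0 = \<sigma> * (y + of_int n * \<alpha> - of_int z - a k)"
    have t0: "0 < t0" "t0 < 6 / Q" using nz \<sigma> by (auto simp: t0_def split: if_splits)
    have t0n: "circle_norm (y + of_int n * \<alpha> - a k) = t0"
    proof -
      have "\<bar>y + of_int n * \<alpha> - of_int z - a k\<bar> = t0" using \<sigma> t0(1) by (auto simp: t0_def)
      moreover have "6 / Q \<le> 7 / Q" using Q1 by (intro divide_right_mono) auto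
      then have "t0 \<le> 1 / 2" using t0 Q7 by linarith
      ultimately have "circle_norm (y + of_int n * \<alpha> - of_int z - a k) = t0" by (simp add: circle_norm_eq_abs)
      moreover have "y + of_int n * \<alpha> - of_int z - a k = y + of_int n * \<alpha> - a k - of_int z" by simp
      ultimately show ?thesis by (metis circle_norm_diff_of_int)
    qed
    have half: "1 / (2 * C * real (q s)) = 2 * (1 / (4 * C * real (q s)))" using C_gt by (simp add: field_simps)
    have q4: "0 < 1 / (4 * C * real (q s))" using C_gt by simp
    have strong: "?d < circle_norm (y + of_int n * \<alpha> - a i)" if "i \<in> {v + 1..k}" for i
    proof -
      have "\<not> near s (y + of_int n * \<alpha>)" using far n by blast
      then have "1 / (2 * C * real (q s)) < circle_norm (y + of_int n * \<alpha> - a i)"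
        using that by (auto simp: near_def not_le)
      then show ?thesis using du half q4 by linarith
    qed
    have dt0: "?d < t0" using strong[OF k(1)] t0n by simp
    let ?y = "y + of_int n * \<alpha>" and ?y' = "y' + of_int n * \<alpha>"
    have "\<exists>z. (?y \<le> z \<and> z \<le> ?y' \<or> ?y' \<le> z \<and> z \<le> ?y) \<and> f ?y - f ?y' = (?y - ?y') * deriv f z"
    proof (rule mean_value_segment)
      fix w assume w: "\<bar>?y - w\<bar> \<le> \<bar>?y - ?y'\<bar>"
      have "0 < circle_norm (w - a i)" if i: "i \<in> {1..k}" for i
      proof -
        have "?d < circle_norm (?y - a i)"
        proof (cases "i \<le> v")
          case True
          then have "2 * rad i s \<le> circle_norm (?y - a i)" "?d \<le> rad i s" "0 < rad i s"
            using far n rad i rad_in[of i s] by auto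
          then show ?thesis by linarith
        qed (use strong i in auto)
        then show ?thesis using circle_norm_diff_le[of "?y - a i" "w - a i"] w by simp
      qed
      then show "w \<in> regular" unfolding regular_iff by blast
    qed
    then obtain w where w: "?y \<le> w \<and> w \<le> ?y' \<or> ?y' \<le> w \<and> w \<le> ?y" "f ?y - f ?y' = (?y - ?y') * deriv f w"
      by blast
    define t where "t = \<sigma> * (w - of_int z - a k)"
    have "\<bar>t - t0\<bar> \<le> ?d" using w(1) \<sigma> by (auto simp: t_def t0_def)
    moreover have "6 / Q + 1 / Q = 7 / Q" by (simp add: add_divide_distrib[symmetric])
    ultimately have t: "0 < t" "t \<le> 7 / Q" using dt0 t0 dQ by linarith+
    have wt: "w - of_int z = a k + \<sigma> * t" using \<sigma> by (auto simp: t_def)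
    have "Kl * H s \<le> - deriv h t"
    proof -
      have "7 / Q \<le> 7 * r ^ 6 / real (q s)" using Qs(2) Q1 q_ge_1[of s] by (simp add: field_simps)
      then have "t \<le> 7 * r ^ 6 / real (q s)" using t by linarith
      then have "deriv h t \<le> deriv h (7 * r ^ 6 / real (q s))"
        using t(1) s0[of s] s by (intro singular_profile_deriv_mono[OF h_profile]) auto
      then show ?thesis using s0[of s] s by auto
    qed
    then have "cl * (Kl * H s) \<le> cl * - deriv h t" using cl by (intro mult_left_mono) auto
    also have "\<dots> \<le> \<bar>deriv f (w - of_int z)\<bar>" unfolding wt using t Q7 by (intro low) auto
    also have "deriv f (w - of_int z) = deriv f w" using deriv_f_add_int[of "w - of_int z" z] by simp
    finally have big: "cl * (Kl * H s) \<le> \<bar>deriv f w\<bar>" .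
    have dH: "D1 / r \<le> ?d * H s"
    proof -
      have "1 < ?d * H (Suc s)" using dl H_pos[of "Suc s"] by (simp add: pos_divide_less_eq)
      also have "\<dots> \<le> ?d * (r / D1 * H s)" using H_power[of s 1] by (intro mult_left_mono) auto
      finally show ?thesis using D_pos r_gt_1 by (simp add: field_simps)
    qed
    have "c \<le> cl * Kl * (?d * H s)" unfolding c_def using dH cl Kl by (intro mult_left_mono) auto
    also have "\<dots> = ?d * (cl * (Kl * H s))" by (simp add: ac_simps)
    also have "\<dots> \<le> ?d * \<bar>deriv f w\<bar>" using big by (intro mult_left_mono) auto
    also have "\<dots> = \<bar>f ?y - f ?y'\<bar>" unfolding w(2) by (simp add: abs_mult)
    finally have "c \<le> \<bar>f ?y - f ?y'\<bar>" .
    moreover have "circle_norm (?y - a k) \<le> 6 / real (q (s - 6))" using t0n t0 by (simp add: Q_def)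
    ultimately show "\<exists>n\<in>{b..<b + int (q (s - 6))}. (\<exists>i\<in>{v + 1..k}. circle_norm (y + of_int n * \<alpha> - a i) \<le> 6 / real (q (s - 6)))
      \<and> c \<le> \<bar>f (y + of_int n * \<alpha>) - f (y' + of_int n * \<alpha>)\<bar>"
      using n k(1) by blast
  qed
qed

end

lemma telescoping_bound:
  fixes D \<Delta> :: "int \<Rightarrow> real"
  assumes D: "\<And>n. D (n + 1) = D n + \<Delta> n" and I: "finite I" "{m..<n} \<subseteq> I" and mn: "m \<le> n"
  shows "\<bar>D n - D m\<bar> \<le> (\<Sum>j\<in>I. \<bar>\<Delta> j\<bar>)"
proof -
  have "\<bar>D n - D m\<bar> \<le> (\<Sum>j\<in>{m..<n}. \<bar>\<Delta> j\<bar>)" using mn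
  proof (induction n rule: int_ge_induct)
    case (step i)
    have "{m..<i + 1} = insert i {m..<i}" using step by auto
    then have "(\<Sum>j\<in>{m..<i + 1}. \<bar>\<Delta> j\<bar>) = \<bar>\<Delta> i\<bar> + (\<Sum>j\<in>{m..<i}. \<bar>\<Delta> j\<bar>)" by simp
    then show ?case using step D[of i] by simp
  qed simp
  also have "\<dots> \<le> (\<Sum>j\<in>I. \<bar>\<Delta> j\<bar>)" using I by (intro sum_mono2) auto
  finally show ?thesis .
qed

lemma measure_arc:
  assumes "0 < \<rho>"
  shows "{x \<in> space circle_measure. circle_norm (x + c) < \<rho>} \<in> sets circle_measure"
    and "measure circle_measure {x \<in> space circle_measure. circle_norm (x + c) < \<rho>} \<le> 2 * \<rho>"
proof -
  let ?A = "{y \<in> {0..<1}. circle_norm y < \<rho>}"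
  have A_eq: "?A = {0..<1} \<inter> ({..<\<rho>} \<union> {1 - \<rho><..})"
  proof (intro set_eqI iffI)
    fix y assume y: "y \<in> ?A"
    obtain m where m: "circle_norm y = \<bar>y - of_int m\<bar>" using circle_norm_attained by blast
    have "m \<le> 0 \<or> 1 \<le> m" by linarith
    then have "of_int m \<le> (0::real) \<or> (1::real) \<le> of_int m" by simp
    then show "y \<in> {0..<1} \<inter> ({..<\<rho>} \<union> {1 - \<rho><..})" using y m by auto
  next
    fix y assume y: "y \<in> {0..<1} \<inter> ({..<\<rho>} \<union> {1 - \<rho><..})"
    then show "y \<in> ?A" using circle_norm_le[of y 0] circle_norm_le[of y 1] by auto
  qed
  have Ab: "?A \<in> sets borel" unfolding A_eq by auto
  then have As: "?A \<in> sets circle_measure"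
    unfolding sets_circle_measure sets_restrict_space by (auto intro!: image_eqI[of _ _ ?A])
  have eq: "{x \<in> space circle_measure. circle_norm (x + c) < \<rho>} = (\<lambda>x. frac (x + c)) -` ?A \<inter> space circle_measure"
    using circle_norm_frac[of "_ + c" 0] by (auto simp: frac_lt_1)
  show "{x \<in> space circle_measure. circle_norm (x + c) < \<rho>} \<in> sets circle_measure"
    unfolding eq using frac_rotation_measurable As by (rule measurable_sets)
  have "emeasure circle_measure {x \<in> space circle_measure. circle_norm (x + c) < \<rho>} = emeasure (distr circle_measure circle_measure (\<lambda>x. frac (x + c))) ?A"
    unfolding eq by (rule emeasure_distr[symmetric, OF frac_rotation_measurable As])
  also have "\<dots> = emeasure lborel ?A" unfolding distr_frac_rotation by (rule emeasure_circle_measure[OF Ab]) auto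
  also have "\<dots> \<le> emeasure lborel ({0..\<rho>} \<union> {1 - \<rho>..1})"
    unfolding A_eq by (intro emeasure_mono) auto
  also have "\<dots> \<le> emeasure lborel {0..\<rho>} + emeasure lborel {1 - \<rho>..1}"
    by (intro emeasure_subadditive) auto
  also have "\<dots> = ennreal (2 * \<rho>)" using assms by (simp flip: ennreal_plus)
  finally show "measure circle_measure {x \<in> space circle_measure. circle_norm (x + c) < \<rho>} \<le> 2 * \<rho>"
    unfolding measure_def using assms by (intro enn2real_leI) auto
qed

context drifting_roof
begin

lemma smaller_scale:
  assumes "0 < \<kappa>" "\<kappa> \<le> 1" "1 \<le> \<kappa> * real (q s)"
  shows "\<exists>t\<le>s. real (q t) \<le> \<kappa> * real (q s) \<and> \<kappa> * real (q s) < r * real (q t)"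
proof -
  define S where "S = {t. real (q t) \<le> \<kappa> * real (q s)}"
  have sub: "S \<subseteq> {..s}"
  proof
    fix t assume "t \<in> S"
    then have "real (q t) \<le> \<kappa> * real (q s)" by (simp add: S_def)
    also have "\<dots> \<le> 1 * real (q s)" using assms by (intro mult_right_mono) auto
    finally have "q t \<le> q s" by simp
    then show "t \<in> {..s}" using strict_mono_less_eq[OF strict_mono_q] by simp
  qed
  have fin: "finite S" using sub by (rule finite_subset) simp
  have "0 \<in> S" using assms by (simp add: S_def)
  then have M: "Max S \<in> S" using Max_in[OF fin] by blast
  have "Suc (Max S) \<notin> S" using Max_ge[OF fin, of "Suc (Max S)"] by auto
  then have "\<kappa> * real (q s) < real (q (Suc (Max S)))" by (simp add: S_def)
  then have "\<kappa> * real (q s) < r * real (q (Max S))" using bounded_type[of "Max S"] by linarith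
  then show ?thesis using M sub by (intro exI[of _ "Max S"]) (auto simp: S_def)
qed

lemma eventually_controlled:
  assumes \<omega>: "0 < \<omega>"
  shows "\<exists>s0. \<forall>s\<ge>s0. weak s \<le> \<omega> * H s \<and> (\<forall>i\<in>{1..v}. rad i s \<le> 1 / 2) \<and> 4 * C \<le> hq s \<and> 1 / \<omega> \<le> hq s \<and> Z \<le> real (q s)"
proof -
  have "\<forall>\<^sub>F s in sequentially. weak s / H s < \<omega>"
    using weak_negligible \<omega> by (intro order_tendstoD) auto
  moreover have "\<forall>\<^sub>F s in sequentially. \<forall>i\<in>{1..v}. rad i s \<le> 1 / 2"
  proof (intro eventually_ball_finite ballI)
    fix i assume i: "i \<in> {1..v}"
    have "\<forall>\<^sub>F s in sequentially. real (q s) * rad i s < 1 / 2"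
      using summable_LIMSEQ_zero[OF rad_summable[OF i]] by (intro order_tendstoD) auto
    then show "\<forall>\<^sub>F s in sequentially. rad i s \<le> 1 / 2"
    proof eventually_elim
      case (elim s)
      have "1 * rad i s \<le> real (q s) * rad i s"
        using q_ge_1[of s] rad_in[OF i, of s] by (intro mult_right_mono) auto
      then show ?case using elim by simp
    qed
  qed simp
  moreover have "\<forall>\<^sub>F s in sequentially. 4 * C \<le> hq s" "\<forall>\<^sub>F s in sequentially. 1 / \<omega> \<le> hq s"
    using hq_at_top by (auto simp: filterlim_at_top)
  moreover have "\<forall>\<^sub>F s in sequentially. Z \<le> real (q s)"
  proof -
    obtain N :: nat where "Z \<le> real N" using real_arch_simple by blast
    then have "Z \<le> real (q s)" if "N \<le> s" for s using that q_ge_index[of s] by linarith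
    then show ?thesis by (auto simp: eventually_sequentially)
  qed
  ultimately have "\<forall>\<^sub>F s in sequentially. weak s \<le> \<omega> * H s \<and> (\<forall>i\<in>{1..v}. rad i s \<le> 1 / 2) \<and> 4 * C \<le> hq s \<and> 1 / \<omega> \<le> hq s \<and> Z \<le> real (q s)"
  proof eventually_elim
    case (elim s)
    then have "weak s < \<omega> * H s" using H_pos[of s] by (simp add: pos_divide_less_eq)
    then show ?case using elim by auto
  qed
  then show ?thesis by (simp add: eventually_sequentially)
qed

definition drift_at_scale :: "real \<Rightarrow> real \<Rightarrow> real \<Rightarrow> real \<Rightarrow> nat \<Rightarrow> bool" where
  "drift_at_scale c1 c2 \<kappa> e s \<longleftrightarrow> (\<forall>(y::real) y' (D :: int \<Rightarrow> real).
    1 / H (Suc s) < \<bar>y - y'\<bar> \<longrightarrow> \<bar>y - y'\<bar> \<le> 1 / H s \<longrightarrow>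
    (\<forall>i\<in>{1..v}. \<forall>n. \<bar>n\<bar> \<le> int (q s) \<longrightarrow> 2 * rad i s \<le> circle_norm (y + of_int n * \<alpha> - a i)) \<longrightarrow>
    D 0 = 0 \<longrightarrow> (\<forall>n. D (n + 1) = D n + (f (y + of_int n * \<alpha>) - f (y' + of_int n * \<alpha>))) \<longrightarrow>
    drifts c1 c2 \<kappa> e (s - 7) D)"

text \<open>
  In one of the two time directions the orbit of \<open>y\<close> has no visit at scale \<open>s\<close> to the strong singularities, but it comes
  within a constant multiple of \<open>1 / q s\<close> at some time \<open>n0\<close>. Then \<open>D n0\<close> and \<open>D (n0 + 1)\<close> differ by at
  least \<open>c\<close>, so that one of them has modulus at least \<open>c / 2\<close>. At the much smaller scale \<open>t\<close> this is the only
  visit within \<open>q t\<close> steps, so that \<open>D\<close> hardly changes before \<open>n0\<close> nor after \<open>n0 + 1\<close>. The variation there is of the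
  order \<open>H t / H s\<close>, which is small compared to \<open>q t / q s\<close> by the power growth of \<open>h\<close>.
\<close>

lemma drift:
  "\<exists>c1>0. \<exists>c2. \<forall>\<tau>>0. \<exists>\<kappa>>0. \<kappa> \<le> 1 \<and> (\<exists>s1. \<forall>s\<ge>s1. drift_at_scale c1 c2 \<kappa> (\<tau> * \<kappa>) s)"
proof -
  obtain c s0 where c: "0 < c" and s06: "6 \<le> s0"
    and jump: "\<forall>s\<ge>s0. \<forall>(y::real) y' b. 1 / H (Suc s) < \<bar>y - y'\<bar> \<longrightarrow> \<bar>y - y'\<bar> \<le> 1 / (4 * C * real (q s)) \<longrightarrow>
      (\<forall>i\<in>{1..v}. \<bar>y - y'\<bar> \<le> rad i s) \<longrightarrow>
      (\<forall>n\<in>{b..<b + int (q (s - 6))}. \<not> near s (y + of_int n * \<alpha>) \<and>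
          (\<forall>i\<in>{1..v}. 2 * rad i s \<le> circle_norm (y + of_int n * \<alpha> - a i))) \<longrightarrow>
      (\<exists>n\<in>{b..<b + int (q (s - 6))}. (\<exists>i\<in>{v + 1..k}. circle_norm (y + of_int n * \<alpha> - a i) \<le> 6 / real (q (s - 6)))
        \<and> c \<le> \<bar>f (y + of_int n * \<alpha>) - f (y' + of_int n * \<alpha>)\<bar>)"
    using strong_visit_jump by (elim exE conjE) (rule that)
  obtain w sg where w: "1 < w" and sg: "\<And>s j. s \<ge> sg \<Longrightarrow> w ^ j * hq s \<le> hq (s + 2 * j)"
    using profile_power_growth by blast
  define K where "K = window_const"
  have K: "0 < K" unfolding K_def by (rule window_const_pos)
  have c2: "0 < c / 2" using c by simp
  show ?thesis
  proof (rule exI[of _ "c / 2"], rule conjI[OF c2], rule exI[of _ "3 * K"], intro allI impI)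
    fix \<tau> :: real assume \<tau>: "0 < \<tau>"
    \<comment> \<open>\<open>\<kappa>1\<close> is the ratio of the scales \<open>q t\<close> and \<open>q s\<close>. Its first bound makes the visit at \<open>n0\<close> a close one at the scale
      \<open>t\<close>. The second one puts at least \<open>2 * J\<close> denominators between the two scales, so that \<open>h\<close> grows by \<open>w ^ J\<close>.\<close>
    obtain J :: nat where J: "4 * r * K / \<tau> < w ^ J" using real_arch_pow[OF w] by blast
    define \<kappa>1 where "\<kappa>1 = min (1 / (12 * C * r ^ 6)) ((1 / r) ^ (2 * J))"
    have r1: "1 < r ^ 6" using r_gt_1 by (simp add: one_less_power)
    have \<kappa>1: "0 < \<kappa>1" "\<kappa>1 \<le> 1 / (12 * C * r ^ 6)" "\<kappa>1 \<le> (1 / r) ^ (2 * J)" "\<kappa>1 \<le> 1"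
    proof -
      show "0 < \<kappa>1" using C_gt r_gt_1 by (simp add: \<kappa>1_def)
      show "\<kappa>1 \<le> 1 / (12 * C * r ^ 6)" and le: "\<kappa>1 \<le> (1 / r) ^ (2 * J)" by (simp_all add: \<kappa>1_def)
      note le
      also have "(1 / r) ^ (2 * J) \<le> 1" using r_gt_1 by (intro power_le_one) auto
      finally show "\<kappa>1 \<le> 1" .
    qed
    define \<kappa> where "\<kappa> = \<kappa>1 / (2 * r)"
    have \<kappa>: "0 < \<kappa>" "\<kappa> \<le> 1" using \<kappa>1 r_gt_1 by (auto simp: \<kappa>_def field_simps)
    define \<omega> where "\<omega> = min 1 (\<tau> * \<kappa> / (4 * K))"
    have \<omega>: "0 < \<omega>" "\<omega> \<le> 1" "\<omega> \<le> \<tau> * \<kappa> / (4 * K)" using \<tau> \<kappa> K by (auto simp: \<omega>_def)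
    define Z where "Z = (1 + r * real (q (max sg 1))) / \<kappa>1"
    obtain s2 where s2: "\<And>s. s \<ge> s2 \<Longrightarrow> weak s \<le> \<omega> * H s \<and> (\<forall>i\<in>{1..v}. rad i s \<le> 1 / 2) \<and> 4 * C \<le> hq s \<and> 1 / \<omega> \<le> hq s \<and> Z \<le> real (q s)"
      using eventually_controlled[OF \<omega>(1), of Z] by blast
    show "\<exists>\<kappa>>0. \<kappa> \<le> 1 \<and> (\<exists>s1. \<forall>s\<ge>s1. drift_at_scale (c / 2) (3 * K) \<kappa> (\<tau> * \<kappa>) s)"
      unfolding drift_at_scale_def
    proof (rule exI[of _ \<kappa>], intro conjI \<kappa>, rule exI[of _ "max s0 s2"], intro allI impI)
      fix s and y y' :: real and D :: "int \<Rightarrow> real"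
      let ?d = "\<bar>y - y'\<bar>"
      assume s: "max s0 s2 \<le> s" and dl: "1 / H (Suc s) < ?d" and du: "?d \<le> 1 / H s"
        and rad: "\<forall>i\<in>{1..v}. \<forall>n. \<bar>n\<bar> \<le> int (q s) \<longrightarrow> 2 * rad i s \<le> circle_norm (y + of_int n * \<alpha> - a i)"
        and D0: "D 0 = 0" and DS: "\<forall>n. D (n + 1) = D n + (f (y + of_int n * \<alpha>) - f (y' + of_int n * \<alpha>))"
      let ?\<Delta> = "\<lambda>n. f (y + of_int n * \<alpha>) - f (y' + of_int n * \<alpha>)"
      have ctl: "weak s \<le> \<omega> * H s" "\<forall>i\<in>{1..v}. rad i s \<le> 1 / 2" "4 * C \<le> hq s" "1 / \<omega> \<le> hq s" "Z \<le> real (q s)"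
        using s2[of s] s by auto
      have dH: "?d * H s \<le> 1" using du H_pos[of s] by (simp add: pos_le_divide_eq)
      have dq: "?d * real (q s) \<le> \<omega>"
      proof -
        have "?d * real (q s) * (1 / \<omega>) \<le> ?d * real (q s) * hq s" using ctl(4) by (intro mult_left_mono) auto
        then have "?d * real (q s) * (1 / \<omega>) \<le> 1" using dH by (simp add: H_def mult.assoc)
        then show ?thesis using \<omega>(1) by (simp add: field_simps)
      qed
      have dweak: "?d * weak s \<le> \<omega>"
      proof -
        have "?d * weak s \<le> ?d * (\<omega> * H s)" using ctl(1) by (intro mult_left_mono) auto
        also have "\<dots> = \<omega> * (?d * H s)" by simp
        also have "\<dots> \<le> \<omega> * 1" using dH \<omega> by (intro mult_left_mono) auto
        finally show ?thesis by simp
      qed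
      have d4: "?d \<le> 1 / (4 * C * real (q s))"
      proof -
        have "4 * C * real (q s) \<le> H s" using ctl(3) by (simp add: H_def mult.commute)
        then have "1 / H s \<le> 1 / (4 * C * real (q s))" using C_gt by (intro frac_le) auto
        then show ?thesis using du by linarith
      qed
      have drad: "\<forall>i\<in>{1..v}. ?d \<le> rad i s"
        using du rad_lower[of _ s] unfolding H_def by (meson le_less_trans less_imp_le)
      \<comment> \<open>Six scales down, all of \<open>{- 4 * Q..<4 * Q}\<close> fits into a single window of length \<open>q s\<close>.\<close>
      define Q where "Q = q (s - 6)"
      have Q8: "8 * Q \<le> q s" using q_power[of 3 "s - 6"] s s06 by (simp add: Q_def)
      have Q1: "1 \<le> Q" using q_pos[of "s - 6"] unfolding Q_def by linarith
      have "\<exists>lo\<in>{0, - 4 * int Q}. \<forall>n\<in>{lo..<lo + 4 * int Q}. \<not> near s (y + of_int n * \<alpha>)"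
      proof (rule ccontr)
        assume "\<not> ?thesis"
        then obtain m n where mn: "n \<in> {0..<0 + 4 * int Q}" "near s (y + of_int n * \<alpha>)"
          "m \<in> {- 4 * int Q..<- 4 * int Q + 4 * int Q}" "near s (y + of_int m * \<alpha>)" by blast
        have "m = n"
          by (rule near_unique[OF mn(4,2), of "- 4 * int Q"]) (use mn Q8 in auto)
        then show False using mn by auto
      qed
      then obtain lo where lo: "lo = 0 \<or> lo = - 4 * int Q" and clear: "\<And>n. n \<in> {lo..<lo + 4 * int Q} \<Longrightarrow> \<not> near s (y + of_int n * \<alpha>)"
        by blast
      \<comment> \<open>The visit is sought in the middle of the clear range, which leaves room for \<open>Q\<close> steps on both sides.\<close>
      define vb where "vb = (if lo = 0 then 2 * int Q else - 3 * int Q)"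
      have vb: "lo \<le> vb - int Q" "vb + 2 * int Q \<le> lo + 4 * int Q" "lo \<le> 0" "0 \<le> lo + 4 * int Q"
        using lo Q1 by (auto simp: vb_def)
      have radn: "\<forall>i\<in>{1..v}. 2 * rad i s \<le> circle_norm (y + of_int n * \<alpha> - a i)" if "n \<in> {lo..<lo + 4 * int Q}" for n
      proof -
        have "\<bar>n\<bar> \<le> int (q s)" using that lo Q8 by auto
        then show ?thesis using rad by blast
      qed
      have "\<exists>n\<in>{vb..<vb + int (q (s - 6))}. (\<exists>i\<in>{v + 1..k}. circle_norm (y + of_int n * \<alpha> - a i) \<le> 6 / real (q (s - 6)))
        \<and> c \<le> \<bar>f (y + of_int n * \<alpha>) - f (y' + of_int n * \<alpha>)\<bar>"
      proof (rule jump[THEN spec, THEN mp, THEN spec, THEN spec, THEN spec, THEN mp, THEN mp, THEN mp, THEN mp])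
        show "s0 \<le> s" using s by simp
        show "\<forall>n\<in>{vb..<vb + int (q (s - 6))}. \<not> near s (y + of_int n * \<alpha>) \<and>
          (\<forall>i\<in>{1..v}. 2 * rad i s \<le> circle_norm (y + of_int n * \<alpha> - a i))"
        proof (intro ballI conjI)
          fix n assume "n \<in> {vb..<vb + int (q (s - 6))}"
          then have "n \<in> {lo..<lo + 4 * int Q}" using vb Q1 unfolding Q_def by auto
          then show "\<not> near s (y + of_int n * \<alpha>)" "\<And>i. i \<in> {1..v} \<Longrightarrow> 2 * rad i s \<le> circle_norm (y + of_int n * \<alpha> - a i)"
            using clear radn by blast+
        qed
      qed (use dl d4 drad in auto)
      then obtain n0 i where n0: "vb \<le> n0" "n0 < vb + int Q" and i: "i \<in> {v + 1..k}" "circle_norm (y + of_int n0 * \<alpha> - a i) \<le> 6 / real Q"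
        and big: "c \<le> \<bar>?\<Delta> n0\<bar>" unfolding Q_def[symmetric] by auto
      have Z: "1 + r * real (q (max sg 1)) \<le> \<kappa>1 * real (q s)"
        using ctl(5) \<kappa>1(1) by (simp add: Z_def pos_divide_le_eq mult.commute)
      have "0 \<le> r * real (q (max sg 1))" using r_gt_1 by simp
      then have "1 \<le> \<kappa>1 * real (q s)" using Z by linarith
      then obtain t where t: "t \<le> s" "real (q t) \<le> \<kappa>1 * real (q s)" "\<kappa>1 * real (q s) < r * real (q t)"
        using smaller_scale[OF \<kappa>1(1,4)] by blast
      have "r * real (q (max sg 1)) < r * real (q t)" using Z t(3) by linarith
      then have "q (max sg 1) < q t" using r_gt_1 by simp
      then have tsg: "sg \<le> t" "1 \<le> t" using strict_mono_less[OF strict_mono_q] by auto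
      have qt2: "2 \<le> q t" using q_mono[OF tsg(2)] q_less_Suc[of 0] by simp
      have t2J: "t + 2 * J \<le> s"
      proof (rule ccontr)
        assume "\<not> t + 2 * J \<le> s"
        then have e: "s - t < 2 * J" "s = t + (s - t)" using t(1) by auto
        have "real (q s) \<le> r ^ (s - t) * real (q t)" using q_le_power[of t "s - t"] e(2) by simp
        also have "\<dots> \<le> r ^ (s - t) * (\<kappa>1 * real (q s))" using t(2) r_gt_1 by (intro mult_left_mono) auto
        finally have "1 * real (q s) \<le> (r ^ (s - t) * \<kappa>1) * real (q s)" by simp
        then have "1 \<le> r ^ (s - t) * \<kappa>1" by (rule mult_right_le_imp_le) simp
        also have "\<dots> \<le> r ^ (s - t) * (1 / r) ^ (2 * J)" using \<kappa>1(3) r_gt_1 by (intro mult_left_mono) auto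
        also have "\<dots> < r ^ (2 * J) * (1 / r) ^ (2 * J)"
          using e(1) r_gt_1 by (intro mult_strict_right_mono power_strict_increasing) auto
        also have "\<dots> = 1" using r_gt_1 by (simp add: power_divide)
        finally show False by simp
      qed
      have CQ: "12 * C * real (q t) \<le> real Q"
      proof -
        have "real (q s) \<le> r ^ 6 * real Q" using q_le_power[of "s - 6" 6] s s06 by (simp add: Q_def)
        then have "\<kappa>1 * real (q s) \<le> 1 / (12 * C * r ^ 6) * (r ^ 6 * real Q)"
          using \<kappa>1 r_gt_1 C_gt by (intro mult_mono) auto
        then have "real (q t) \<le> 1 / (12 * C * r ^ 6) * (r ^ 6 * real Q)" using t(2) by linarith
        then show ?thesis using C_gt r_gt_1 by (simp add: field_simps)
      qed
      have qtQ: "q t \<le> Q"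
      proof -
        have "1 * real (q t) \<le> 12 * C * real (q t)" using C_gt by (intro mult_right_mono) auto
        also note CQ
        finally show ?thesis by simp
      qed
      have near0: "near t (y + of_int n0 * \<alpha>)"
      proof -
        have "6 / real Q \<le> 6 / (12 * C * real (q t))" using CQ C_gt by (intro frac_le) auto
        also have "\<dots> = 1 / (2 * C * real (q t))" by simp
        finally show ?thesis using i unfolding near_def by (intro bexI[of _ i]) auto
      qed
      have small: "(\<Sum>j\<in>I. \<bar>?\<Delta> j\<bar>) \<le> \<tau> * \<kappa>"
        if I: "I \<subseteq> {b..<b + int (q t)}" "I \<subseteq> {lo..<lo + 4 * int Q}" "n0 \<notin> I" "n0 \<in> {b..<b + int (q t)}" for I b
      proof -
        have "(\<Sum>j\<in>I. \<bar>?\<Delta> j\<bar>) \<le> ?d * (K * (real (q t) + H t + weak s))"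
          unfolding K_def
        proof (rule window_variation[OF t(1) I(1) d4])
          show "\<forall>i\<in>{1..v}. ?d \<le> rad i s \<and> rad i s \<le> 1 / 2" using drad ctl(2) by blast
          show "\<forall>n\<in>I. \<not> near t (y + of_int n * \<alpha>) \<and> (\<forall>i\<in>{1..v}. 2 * rad i s \<le> circle_norm (y + of_int n * \<alpha> - a i))"
            using near_unique[OF _ near0 _ I(4)] I radn by blast
        qed
        also have "\<dots> = K * (?d * real (q t) + ?d * H t + ?d * weak s)" by (simp add: algebra_simps)
        also have "\<dots> \<le> K * (\<omega> + \<kappa>1 / w ^ J + \<omega>)"
        proof (intro mult_left_mono add_mono dweak)
          have "?d * real (q t) \<le> ?d * real (q s)" using q_mono[OF t(1)] by (intro mult_left_mono) auto
          then show "?d * real (q t) \<le> \<omega>" using dq by linarith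
          have "w ^ J * hq t \<le> hq s" using sg[OF tsg(1), of J] hq_mono[OF t2J] by linarith
          then have "hq t \<le> hq s / w ^ J" using w by (simp add: pos_le_divide_eq mult.commute)
          then have "H t \<le> (\<kappa>1 * real (q s)) * (hq s / w ^ J)"
            unfolding H_def using t(2) hq_pos[of t] \<kappa>1(1) by (intro mult_mono) auto
          then have "?d * H t \<le> ?d * ((\<kappa>1 * real (q s)) * (hq s / w ^ J))" by (intro mult_left_mono) auto
          also have "\<dots> = \<kappa>1 / w ^ J * (?d * H s)" by (simp add: H_def)
          also have "\<dots> \<le> \<kappa>1 / w ^ J * 1" using dH \<kappa>1 w by (intro mult_left_mono) auto
          finally show "?d * H t \<le> \<kappa>1 / w ^ J" by simp
        qed (use K in simp)
        also have "\<dots> = 2 * (K * \<omega>) + K * (\<kappa>1 / w ^ J)" by (simp add: algebra_simps)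
        also have "\<dots> \<le> \<tau> * \<kappa> / 2 + \<tau> * \<kappa> / 2"
        proof (rule add_mono)
          have "K * \<omega> \<le> K * (\<tau> * \<kappa> / (4 * K))" using \<omega>(3) K by (intro mult_left_mono) auto
          then show "2 * (K * \<omega>) \<le> \<tau> * \<kappa> / 2" using K by simp
          have "K / w ^ J \<le> \<tau> / (4 * r)" using J \<tau> w r_gt_1 by (simp add: field_simps)
          then have "\<kappa>1 * (K / w ^ J) \<le> \<kappa>1 * (\<tau> / (4 * r))" using \<kappa>1 by (intro mult_left_mono) auto
          then show "K * (\<kappa>1 / w ^ J) \<le> \<tau> * \<kappa> / 2" by (simp add: \<kappa>_def mult.commute)
        qed
        finally show ?thesis by linarith
      qed
      have D_bound: "\<bar>D m\<bar> \<le> 3 * K" if m: "lo \<le> m" "m \<le> lo + 4 * int Q" for m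
      proof -
        have "\<bar>D m\<bar> \<le> (\<Sum>j\<in>{lo..<lo + 4 * int Q}. \<bar>?\<Delta> j\<bar>)"
        proof (cases "0 \<le> m")
          case True
          then show ?thesis
            using telescoping_bound[of D ?\<Delta> "{lo..<lo + 4 * int Q}" 0 m] DS D0 m vb by auto
        next
          case False
          then show ?thesis
            using telescoping_bound[of D ?\<Delta> "{lo..<lo + 4 * int Q}" m 0] DS D0 m vb by auto
        qed
        also have "\<dots> \<le> ?d * (K * (real (q s) + H s + weak s))"
          unfolding K_def
        proof (rule window_variation[OF order_refl _ d4])
          show "{lo..<lo + 4 * int Q} \<subseteq> {lo..<lo + int (q s)}" using Q8 by auto
          show "\<forall>i\<in>{1..v}. ?d \<le> rad i s \<and> rad i s \<le> 1 / 2" using drad ctl(2) by blast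
          show "\<forall>n\<in>{lo..<lo + 4 * int Q}. \<not> near s (y + of_int n * \<alpha>) \<and> (\<forall>i\<in>{1..v}. 2 * rad i s \<le> circle_norm (y + of_int n * \<alpha> - a i))"
            using clear radn by blast
        qed
        also have "\<dots> = K * (?d * real (q s) + ?d * H s + ?d * weak s)" by (simp add: algebra_simps)
        also have "\<dots> \<le> K * 3" using dq dH dweak \<omega>(2) K by (intro mult_left_mono) auto
        finally show ?thesis by simp
      qed
      define L where "L = q t - 1"
      have L: "int L = int (q t) - 1" using qt2 by (simp add: L_def of_nat_diff)
      have \<kappa>L: "\<kappa> * real Q \<le> real L"
      proof -
        have "\<kappa> * real Q \<le> \<kappa> * real (q s)" using Q8 \<kappa>(1) by (intro mult_left_mono) auto
        also have "\<dots> = \<kappa>1 * real (q s) / (2 * r)" by (simp add: \<kappa>_def)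
        also have "\<dots> \<le> r * real (q t) / (2 * r)" using t(3) r_gt_1 by (intro divide_right_mono) auto
        also have "\<dots> = real (q t) / 2" using r_gt_1 by simp
        also have "\<dots> \<le> real L" using qt2 by (simp add: L_def of_nat_diff)
        finally show ?thesis .
      qed
      have win: "int Q \<le> b \<and> b + int L \<le> 4 * int Q \<or> - 4 * int Q \<le> b \<and> b + int L \<le> - int Q"
        if "vb - int Q \<le> b" "b + int L \<le> vb + 2 * int Q" for b
        using that lo Q1 by (auto simp: vb_def split: if_splits)
      have sQ: "s - 7 < Q" using q_ge_index[of "s - 6"] Q1 unfolding Q_def by linarith
      have "D (n0 + 1) - D n0 = ?\<Delta> n0" using DS by simp
      then have "c / 2 \<le> \<bar>D (n0 + 1)\<bar> \<or> c / 2 \<le> \<bar>D n0\<bar>" using big by linarith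
      then show "drifts (c / 2) (3 * K) \<kappa> (\<tau> * \<kappa>) (s - 7) D"
      proof
        assume p: "c / 2 \<le> \<bar>D (n0 + 1)\<bar>"
        have "\<bar>D n - D (n0 + 1)\<bar> \<le> \<tau> * \<kappa>" if n: "n \<in> {n0 + 1..n0 + 1 + int L}" for n
        proof -
          have "\<bar>D n - D (n0 + 1)\<bar> \<le> (\<Sum>j\<in>{n0 + 1..<n0 + int (q t)}. \<bar>?\<Delta> j\<bar>)"
            using n L by (intro telescoping_bound) (auto simp: DS)
          also have "\<dots> \<le> \<tau> * \<kappa>" using n0 vb qtQ qt2 by (intro small[of _ n0]) auto
          finally show ?thesis .
        qed
        moreover have "\<bar>D (n0 + 1)\<bar> \<le> 3 * K" using n0 vb Q1 by (intro D_bound) auto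
        moreover have "int Q \<le> n0 + 1 \<and> n0 + 1 + int L \<le> 4 * int Q \<or> - 4 * int Q \<le> n0 + 1 \<and> n0 + 1 + int L \<le> - int Q"
          using n0 qtQ L by (intro win) auto
        ultimately show ?thesis unfolding drifts_def using sQ \<kappa>L p by blast
      next
        assume p: "c / 2 \<le> \<bar>D n0\<bar>"
        let ?b = "n0 + 1 - int (q t)"
        have "\<bar>D n - D n0\<bar> \<le> \<tau> * \<kappa>" if n: "n \<in> {?b..?b + int L}" for n
        proof -
          have "\<bar>D n0 - D n\<bar> \<le> (\<Sum>j\<in>{?b..<n0}. \<bar>?\<Delta> j\<bar>)"
            using n L by (intro telescoping_bound) (auto simp: DS)
          also have "\<dots> \<le> \<tau> * \<kappa>" using n0 vb qtQ qt2 by (intro small[of _ ?b]) auto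
          finally show ?thesis by (simp add: abs_minus_commute)
        qed
        moreover have "\<bar>D n0\<bar> \<le> 3 * K" using n0 vb Q1 by (intro D_bound) auto
        moreover have "int Q \<le> ?b \<and> ?b + int L \<le> 4 * int Q \<or> - 4 * int Q \<le> ?b \<and> ?b + int L \<le> - int Q"
          using n0 qtQ L Q1 by (intro win) auto
        ultimately show ?thesis unfolding drifts_def using sQ \<kappa>L p by blast
      qed
    qed
  qed
qed

end

section \<open>Typical points and the conclusion\<close>

context drifting_roof
begin

text \<open>
  \<open>f\<close> is bounded below on some arc, which is visited in each block of \<open>q s\<close> steps if \<open>s\<close> is large.
\<close>

lemma sum_f_growth: "\<exists>c>0. \<exists>n0. \<forall>n\<ge>n0. \<forall>x. c * real n \<le> (\<Sum>i<n. f (x + real i * \<alpha>))"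
proof -
  have "infinite ({0<..<1::real} - a ` {1..k})" by (intro Diff_infinite_finite) auto
  then have "{0<..<1} - a ` {1..k} \<noteq> {}" by (metis finite.emptyI)
  then obtain p where p: "p \<in> {0<..<1} - a ` {1..k}" by blast
  have "p - a i \<notin> \<int>" if i: "i \<in> {1..k}" for i
  proof
    assume "p - a i \<in> \<int>"
    moreover have "\<bar>p - a i\<bar> < 1" using p sing_in[OF i] by auto
    ultimately have "p = a i" by (metis Ints_nonzero_abs_less1 eq_iff_diff_eq_0)
    then show False using p i by auto
  qed
  then have "p \<in> regular" by blast
  then have "isCont f p" using f_continuous open_regular by (simp add: continuous_on_eq_continuous_at)
  then have "\<forall>\<^sub>F z in nhds p. f p / 2 < f z"
    using positive[of p] by (intro order_tendstoD(1)[of f "f p"]) (auto simp: isCont_def tendsto_at_iff_tendsto_nhds)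
  then obtain e where e: "0 < e" "\<And>z. dist z p < e \<Longrightarrow> f p / 2 < f z"
    by (auto simp: eventually_nhds_metric)
  obtain s :: nat where s: "6 / e < real s" using reals_Archimedean2 by blast
  define Q where "Q = q s"
  have Q: "0 < Q" "6 / real Q < e"
  proof -
    show "0 < Q" by (simp add: Q_def)
    have "6 / e < real Q" using s q_ge_index[of s] by (simp add: Q_def)
    then show "6 / real Q < e" using e(1) \<open>0 < Q\<close> by (simp add: field_simps)
  qed
  have block: "f p / 2 \<le> (\<Sum>i<Q. f (x + real i * \<alpha>))" for x
  proof -
    obtain n z where n: "n \<in> {0..<0 + int Q}" and z: "p < x + of_int n * \<alpha> - of_int z" "x + of_int n * \<alpha> - of_int z < p + 6 / real Q"
      using orbit_visits[of 0 s p x] unfolding Q_def by blast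
    have "f p / 2 < f (x + of_int n * \<alpha> - of_int z)" using z Q by (intro e(2)) (auto simp: dist_real_def)
    then have "f p / 2 < f (x + real (nat n) * \<alpha>)" using f_add_int[of "x + of_int n * \<alpha> - of_int z" z] n by simp
    also have "\<dots> \<le> (\<Sum>i<Q. f (x + real i * \<alpha>))"
      using n positive by (intro member_le_sum[of "nat n" "{..<Q}" "\<lambda>i. f (x + real i * \<alpha>)"]) (auto intro: less_imp_le)
    finally show ?thesis by simp
  qed
  have blocks: "real m * (f p / 2) \<le> (\<Sum>i<m * Q. f (x + real i * \<alpha>))" for m x
  proof (induction m)
    case (Suc m)
    have "(\<Sum>i<l + j. f (x + real i * \<alpha>)) = (\<Sum>i<l. f (x + real i * \<alpha>)) + (\<Sum>i<j. f ((x + real l * \<alpha>) + real i * \<alpha>))" for l j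
      by (induction j) (auto simp: algebra_simps)
    from this[of "m * Q" Q] show ?case
      using Suc block[of "x + real (m * Q) * \<alpha>"] by (simp add: algebra_simps)
  qed simp
  have "f p / (4 * real Q) * real n \<le> (\<Sum>i<n. f (x + real i * \<alpha>))" if n: "Q \<le> n" for n x
  proof -
    have "n < Suc (n div Q) * Q" using dividend_less_div_times[OF Q(1), of n] by simp
    moreover have "1 \<le> n div Q" using n Q(1) by (simp add: Suc_le_eq div_greater_zero_iff)
    then have "Suc (n div Q) * Q \<le> (2 * (n div Q)) * Q" by (intro mult_right_mono) auto
    ultimately have "n \<le> 2 * (n div Q) * Q" by linarith
    then have "real n \<le> real (2 * (n div Q) * Q)" by (rule of_nat_mono)
    then have "f p / (4 * real Q) * real n \<le> f p / (4 * real Q) * real (2 * (n div Q) * Q)"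
      using positive[of p] by (intro mult_left_mono) auto
    also have "\<dots> = real (n div Q) * (f p / 2)" using Q(1) by (simp add: field_simps)
    also have "\<dots> \<le> (\<Sum>i<n div Q * Q. f (x + real i * \<alpha>))" by (rule blocks)
    also have "\<dots> \<le> (\<Sum>i<n. f (x + real i * \<alpha>))"
      using positive by (intro sum_mono2) (auto intro: less_imp_le less_le_trans[OF _ div_times_less_eq_dividend])
    finally show ?thesis .
  qed
  moreover have "0 < f p / (4 * real Q)" using positive[of p] Q(1) by simp
  ultimately show ?thesis by blast
qed

sublocale rotation_flow \<alpha> f
  by unfold_locales (use irrational periodic positive L1 sum_f_growth in auto)

text \<open>
  Borel--Cantelli: the points with such a visit to \<open>a i\<close> at scale \<open>s\<close> have measure of order \<open>q s * rad i s\<close>.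
\<close>

lemma weak_visits_rare:
  assumes \<tau>: "0 < \<tau>"
  shows "\<exists>X0 s1. X0 \<in> sets circle_measure \<and> 1 - \<tau> < measure circle_measure X0 \<and>
    (\<forall>x\<in>X0. \<forall>s\<ge>s1. \<forall>i\<in>{1..v}. \<forall>n. \<bar>n\<bar> \<le> int (q s) \<longrightarrow> 2 * rad i s \<le> circle_norm (x + of_int n * \<alpha> - a i))"
proof -
  interpret P: prob_space circle_measure by (rule prob_space_circle_measure)
  define V where "V i s n = {x \<in> space circle_measure. circle_norm (x + (of_int n * \<alpha> - a i)) < 2 * rad i s}" for i s n
  have rad0: "0 < rad i s" if "i \<in> {1..v}" for i s using rad_in[OF that, of s] by simp
  have V: "V i s n \<in> sets circle_measure" "measure circle_measure (V i s n) \<le> 4 * rad i s" if "i \<in> {1..v}" for i s n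
    using measure_arc[of "2 * rad i s" "of_int n * \<alpha> - a i"] rad0[OF that, of s] by (simp_all add: V_def)
  define W where "W s = (\<Union>i\<in>{1..v}. \<Union>n\<in>{- int (q s)..int (q s)}. V i s n)" for s
  define bnd where "bnd s = (\<Sum>i\<in>{1..v}. 12 * (real (q s) * rad i s))" for s
  have Ws: "W s \<in> sets circle_measure" for s unfolding W_def using V(1) by (intro sets.finite_UN) auto
  have Wm: "measure circle_measure (W s) \<le> bnd s" for s
  proof -
    have "measure circle_measure (W s) \<le> (\<Sum>i\<in>{1..v}. measure circle_measure (\<Union>n\<in>{- int (q s)..int (q s)}. V i s n))"
      unfolding W_def using V(1) by (intro P.finite_measure_subadditive_finite) (auto intro!: sets.finite_UN)
    also have "\<dots> \<le> bnd s" unfolding bnd_def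
    proof (rule sum_mono)
      fix i assume i: "i \<in> {1..v}"
      have "measure circle_measure (\<Union>n\<in>{- int (q s)..int (q s)}. V i s n) \<le> (\<Sum>n\<in>{- int (q s)..int (q s)}. measure circle_measure (V i s n))"
        using V(1)[OF i] by (intro P.finite_measure_subadditive_finite) auto
      also have "\<dots> \<le> (\<Sum>n\<in>{- int (q s)..int (q s)}. 4 * rad i s)" using V(2)[OF i] by (intro sum_mono)
      also have "\<dots> = real (2 * q s + 1) * (4 * rad i s)" by simp
      also have "\<dots> \<le> (3 * real (q s)) * (4 * rad i s)"
        using q_ge_1[of s] rad0[OF i, of s] by (intro mult_right_mono) auto
      finally show "measure circle_measure (\<Union>n\<in>{- int (q s)..int (q s)}. V i s n) \<le> 12 * (real (q s) * rad i s)" by simp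
    qed
    finally show ?thesis .
  qed
  have sb: "summable bnd" unfolding bnd_def[abs_def] by (intro summable_sum summable_mult rad_summable)
  obtain s1 where s1: "norm (\<Sum>j. bnd (j + s1)) < \<tau>" using suminf_exist_split[OF \<tau> sb] by blast
  have sb1: "summable (\<lambda>j. bnd (j + s1))" using sb by (simp add: summable_iff_shift)
  have sm: "summable (\<lambda>j. measure circle_measure (W (j + s1)))"
    by (rule summable_comparison_test'[OF sb1]) (use Wm in simp)
  define U where "U = (\<Union>j. W (j + s1))"
  have Us: "U \<in> sets circle_measure" unfolding U_def using Ws by auto
  have "measure circle_measure U \<le> (\<Sum>j. measure circle_measure (W (j + s1)))"
    unfolding U_def using Ws sm by (intro P.finite_measure_subadditive_countably) auto
  also have "\<dots> \<le> (\<Sum>j. bnd (j + s1))" using Wm sm sb1 by (intro suminf_le) auto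
  finally have Um: "measure circle_measure U < \<tau>" using s1 by simp
  define X0 where "X0 = space circle_measure - U"
  have "X0 \<in> sets circle_measure" unfolding X0_def using Us by (rule sets.compl_sets)
  moreover have "1 - \<tau> < measure circle_measure X0" unfolding X0_def P.prob_compl[OF Us] using Um by simp
  moreover have "2 * rad i s \<le> circle_norm (x + of_int n * \<alpha> - a i)"
    if "x \<in> X0" "s \<ge> s1" "i \<in> {1..v}" "\<bar>n\<bar> \<le> int (q s)" for x s i n
  proof (rule ccontr)
    assume "\<not> 2 * rad i s \<le> circle_norm (x + of_int n * \<alpha> - a i)"
    then have "x \<in> V i s n" using that(1) by (simp add: V_def X0_def add_diff_eq)
    moreover have "n \<in> {- int (q s)..int (q s)}" using that(4) by auto
    ultimately have "x \<in> W s" unfolding W_def using that(3) by blast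
    then have "x \<in> W ((s - s1) + s1)" using that(2) by simp
    then have "x \<in> U" unfolding U_def by blast
    then show False using that(1) by (simp add: X0_def)
  qed
  ultimately show ?thesis by blast
qed

text \<open>
  \<open>H\<close> is unbounded, so some scale \<open>s \<ge> S\<close> satisfies the first condition; the least one satisfies the second.
\<close>

lemma scale_of_distance:
  assumes "0 < d" "d \<le> 1 / H S"
  shows "\<exists>s\<ge>S. 1 / H (Suc s) < d \<and> d \<le> 1 / H s"
proof -
  define P where "P s \<longleftrightarrow> S \<le> s \<and> 1 / H (Suc s) < d" for s
  obtain s0 where s0: "\<And>s. s \<ge> s0 \<Longrightarrow> 1 / d + 1 \<le> hq s" using hq_eventually_ge[of "1 / d + 1"] by blast
  have "P (max S s0)"
  proof -
    have "1 / d + 1 \<le> hq (Suc (max S s0))" by (rule s0) simp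
    also have "hq (Suc (max S s0)) = 1 * hq (Suc (max S s0))" by simp
    also have "\<dots> \<le> H (Suc (max S s0))"
      unfolding H_def using q_ge_1[of "Suc (max S s0)"] hq_pos[of "Suc (max S s0)"] by (intro mult_right_mono) auto
    finally have "1 / d < H (Suc (max S s0))" by linarith
    then have "1 / H (Suc (max S s0)) < d" using assms(1) H_pos[of "Suc (max S s0)"] by (simp add: field_simps)
    then show ?thesis by (simp add: P_def)
  qed
  then have L: "P (LEAST s. P s)" by (rule LeastI)
  define s where "s = (LEAST s. P s)"
  have s: "S \<le> s" "1 / H (Suc s) < d" using L by (simp_all add: P_def s_def)
  have "d \<le> 1 / H s"
  proof (cases "s = S")
    case False
    then have "\<not> P (s - 1)" using s(1) unfolding s_def by (intro not_less_Least) auto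
    then show ?thesis using False s(1) by (auto simp: P_def not_less)
  qed (use assms in simp)
  then show ?thesis using s by blast
qed

theorem SWR_drifting_roof: "SWR_property flow_measure (special_flow_dist circle_dist) flow"
proof -
  obtain c1 c2 where c1: "0 < c1"
    and dr: "\<forall>\<tau>>0. \<exists>\<kappa>>0. \<kappa> \<le> 1 \<and> (\<exists>s1. \<forall>s\<ge>s1. drift_at_scale c1 c2 \<kappa> (\<tau> * \<kappa>) s)"
    using drift by blast
  have cont: "continuous_on ({0..<1} - a ` {1..k}) f"
  proof (rule continuous_on_subset[OF f_continuous], rule subsetI, rule CollectI, rule ballI, rule notI)
    fix p i assume p: "p \<in> {0..<1} - a ` {1..k}" and i: "i \<in> {1..k}" and int: "p - a i \<in> \<int>"
    have "\<bar>p - a i\<bar> < 1" using p sing_in[OF i] by auto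
    then have "p = a i" using int by (metis Ints_nonzero_abs_less1 eq_iff_diff_eq_0)
    then show False using p i by auto
  qed
  have "birkhoff_drift c1 c2"
    unfolding birkhoff_drift_def
  proof (intro allI impI)
    fix \<tau> :: real assume \<tau>: "0 < \<tau>"
    obtain \<kappa> s1 where \<kappa>: "0 < \<kappa>" "\<kappa> \<le> 1" and at_scale: "\<And>s. s \<ge> s1 \<Longrightarrow> drift_at_scale c1 c2 \<kappa> (\<tau> * \<kappa>) s"
      using dr \<tau> by blast
    obtain X0 s2 where X0: "X0 \<in> sets circle_measure" "1 - \<tau> < measure circle_measure X0"
      and clear: "\<forall>x\<in>X0. \<forall>s\<ge>s2. \<forall>i\<in>{1..v}. \<forall>n. \<bar>n\<bar> \<le> int (q s) \<longrightarrow> 2 * rad i s \<le> circle_norm (x + of_int n * \<alpha> - a i)"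
      using weak_visits_rare[OF \<tau>] by (elim exE conjE) (rule that)
    have X0sub: "X0 \<subseteq> {0..<1}" using sets.sets_into_space[OF X0(1)] by simp
    show "\<exists>\<kappa> X0. 0 < \<kappa> \<and> \<kappa> \<le> 1 \<and> X0 \<in> sets circle_measure \<and> 1 - \<tau> < measure circle_measure X0 \<and>
      (\<forall>N::nat. \<exists>\<delta>>0. \<forall>x\<in>X0. \<forall>y\<in>X0. x \<noteq> y \<longrightarrow> circle_dist x y < \<delta> \<longrightarrow>
        drifts c1 c2 \<kappa> (\<tau> * \<kappa>) N (\<lambda>n. birk n x - birk n y))"
    proof (rule exI[of _ \<kappa>], rule exI[of _ X0], intro conjI \<kappa> X0 allI)
      fix N :: nat
      define S where "S = max s1 (max s2 (N + 7))"
      show "\<exists>\<delta>>0. \<forall>x\<in>X0. \<forall>y\<in>X0. x \<noteq> y \<longrightarrow> circle_dist x y < \<delta> \<longrightarrow>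
        drifts c1 c2 \<kappa> (\<tau> * \<kappa>) N (\<lambda>n. birk n x - birk n y)"
      proof (rule exI[of _ "1 / H S"], intro conjI ballI impI)
        show "0 < 1 / H S" using H_pos[of S] by simp
        fix x y assume xy: "x \<in> X0" "y \<in> X0" "x \<noteq> y" "circle_dist x y < 1 / H S"
        obtain z where z: "circle_dist x y = \<bar>x - y - of_int z\<bar>"
          unfolding circle_dist_def using circle_norm_attained by blast
        define y' where "y' = y + of_int z"
        have d: "\<bar>x - y'\<bar> = circle_dist x y" by (simp add: z y'_def algebra_simps)
        have "x \<in> {0..<1}" "y \<in> {0..<1}" using xy X0sub by auto
        then have "circle_dist x y \<noteq> 0" using Metric_space.zero[OF Metric_space_circle] xy(3) by blast
        then have "0 < \<bar>x - y'\<bar>" "\<bar>x - y'\<bar> \<le> 1 / H S" using d xy(4) by auto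
        then obtain s where s: "S \<le> s" "1 / H (Suc s) < \<bar>x - y'\<bar>" "\<bar>x - y'\<bar> \<le> 1 / H s"
          using scale_of_distance by blast
        have by': "birk n y' = birk n y" for n
          using birk_frac[of n y'] birk_frac[of n y] by (simp add: y'_def)
        have "drifts c1 c2 \<kappa> (\<tau> * \<kappa>) (s - 7) (\<lambda>n. birk n x - birk n y')"
        proof (rule at_scale[unfolded drift_at_scale_def, THEN spec, THEN spec, THEN spec, of _ _ _ "\<lambda>n. birk n x - birk n y'",
              THEN mp, THEN mp, THEN mp, THEN mp, THEN mp])
          show "s1 \<le> s" using s(1) by (simp add: S_def)
          show "\<forall>i\<in>{1..v}. \<forall>n. \<bar>n\<bar> \<le> int (q s) \<longrightarrow> 2 * rad i s \<le> circle_norm (x + of_int n * \<alpha> - a i)"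
            using clear xy(1) s(1) by (simp add: S_def)
          show "\<forall>n. birk (n + 1) x - birk (n + 1) y' = birk n x - birk n y' + (f (x + of_int n * \<alpha>) - f (y' + of_int n * \<alpha>))"
            by (simp add: birk_Suc)
        qed (use s in auto)
        moreover have "N \<le> s - 7"
        proof -
          have "N + 7 \<le> s" using s(1) by (simp add: S_def)
          then show ?thesis by linarith
        qed
        ultimately show "drifts c1 c2 \<kappa> (\<tau> * \<kappa>) N (\<lambda>n. birk n x - birk n y)"
          unfolding by' by (rule drifts_antimono[rotated])
      qed
    qed
  qed
  then show ?thesis by (rule SWR_of_drift[OF finite_imageI[OF finite_atLeastAtMost] cont c1])
qed

end

theorem theorem3:
  fixes \<alpha> C D1 D2 :: real
    and q :: "nat \<Rightarrow> nat"
    and f h :: "real \<Rightarrow> real"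
    and k v :: nat
    and a A B :: "nat \<Rightarrow> real"
    and g :: "nat \<Rightarrow> real \<Rightarrow> real"
    and A' B' :: "nat \<Rightarrow> real"
    and x :: "nat \<Rightarrow> nat \<Rightarrow> real"
  assumes irrational: "\<alpha> \<notin> \<rat>"
    and denominators: "denominators \<alpha> q"
    and bounded_type: "bounded_partial_quotients q"
    and sing_in: "\<And>i. i \<in> {1..k} \<Longrightarrow> a i \<in> {0..<1}"
    and sing_distinct: "inj_on a {1..k}"
    and periodic: "\<And>y. f (y + 1) = f y"
    and C2: "C2_on {y. \<forall>i\<in>{1..k}. y - a i \<notin> \<int>} f"
    and positive: "\<And>y. 0 < f y"
    and L1: "integrable circle_measure f"
    and h_profile: "singular_profile h"
    and h_limit: "filterlim h at_top (at_right 0)"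
    and type_h: "\<And>i. i \<in> {1..k} \<Longrightarrow> has_singularity_of_type f h (a i) (A i) (B i)"
    and E_nonempty: "v < k"
    and E_strong: "\<And>i. i \<in> {v + 1..k} \<Longrightarrow> (A i)\<^sup>2 + (B i)\<^sup>2 > 0"
    and g_profile: "\<And>i. i \<in> {1..v} \<Longrightarrow> singular_profile (g i)"
    and type_g: "\<And>i. i \<in> {1..v} \<Longrightarrow> has_singularity_of_type f (g i) (a i) (A' i) (B' i)"
    and g_right: "\<And>i. i \<in> {1..v} \<Longrightarrow>
           \<exists>l. ((\<lambda>y. \<bar>deriv f y / deriv (g i) (y - a i)\<bar>) \<longlongrightarrow> l) (at_right (a i))"
    and g_left: "\<And>i. i \<in> {1..v} \<Longrightarrow>
           \<exists>l. ((\<lambda>y. \<bar>deriv f y / deriv (g i) (a i - y)\<bar>) \<longlongrightarrow> l) (at_left (a i))"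
    and g_small: "\<And>i. i \<in> {1..v} \<Longrightarrow> ((\<lambda>y. g i y / h y) \<longlongrightarrow> 0) (at_right 0)"
    and x_in: "\<And>i s. i \<in> {1..v} \<Longrightarrow> x i s \<in> {0<..<1}"
    and x_lower: "\<And>i s. i \<in> {1..v} \<Longrightarrow>
           x i s > 1 / (real (q s) * h (1 / (2 * real (q s))))"
    and x_deriv: "\<And>i. i \<in> {1..v} \<Longrightarrow>
           (\<lambda>s. deriv (g i) (x i s) / deriv h (1 / (2 * real (q s)))) \<longlonglongrightarrow> 0"
    and x_summable: "\<And>i. i \<in> {1..v} \<Longrightarrow> summable (\<lambda>s. real (q s) * x i s)"
    and C_gt: "C > 1"
    and E_badly: "badly_approximable \<alpha> q (a ` {v + 1..k}) C"
    and D_pos: "D1 > 0" "D2 > 0"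
    and D_upper: "\<And>s. D2 > - deriv h (1 / (C ^ 4 * real (q s))) /
                         (real (q s) * h (1 / (2 * real (q s))))"
    and D_lower: "\<And>s. - deriv h (1 / (C ^ 4 * real (q s))) /
                         (real (q s) * h (1 / (2 * real (q s)))) > D1"
    and h_ratio: "\<And>s. h (1 / (2 * real (q s))) / h (1 / (2 * real (q (Suc s)))) > D1"
  shows "SWR_property (special_flow_measure circle_measure f) (special_flow_dist circle_dist)
           (special_flow (space circle_measure) (rotation \<alpha>) f)"
proof -
  obtain r where r: "\<And>n. real (q (Suc n)) < r * real (q n)"
    using bounded_type unfolding bounded_partial_quotients_def by blast
  \<comment> \<open>Each weak singularity is measured by its own profile, and the strong ones by \<open>h\<close>.\<close>
  define G where "G i = (if i \<le> v then g i else h)" for i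
  define A2 where "A2 i = (if i \<le> v then A' i else A i)" for i
  define B2 where "B2 i = (if i \<le> v then B' i else B i)" for i
  have G: "singular_profile (G i)" "has_singularity_of_type f (G i) (a i) (A2 i) (B2 i)" if "i \<in> {1..k}" for i
    using that g_profile[of i] h_profile type_g[of i] type_h[of i] by (auto simp: G_def A2_def B2_def)
  have strong: "G i = h" "(A2 i)\<^sup>2 + (B2 i)\<^sup>2 > 0" if "i \<in> {v + 1..k}" for i
    using that E_strong[of i] by (auto simp: G_def A2_def B2_def)
  have weak: "((\<lambda>y. G i y / h y) \<longlongrightarrow> 0) (at_right 0)"
    "(\<lambda>s. deriv (G i) (x i s) / deriv h (1 / (2 * real (q s)))) \<longlonglongrightarrow> 0" if "i \<in> {1..v}" for i
    using that g_small[of i] x_deriv[of i] by (simp_all add: G_def)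
  have "drifting_roof \<alpha> q r h C D1 D2 f k a G A2 B2 v x"
    by unfold_locales
      (fact irrational denominators r h_profile h_limit C_gt D_pos D_upper D_lower h_ratio periodic C2 G positive L1
        sing_in E_nonempty strong E_badly weak x_in x_lower x_summable)+
  then interpret drifting_roof \<alpha> q r h C D1 D2 f k a G A2 B2 v x .
  show ?thesis using SWR_drifting_roof by simp
qed

end
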